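(* Let $\mathbb V$ be an $\mathbb N$-graded $C_2$-cofinite vertex operator algebra. Assume that there exists a module in $\mathrm{Mod}(\mathbb V)$ that is not lowest generated. Then there exist $\mathbb X,\mathbb Y\in\mathrm{Mod}(\mathbb V)$ such that $$\dim \mathscr T^*_{\mathfrak N}(\mathbb X\otimes\mathbb Y)\neq \dim \mathscr T^*_{\mathfrak B}(\mathbb X\otimes \mathbb Y),$$ where $\mathscr T^*_{\mathfrak N}$ denotes the space of smooth conformal blocks on the 2-pointed smooth sphere $\mathfrak N$ and $\mathscr T^*_{\mathfrak B}$ denotes the space of nodal conformal blocks on the 2-pointed nodal sphere $\mathfrak B$.
   Context: All spaces are over $\mathbb C$. $\mathbb V=\bigoplus_{n\in\mathbb N}\mathbb V(n)$ is an $\mathbb N$-graded $C_2$-cofinite vertex operator algebra with conformal vector $\mathbf c$ and vacuum $\mathbf 1$; nonzero $v\in\mathbb V(n)$ is homogeneous of weight $\mathrm{wt}(v)=n$. For each $N$, $\mathrm{Mod}(\mathbb V^{\otimes N})$ is the (abelian) category of grading-restricted generalized $\mathbb V^{\otimes N}$-modules: weak modules $\mathbb W=\bigoplus_{\lambda_\bullet\in\mathbb C^N}\mathbb W_{[\lambda_\bullet]}$, with $\mathbb W_{[\lambda_\bullet]}$ the joint generalized eigenspaces of the operators $L_1(0),\dots,L_N(0)$ (one for each tensor factor), such that the sum of all $\mathbb W_{[\mu_\bullet]}$ with $\mathrm{Re}(\mu_i)\le \mathrm{Re}(\lambda_i)$ for all $i$ is finite dimensional for each $\lambda_\bullet$.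 Write $Y(v,z)=\sum_{n\in\mathbb Z}Y(v)_nz^{-n-1}$ and $Y'(v,z)=Y(e^{zL(1)}(-z^{-2})^{L(0)}v,z^{-1})=\sum_{n}Y'(v)_nz^{-n-1}$. For $\mathbb W\in\mathrm{Mod}(\mathbb V^{\otimes 2})$ set $Y_+(v,z)=Y(v\otimes\mathbf 1,z)$, $Y_-(v,z)=Y(\mathbf 1\otimes v,z)$, and define modes $Y_\pm(v)_n$, $Y_\pm'(v)_n$ similarly. Lowest generated: for a weak $\mathbb V$-module $\mathbb X$, $\Omega(\mathbb X)=\{w\in\mathbb X: Y(v)_nw=0$ for all homogeneous $v\in\mathbb V$ and $n\in\mathbb Z$ with $\mathrm{wt}(v)-n-1<0\}$. $\mathbb X$ is lowest generated if it is generated by $\Omega(\mathbb X)$ as a $\mathbb V$-module. Smooth conformal blocks: $\mathfrak N=(\mathbb P^1\,|\,\infty,0;1/\zeta,\zeta)$, with $\zeta$ the standard coordinate of $\mathbb C$. For $\mathbb X,\mathbb Y\in\mathrm{Mod}(\mathbb V)$ (attached to $\infty$ and $0$ respectively), $\mathscr T^*_{\mathfrak N}(\mathbb X\otimes\mathbb Y)$ is the space of linear functionals $\psi:\mathbb X\otimes\mathbb Y\to\mathbb C$ such that $\psi(Y(v,z)x\otimes y)=\psi(x\otimes Y'(v,z)y)$ in $\mathbb C[[z^{\pm1}]]$ for all $v\in\mathbb V,x\in\mathbb X,y\in\mathbb Y$. Nodal conformal blocks: $\mathfrak B$ is the 2-pointed nodal sphere obtained by gluing two copies of $\mathfrak N$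 by identifying the point $0$ of the first copy with the point $\infty$ of the second; its two marked points are $\infty$ (from the first copy, local coordinate $1/\zeta$) and $0$ (from the second copy, local coordinate $\zeta$). For $\mathbb W\in\mathrm{Mod}(\mathbb V^{\otimes2})$, $\mathscr T^*_{\mathfrak B}(\mathbb W)$ is the space of linear functionals $\psi:\mathbb W\to\mathbb C$ such that for all $w\in\mathbb W$, homogeneous $v\in\mathbb V$ and $n\in\mathbb Z$: $\psi(Y_+(v)_{\mathrm{wt}(v)-1}w)=\psi(Y_-'(v)_{\mathrm{wt}(v)-1}w)$, and $\psi(Y_+(v)_nw)=\psi(Y_-(v)_nw)=0$ whenever $\mathrm{wt}(v)-n-1>0$. For $\mathbb X,\mathbb Y\in\mathrm{Mod}(\mathbb V)$ take $\mathbb W=\mathbb X\otimes\mathbb Y$. *)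

theory Defs
  imports Complex_Main "HOL-Library.Function_Algebras" "HOL-Library.Groups_Big_Fun"
begin

text \<open>
  Conventions. The vertex operator algebra lives on a whole type with an explicit complex scalar
  multiplication; modules are carriers inside an ambient complex vector space, so that
  existence of modules can be stated inside a fixed ambient space. A grading-restricted module has
  countable dimension, hence is isomorphic to one inside \<^typ>\<open>nat \<Rightarrow> complex\<close>. Vertex operators are
  given by their modes: \<open>Y v n\<close> is the coefficient of \<open>z^(-n-1)\<close> in \<open>Y(v,z)\<close>.
  Sums such as those in the Jacobi identity have only finitely many nonzero terms and are written
  with \<^const>\<open>Sum_any\<close>.
\<close>

section \<open>Linear algebra\<close>

definition linear_on ::
  "(complex \<Rightarrow> 'a::ab_group_add \<Rightarrow> 'a) \<Rightarrow> (complex \<Rightarrow> 'b::ab_group_add \<Rightarrow> 'b) \<Rightarrow> 'a set \<Rightarrow> ('a \<Rightarrow> 'b) \<Rightarrow> bool"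
  where "linear_on s t W f \<longleftrightarrow>
    (\<forall>x\<in>W. \<forall>y\<in>W. f (x + y) = f x + f y) \<and> (\<forall>c. \<forall>x\<in>W. f (s c x) = t c (f x))"

definition finite_dim :: "(complex \<Rightarrow> 'a::ab_group_add \<Rightarrow> 'a) \<Rightarrow> 'a set \<Rightarrow> bool"
  where "finite_dim s S \<longleftrightarrow> (\<exists>F. finite F \<and> S \<subseteq> module.span s F)"

definition fscale :: "complex \<Rightarrow> ('i \<Rightarrow> complex) \<Rightarrow> 'i \<Rightarrow> complex"
  where "fscale c f = (\<lambda>i. c * f i)"

lemma vector_space_fscale: "vector_space fscale"
  by unfold_locales (auto simp: fscale_def fun_eq_iff algebra_simps)

text \<open>Linear functionals on a subspace \<open>W\<close>, extended by zero outside \<open>W\<close> so that each functional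
  is represented by exactly one function.\<close>

definition dual_space :: "('i \<Rightarrow> complex) set \<Rightarrow> (('i \<Rightarrow> complex) \<Rightarrow> complex) set"
  where "dual_space W = {\<psi>. linear_on fscale (*) W \<psi> \<and> (\<forall>w. w \<notin> W \<longrightarrow> \<psi> w = 0)}"

text \<open>For subspaces of function spaces, the canonical map from the tensor product of
  \<open>X\<close> and \<open>Y\<close> to functions of two variables is injective; the tensor product is its image.\<close>

definition tensor :: "('i \<Rightarrow> complex) \<Rightarrow> ('j \<Rightarrow> complex) \<Rightarrow> 'i \<times> 'j \<Rightarrow> complex"
  where "tensor x y = (\<lambda>(i, j). x i * y j)"

definition tensor_space ::
  "('i \<Rightarrow> complex) set \<Rightarrow> ('j \<Rightarrow> complex) set \<Rightarrow> ('i \<times> 'j \<Rightarrow> complex) set"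
  where "tensor_space X Y = module.span fscale {tensor x y |x y. x \<in> X \<and> y \<in> Y}"

text \<open>The tensor product of two operators: apply \<open>A\<close> in the first variable, then \<open>B\<close> in the second.
  If \<open>A\<close>, \<open>B\<close> are linear on \<open>X\<close>, \<open>Y\<close>, this is the linear map on \<^term>\<open>tensor_space X Y\<close> that sends
  \<^term>\<open>tensor x y\<close> to \<^term>\<open>tensor (A x) (B y)\<close>.\<close>

definition tensor_op ::
  "(('i \<Rightarrow> complex) \<Rightarrow> 'i \<Rightarrow> complex) \<Rightarrow> (('j \<Rightarrow> complex) \<Rightarrow> 'j \<Rightarrow> complex) \<Rightarrow>
   ('i \<times> 'j \<Rightarrow> complex) \<Rightarrow> 'i \<times> 'j \<Rightarrow> complex"
  where "tensor_op A B f = (\<lambda>(i, j). B (\<lambda>j'. A (\<lambda>i'. f (i', j')) i) j)"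

section \<open>Vertex operator algebras\<close>

record 'v voa_data =
  vscale :: "complex \<Rightarrow> 'v \<Rightarrow> 'v"
  vmode :: "'v \<Rightarrow> int \<Rightarrow> 'v \<Rightarrow> 'v"
  vac :: 'v
  conf :: 'v

text \<open>The Virasoro mode \<open>L(n)\<close> acting on the algebra.\<close>

definition Lop :: "'v voa_data \<Rightarrow> int \<Rightarrow> 'v \<Rightarrow> 'v"
  where "Lop V n = vmode V (conf V) (n + 1)"

definition wt_space :: "'v voa_data \<Rightarrow> nat \<Rightarrow> 'v set"
  where "wt_space V k = {v. Lop V 0 v = vscale V (of_nat k) v}"

text \<open>The Jacobi identity in components, for modes \<open>Yw\<close> acting on \<open>W\<close>.\<close>

definition jacobi_identity ::
  "'v voa_data \<Rightarrow> (complex \<Rightarrow> 'm::ab_group_add \<Rightarrow> 'm) \<Rightarrow> 'm set \<Rightarrow> ('v \<Rightarrow> int \<Rightarrow> 'm \<Rightarrow> 'm) \<Rightarrow> bool"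
  where "jacobi_identity V s W Yw \<longleftrightarrow>
    (\<forall>u v l m n. \<forall>w\<in>W.
      Sum_any (\<lambda>j::nat. s (of_int m gchoose j)
        (Yw (vmode V u (l + int j) v) (m + n - int j) w)) =
      Sum_any (\<lambda>j::nat. s ((-1) ^ j * (of_int l gchoose j))
        (Yw u (m + l - int j) (Yw v (n + int j) w)
         - s ((-1) powi l) (Yw v (n + l - int j) (Yw u (m + int j) w)))))"

text \<open>An \<open>\<nat>\<close>-graded vertex operator algebra. The grading is by the eigenspaces of \<open>L(0)\<close>, whose sum
  is automatically direct.\<close>

locale voa =
  fixes V :: "'v::ab_group_add voa_data"
  assumes vector_space: "vector_space (vscale V)"
    and linear_left: "Vector_Spaces.linear (vscale V) (vscale V) (\<lambda>v. vmode V v n u)"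
    and linear_right: "Vector_Spaces.linear (vscale V) (vscale V) (vmode V v n)"
    and truncation: "\<exists>N. \<forall>n\<ge>N. vmode V u n v = 0"
    and vacuum: "vmode V (vac V) n v = (if n = -1 then v else 0)"
    and creation: "n \<ge> 0 \<Longrightarrow> vmode V v n (vac V) = 0" "vmode V v (-1) (vac V) = v"
    and jacobi: "jacobi_identity V (vscale V) UNIV (vmode V)"
    and virasoro: "\<exists>c. \<forall>m n v.
      Lop V m (Lop V n v) - Lop V n (Lop V m v) =
      vscale V (of_int (m - n)) (Lop V (m + n) v)
      + (if m + n = 0 then vscale V (of_int (m ^ 3 - m) / 12 * c) v else 0)"
    and derivative: "vmode V (Lop V (-1) v) n u = vscale V (- of_int n) (vmode V v (n - 1) u)"
    and grading: "module.span (vscale V) (\<Union>k. wt_space V k) = UNIV"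
    and finite_dim_wt: "finite_dim (vscale V) (wt_space V k)"

text \<open>\<open>V / C\<^sub>2(V)\<close> is finite-dimensional, where \<open>C\<^sub>2(V)\<close> is spanned by all \<open>Y(u)\<^sub>-\<^sub>2 v\<close>.\<close>

definition C2_cofinite :: "'v::ab_group_add voa_data \<Rightarrow> bool"
  where "C2_cofinite V \<longleftrightarrow>
    (\<exists>F. finite F \<and> module.span (vscale V) (F \<union> {vmode V u (-2) v |u v. True}) = UNIV)"

section \<open>Modules\<close>

record ('v, 'm) vmodule =
  mcarrier :: "'m set"
  mmode :: "'v \<Rightarrow> int \<Rightarrow> 'm \<Rightarrow> 'm"

locale weak_module =
  fixes V :: "'v::ab_group_add voa_data"
    and s :: "complex \<Rightarrow> 'm::ab_group_add \<Rightarrow> 'm"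
    and M :: "('v, 'm) vmodule"
  assumes vector_space: "vector_space s"
    and subspace: "module.subspace s (mcarrier M)"
    and closed: "w \<in> mcarrier M \<Longrightarrow> mmode M v n w \<in> mcarrier M"
    and linear_left: "w \<in> mcarrier M \<Longrightarrow> Vector_Spaces.linear (vscale V) s (\<lambda>v. mmode M v n w)"
    and linear_right: "linear_on s s (mcarrier M) (mmode M v n)"
    and truncation: "w \<in> mcarrier M \<Longrightarrow> \<exists>N. \<forall>n\<ge>N. mmode M v n w = 0"
    and vacuum: "w \<in> mcarrier M \<Longrightarrow> mmode M (vac V) n w = (if n = -1 then w else 0)"
    and jacobi: "jacobi_identity V s (mcarrier M) (mmode M)"

text \<open>The generalized eigenspace of \<open>L(0)\<close> for the eigenvalue \<open>a\<close>.\<close>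

definition gen_eigenspace ::
  "'v voa_data \<Rightarrow> (complex \<Rightarrow> 'm::ab_group_add \<Rightarrow> 'm) \<Rightarrow> ('v, 'm) vmodule \<Rightarrow> complex \<Rightarrow> 'm set"
  where "gen_eigenspace V s M a =
    {w \<in> mcarrier M. \<exists>k. ((\<lambda>x. mmode M (conf V) 1 x - s a x) ^^ k) w = 0}"

text \<open>Objects of \<open>Mod(V)\<close>: grading-restricted generalized modules.\<close>

locale gr_module = weak_module V s M
  for V :: "'v::ab_group_add voa_data"
    and s :: "complex \<Rightarrow> 'm::ab_group_add \<Rightarrow> 'm"
    and M :: "('v, 'm) vmodule" +
  assumes grading: "module.span s (\<Union>a. gen_eigenspace V s M a) = mcarrier M"
    and grading_restricted: "finite_dim s (\<Union>\<mu>\<in>{\<mu>. Re \<mu> \<le> Re a}. gen_eigenspace V s M \<mu>)"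

definition Omega :: "'v voa_data \<Rightarrow> ('v, 'm::ab_group_add) vmodule \<Rightarrow> 'm set"
  where "Omega V M =
    {w \<in> mcarrier M. \<forall>k. \<forall>v\<in>wt_space V k. \<forall>n. int k - n - 1 < 0 \<longrightarrow> mmode M v n w = 0}"

definition vsubmodule ::
  "(complex \<Rightarrow> 'm::ab_group_add \<Rightarrow> 'm) \<Rightarrow> ('v, 'm) vmodule \<Rightarrow> 'm set \<Rightarrow> bool"
  where "vsubmodule s M U \<longleftrightarrow>
    U \<subseteq> mcarrier M \<and> module.subspace s U \<and> (\<forall>v n. \<forall>w\<in>U. mmode M v n w \<in> U)"

definition generated_submodule ::
  "(complex \<Rightarrow> 'm::ab_group_add \<Rightarrow> 'm) \<Rightarrow> ('v, 'm) vmodule \<Rightarrow> 'm set \<Rightarrow> 'm set"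
  where "generated_submodule s M S = \<Inter>{U. vsubmodule s M U \<and> S \<subseteq> U}"

definition lowest_generated ::
  "'v voa_data \<Rightarrow> (complex \<Rightarrow> 'm::ab_group_add \<Rightarrow> 'm) \<Rightarrow> ('v, 'm) vmodule \<Rightarrow> bool"
  where "lowest_generated V s M \<longleftrightarrow> generated_submodule s M (Omega V M) = mcarrier M"

section \<open>Conformal blocks\<close>

text \<open>The homogeneous components of a vector.\<close>

definition hcomp :: "'v::ab_group_add voa_data \<Rightarrow> 'v \<Rightarrow> nat \<Rightarrow> 'v"
  where "hcomp V v =
    (THE f. (\<forall>k. f k \<in> wt_space V k) \<and> finite {k. f k \<noteq> 0} \<and> Sum_any f = v)"

text \<open>The modes of \<open>Y'(v,z) = Y(e^(zL(1)) (-z^(-2))^(L(0)) v, z^(-1))\<close>. For \<open>v\<close> of weight \<open>k\<close>,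
  \<open>Y'(v,z)\<close> is the sum over \<open>i\<close> and \<open>m\<close> of \<open>(-1)^k / i! * Y(L(1)^i v)\<^sub>m z^(m + 1 + i - 2k)\<close>, and the
  exponent equals \<open>-n-1\<close> for \<open>m = 2k - i - n - 2\<close>.\<close>

definition opp_mode ::
  "'v::ab_group_add voa_data \<Rightarrow> (complex \<Rightarrow> 'm::ab_group_add \<Rightarrow> 'm) \<Rightarrow>
   ('v \<Rightarrow> int \<Rightarrow> 'm \<Rightarrow> 'm) \<Rightarrow> 'v \<Rightarrow> int \<Rightarrow> 'm \<Rightarrow> 'm"
  where "opp_mode V s Yw v n w =
    Sum_any (\<lambda>k::nat. Sum_any (\<lambda>i::nat.
      s ((-1) ^ k / fact i)
        (Yw ((Lop V 1 ^^ i) (hcomp V v k)) (2 * int k - int i - n - 2) w)))"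

definition smooth_blocks ::
  "'v::ab_group_add voa_data \<Rightarrow> ('v, 'i \<Rightarrow> complex) vmodule \<Rightarrow> ('v, 'j \<Rightarrow> complex) vmodule \<Rightarrow>
   (('i \<times> 'j \<Rightarrow> complex) \<Rightarrow> complex) set"
  where "smooth_blocks V X Y =
    {\<psi> \<in> dual_space (tensor_space (mcarrier X) (mcarrier Y)).
      \<forall>v n. \<forall>x\<in>mcarrier X. \<forall>y\<in>mcarrier Y.
        \<psi> (tensor (mmode X v n x) y) = \<psi> (tensor x (opp_mode V fscale (mmode Y) v n y))}"

text \<open>A module for the tensor square of \<open>V\<close> is given by its modes on pure tensors, i.e. by a family
  \<open>Y2\<close> in which \<open>Y2 u v n\<close> is the \<open>n\<close>-th mode of \<open>u \<otimes> v\<close>. Below, \<open>Y2 v (vac V) n\<close> and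
  \<open>Y2 (vac V) v n\<close> are the modes \<open>Y\<^sub>+(v)\<^sub>n\<close> and \<open>Y\<^sub>-(v)\<^sub>n\<close>.\<close>

definition nodal_blocks ::
  "'v::ab_group_add voa_data \<Rightarrow> ('i \<Rightarrow> complex) set \<Rightarrow>
   ('v \<Rightarrow> 'v \<Rightarrow> int \<Rightarrow> ('i \<Rightarrow> complex) \<Rightarrow> 'i \<Rightarrow> complex) \<Rightarrow> (('i \<Rightarrow> complex) \<Rightarrow> complex) set"
  where "nodal_blocks V W Y2 =
    (let Yp = (\<lambda>v. Y2 v (vac V)); Ym = (\<lambda>v. Y2 (vac V) v) in
     {\<psi> \<in> dual_space W.
       \<forall>w\<in>W. \<forall>k. \<forall>v\<in>wt_space V k.
         \<psi> (Yp v (int k - 1) w) = \<psi> (opp_mode V fscale Ym v (int k - 1) w) \<and>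
         (\<forall>n. int k - n - 1 > 0 \<longrightarrow> \<psi> (Yp v n w) = 0 \<and> \<psi> (Ym v n w) = 0)})"

text \<open>The modes on the tensor product of two modules, from \<open>Y(u \<otimes> v, z) = Y(u,z) \<otimes> Y(v,z)\<close>: the
  coefficient of \<open>z^(-n-1)\<close> collects the pairs of modes with indices adding up to \<open>n - 1\<close>.\<close>

definition tensor_mode ::
  "('v, 'i \<Rightarrow> complex) vmodule \<Rightarrow> ('v, 'j \<Rightarrow> complex) vmodule \<Rightarrow>
   'v \<Rightarrow> 'v \<Rightarrow> int \<Rightarrow> ('i \<times> 'j \<Rightarrow> complex) \<Rightarrow> 'i \<times> 'j \<Rightarrow> complex"
  where "tensor_mode X Y u v n w =
    Sum_any (\<lambda>i::int. tensor_op (mmode X u i) (mmode Y v (n - 1 - i)) w)"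

end

theory Submission
  imports Defs "HOL-Computational_Algebra.Formal_Power_Series" "HOL-Library.Countable_Set"
begin

text \<open>
  The graded dual \<open>M'\<close> of a module \<open>M\<close> is a module under the opposite modes. A nodal block on
  \<open>M' \<otimes> Y\<close> vanishes on the image of all weight-raising modes in \<open>M'\<close>, and by duality of
  finite-dimensional weight spaces this image is the annihilator of \<open>\<Omega>(M)\<close>. So if \<open>N\<close> is the submodule
  generated by \<open>\<Omega>(M)\<close>, the restriction \<open>M' \<rightarrow> N'\<close> identifies the nodal blocks on \<open>M' \<otimes> Y\<close> and
  \<open>N' \<otimes> Y\<close>. For \<open>Y = M \<noteq> N\<close>, the evaluation pairing on \<open>M' \<otimes> M\<close> is a smooth block that does not
  come from \<open>N' \<otimes> M\<close>. Passing to a submodule, one may take \<open>M\<close> generated by one generalized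
  \<open>L(0)\<close>-eigenvector, which makes the smooth blocks on \<open>M' \<otimes> M\<close> finite-dimensional. Then smooth
  and nodal dimensions cannot agree for both \<open>(M', M)\<close> and \<open>(N', M)\<close>.
\<close>

section \<open>Linear algebra\<close>

text \<open>The argument needs \<open>M'\<close> to be a genuine module, and the main obstacle is
  the Jacobi identity for the opposite modes; since modules are given by modes only, it is proved in
  components, as an identity of finite sums. Double duality is available only one weight at a time:
  a functional on all of \<open>M'\<close> need not be evaluation at a vector, but on each
  finite-dimensional weight space it is, and this turns a functional killed by the raising modes of
  \<open>M'\<close> into a family of vectors of \<open>\<Omega>(M)\<close>. As
  \<open>vector_space.dim\<close> gives 0 on infinite-dimensional spaces, the proper inclusion of
  the smooth blocks on \<open>N' \<otimes> M\<close> into those on \<open>M' \<otimes> M\<close>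
  yields a strict inequality only if the larger space is finite-dimensional. This is the purpose of
  the homogeneous generator \<open>w\<close> of weight \<open>a\<close>: invariance determines a
  block by its values on \<open>f \<otimes> w\<close>, and invariance under \<open>L(0)\<close>
  leaves only \<open>f\<close> of weight \<open>a\<close>. For the nodal blocks no finiteness is
  shown; an isomorphism gives equal \<open>dim\<close> in any case.\<close>

locale linear_map_on = S: vector_space s + T: vector_space t
  for s :: "complex \<Rightarrow> 'a::ab_group_add \<Rightarrow> 'a" and t :: "complex \<Rightarrow> 'b::ab_group_add \<Rightarrow> 'b" +
  fixes W :: "'a set" and f :: "'a \<Rightarrow> 'b"
  assumes subspace_dom: "S.subspace W"
    and linear_on: "linear_on s t W f"
begin

lemma add: "x \<in> W \<Longrightarrow> y \<in> W \<Longrightarrow> f (x + y) = f x + f y"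
  and scale: "x \<in> W \<Longrightarrow> f (s c x) = t c (f x)"
  using linear_on by (auto simp: linear_on_def)

lemma zero [simp]: "f 0 = 0"
  using add[of 0 0] S.subspace_0[OF subspace_dom] by simp

lemma neg: "x \<in> W \<Longrightarrow> f (- x) = - f x"
  using scale[of x "-1"] by simp

lemma diff: "x \<in> W \<Longrightarrow> y \<in> W \<Longrightarrow> f (x - y) = f x - f y"
  using add[of x "-y"] neg[of y] S.subspace_neg[OF subspace_dom, of y] by simp

lemma sum: "(\<And>i. i \<in> A \<Longrightarrow> g i \<in> W) \<Longrightarrow> f (sum g A) = (\<Sum>i\<in>A. f (g i))"
proof (induction A rule: infinite_finite_induct)
  case (insert i A)
  then show ?case
    using add[of "g i" "sum g A"] S.subspace_sum[OF subspace_dom, of A g] by simp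
qed auto

lemma Sum_any:
  assumes "\<And>i. g i \<in> W" and fin: "finite {i. g i \<noteq> 0}"
  shows "f (Sum_any g) = Sum_any (\<lambda>i. f (g i))"
proof -
  have "f (Sum_any g) = (\<Sum>i | g i \<noteq> 0. f (g i))"
    unfolding Sum_any.expand_set by (rule sum) (use assms in auto)
  also have "\<dots> = Sum_any (\<lambda>i. f (g i))"
    by (rule Sum_any.expand_superset[symmetric]) (use fin in auto)
  finally show ?thesis .
qed

lemma subspace_kernel: "S.subspace {x \<in> W. f x = 0}"
  using subspace_dom by (auto simp: S.subspace_def add scale)

lemma zero_on_span: "A \<subseteq> W \<Longrightarrow> (\<And>x. x \<in> A \<Longrightarrow> f x = 0) \<Longrightarrow> x \<in> S.span A \<Longrightarrow> f x = 0"
  using S.span_minimal[OF _ subspace_kernel, of A] by auto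

end

lemma vector_space_mult: "vector_space ((*) :: complex \<Rightarrow> complex \<Rightarrow> complex)"
  by unfold_locales (auto simp: algebra_simps)

lemma (in vector_space) span_subset_basis:
  assumes "A \<subseteq> span F"
  obtains B where "B \<subseteq> A" "independent B" "A \<subseteq> span B" "finite F \<Longrightarrow> finite B"
proof -
  obtain B where B: "B \<subseteq> A" "independent B" "A \<subseteq> span B"
    using maximal_independent_subset by blast
  moreover have "finite B" if "finite F"
    using independent_span_bound[OF that B(2)] B(1) assms by blast
  ultimately show thesis using that by blast
qed

text \<open>\<open>finite_dim\<close> allows a spanning set outside \<open>A\<close>; a maximal
  independent subset of \<open>A\<close> serves instead, and the exchange lemma bounds its
  size.\<close>

lemma finite_dimE:
  assumes "vector_space s" "finite_dim s A"
  obtains F where "finite F" "F \<subseteq> A" "A \<subseteq> module.span s F"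
proof -
  interpret vector_space s by fact
  from assms(2) obtain F where F: "finite F" "A \<subseteq> span F" by (auto simp: finite_dim_def)
  show thesis
    by (rule span_subset_basis[OF F(2)]) (use F(1) that in blast)
qed

text \<open>Each evaluation cuts the dimension by at most one, so finitely many jointly injective
  evaluations bound it. The criterion serves for the weight spaces of the contragredient and for the
  smooth blocks.\<close>

lemma finite_dim_eval:
  fixes S :: "('i \<Rightarrow> complex) set"
  assumes "module.subspace fscale S" "finite E"
    and "\<And>f. f \<in> S \<Longrightarrow> (\<And>e. e \<in> E \<Longrightarrow> f e = 0) \<Longrightarrow> f = 0"
  shows "finite_dim fscale S"
  using assms(2,1,3)
proof (induction E arbitrary: S rule: finite_induct)
  case empty
  then have "S \<subseteq> {0}" by blast
  interpret vector_space fscale by (rule vector_space_fscale)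
  have "S \<subseteq> span {0}" using \<open>S \<subseteq> {0}\<close> span_superset by blast
  then show ?case
    unfolding finite_dim_def by (meson finite.emptyI finite_insert)
next
  case (insert e E)
  interpret vector_space fscale by (rule vector_space_fscale)
  let ?S = "{f \<in> S. f e = 0}"
  have "subspace ?S"
    using insert.prems(1) by (auto simp: subspace_def) (simp add: fscale_def)
  then have "finite_dim fscale ?S"
    by (rule insert.IH) (use insert.prems(2) in auto)
  then obtain F where F: "finite F" "?S \<subseteq> span F" by (auto simp: finite_dim_def)
  show ?case
  proof (cases "S = ?S")
    case True
    then show ?thesis using F unfolding finite_dim_def by metis
  next
    case False
    then obtain g where g: "g \<in> S" "g e \<noteq> 0" by auto
    have "S \<subseteq> span (insert g F)"
    proof
      fix f assume f: "f \<in> S"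
      have "f - fscale (f e / g e) g \<in> ?S"
        using f g(1) subspace_diff[OF insert.prems(1)] subspace_scale[OF insert.prems(1)]
        by (simp add: g(2)) (simp add: fscale_def g(2))
      then show "f \<in> span (insert g F)"
        using F(2) span_breakdown_eq by blast
    qed
    then show ?thesis using F(1) unfolding finite_dim_def by (meson finite_insert)
  qed
qed

section \<open>Direct sums\<close>

locale direct_sum = vector_space s
  for s :: "complex \<Rightarrow> 'a::ab_group_add \<Rightarrow> 'a" +
  fixes G :: "'i \<Rightarrow> 'a set"
  assumes subspace_G: "subspace (G i)"
    and independent_G: "finite A \<Longrightarrow> (\<And>i. i \<in> A \<Longrightarrow> f i \<in> G i) \<Longrightarrow> sum f A = 0 \<Longrightarrow> i \<in> A \<Longrightarrow> f i = 0"
begin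

text \<open>The description is literally that of \<open>hcomp\<close>, so \<open>hcomp_eq\<close>
  holds by unfolding. The value is meaningful only on the span of the \<open>G i\<close>.\<close>

definition comp :: "'a \<Rightarrow> 'i \<Rightarrow> 'a"
  where "comp w = (THE f. (\<forall>i. f i \<in> G i) \<and> finite {i. f i \<noteq> 0} \<and> Sum_any f = w)"

lemma comp_unique:
  assumes f: "\<And>i. f i \<in> G i" "finite {i. f i \<noteq> 0}"
    and g: "\<And>i. g i \<in> G i" "finite {i. g i \<noteq> 0}" and eq: "Sum_any f = Sum_any g"
  shows "f = g"
proof
  fix i
  let ?A = "insert i ({i. f i \<noteq> 0} \<union> {i. g i \<noteq> 0})"
  have fin: "finite ?A" using f g by simp
  have "(\<Sum>i\<in>?A. f i - g i) = 0"
    using eq Sum_any.expand_superset[OF fin, of f] Sum_any.expand_superset[OF fin, of g]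
    by (simp add: sum_subtractf subset_iff)
  then have "f i - g i = 0"
    using independent_G[OF fin, of "\<lambda>i. f i - g i" i] f(1) g(1) subspace_diff[OF subspace_G] by blast
  then show "f i = g i" by simp
qed

lemma comp_eqI:
  assumes "\<And>i. f i \<in> G i" "finite {i. f i \<noteq> 0}" "Sum_any f = w"
  shows "comp w = f"
  unfolding comp_def by (rule the_equality) (use assms comp_unique in blast)+

lemma zero_in_G [simp]: "0 \<in> G i"
  using subspace_0[OF subspace_G] .

lemma comp_exists:
  assumes "w \<in> span (\<Union>i. G i)"
  shows "\<exists>f. (\<forall>i. f i \<in> G i) \<and> finite {i. f i \<noteq> 0} \<and> Sum_any f = w"
  using assms
proof (induction w rule: span_induct_alt)
  case base
  then show ?case by (intro exI[of _ "\<lambda>_. 0"]) auto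
next
  case (step c x y)
  then obtain f i where f: "\<And>i. f i \<in> G i" "finite {i. f i \<noteq> 0}" "Sum_any f = y" and x: "x \<in> G i"
    by auto
  let ?h = "\<lambda>j. if j = i then s c x else 0"
  have fin: "finite {j. ?h j \<noteq> 0}" by (rule finite_subset[of _ "{i}"]) auto
  have "finite {j. ?h j + f j \<noteq> 0}"
    by (rule finite_subset[OF _ finite_UnI[OF fin f(2)]]) auto
  moreover have "Sum_any (\<lambda>j. ?h j + f j) = s c x + y"
    by (subst Sum_any.distrib[OF fin f(2)]) (simp add: f(3))
  moreover have "?h j + f j \<in> G j" for j
    using x f(1) subspace_add[OF subspace_G] subspace_scale[OF subspace_G] by auto
  ultimately show ?case by (intro exI[of _ "\<lambda>j. ?h j + f j"]) auto
qed

context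
  fixes w assumes w: "w \<in> span (\<Union>i. G i)"
begin

lemma comp_in: "comp w i \<in> G i"
  and finite_comp: "finite {i. comp w i \<noteq> 0}"
  and Sum_any_comp: "Sum_any (comp w) = w"
proof -
  obtain f where f: "\<forall>i. f i \<in> G i" "finite {i. f i \<noteq> 0}" "Sum_any f = w"
    using comp_exists[OF w] by blast
  then have "comp w = f" by (intro comp_eqI) auto
  with f show "comp w i \<in> G i" "finite {i. comp w i \<noteq> 0}" "Sum_any (comp w) = w" by simp_all
qed

lemma sum_comp: "finite A \<Longrightarrow> {i. comp w i \<noteq> 0} \<subseteq> A \<Longrightarrow> (\<Sum>i\<in>A. comp w i) = w"
  using Sum_any.expand_superset[of A "comp w"] Sum_any_comp by simp

end

lemma comp_in_G: "w \<in> G i \<Longrightarrow> comp w = (\<lambda>j. if j = i then w else 0)"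
  by (rule comp_eqI) (auto intro: finite_subset[of _ "{i}"])

lemma comp_add:
  assumes "x \<in> span (\<Union>i. G i)" "y \<in> span (\<Union>i. G i)"
  shows "comp (x + y) = (\<lambda>i. comp x i + comp y i)"
proof (rule comp_eqI)
  show "finite {i. comp x i + comp y i \<noteq> 0}"
    by (rule finite_subset[OF _ finite_UnI[OF finite_comp[OF assms(1)] finite_comp[OF assms(2)]]]) auto
  show "Sum_any (\<lambda>i. comp x i + comp y i) = x + y"
    using assms by (simp add: Sum_any.distrib finite_comp Sum_any_comp)
  show "comp x i + comp y i \<in> G i" for i
    using assms comp_in subspace_add[OF subspace_G] by blast
qed

lemma comp_scale:
  assumes "x \<in> span (\<Union>i. G i)"
  shows "comp (s c x) = (\<lambda>i. s c (comp x i))"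
proof (rule comp_eqI)
  show fin: "finite {i. s c (comp x i) \<noteq> 0}"
    by (rule finite_subset[OF _ finite_comp[OF assms]]) auto
  show "s c (comp x i) \<in> G i" for i
    using assms comp_in subspace_scale[OF subspace_G] by blast
  interpret l: linear_map_on s s UNIV "s c"
    by unfold_locales (auto simp: linear_on_def scale_right_distrib mult.commute)
  show "Sum_any (\<lambda>i. s c (comp x i)) = s c x"
    using l.Sum_any[OF _ finite_comp[OF assms]] Sum_any_comp[OF assms] by simp
qed

end

section \<open>Generalized eigenspaces\<close>

text \<open>Abstracts \<open>L(0)\<close>, so that one theory of eigenspaces serves the algebra, its
  modules and their contragredients.\<close>

locale endomorphism_on = linear_map_on s s U T
  for s :: "complex \<Rightarrow> 'a::ab_group_add \<Rightarrow> 'a" and U T +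
  assumes closed: "x \<in> U \<Longrightarrow> T x \<in> U"
begin

abbreviation "D a \<equiv> \<lambda>x. T x - s a x"

definition G :: "complex \<Rightarrow> 'a set"
  where "G a = {w \<in> U. \<exists>k. (D a ^^ k) w = 0}"

lemmas U_simps = S.subspace_add[OF subspace_dom] S.subspace_diff[OF subspace_dom]
  S.subspace_scale[OF subspace_dom] S.subspace_0[OF subspace_dom]

lemma D_closed: "x \<in> U \<Longrightarrow> D a x \<in> U"
  by (simp add: closed U_simps)

lemma D_pow_closed: "x \<in> U \<Longrightarrow> (D a ^^ k) x \<in> U"
  by (induction k) (auto simp: D_closed)

lemma D_linear: "linear_map_on s s U (D a)"
  by unfold_locales
    (auto simp: linear_on_def subspace_dom add scale S.scale_right_distrib S.scale_right_diff_distrib mult.commute)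

lemma D_pow_linear: "linear_map_on s s U (D a ^^ k)"
proof (induction k)
  case 0
  show ?case by unfold_locales (auto simp: linear_on_def subspace_dom)
next
  case (Suc k)
  interpret A: linear_map_on s s U "D a ^^ k" by fact
  interpret B: linear_map_on s s U "D a" by (rule D_linear)
  show ?case
    by unfold_locales (auto simp only: linear_on_def subspace_dom A.add A.scale B.add B.scale D_pow_closed
        funpow.simps o_apply)
qed

lemma D_commute: "x \<in> U \<Longrightarrow> D a (D b x) = D b (D a x)"
  by (simp add: closed U_simps diff scale S.scale_right_diff_distrib mult.commute[of b])

lemma D_pow_commute: "x \<in> U \<Longrightarrow> (D a ^^ k) (D b x) = D b ((D a ^^ k) x)"
proof (induction k)
  case (Suc k)
  then show ?case using D_commute[of "(D a ^^ k) x" b a] D_pow_closed by simp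
qed simp

lemma D_pow_le: "(D a ^^ k) x = 0 \<Longrightarrow> k \<le> l \<Longrightarrow> (D a ^^ l) x = 0"
  by (rotate_tac 1, induction l rule: dec_induct) auto

lemma G_subset: "G a \<subseteq> U"
  by (auto simp: G_def)

lemma G_subspace: "S.subspace (G a)"
proof (rule S.subspaceI)
  show "0 \<in> G a" by (auto simp: G_def U_simps intro: exI[of _ 0])
next
  fix x y assume "x \<in> G a" "y \<in> G a"
  then obtain k l where kl: "(D a ^^ k) x = 0" "(D a ^^ l) y = 0" "x \<in> U" "y \<in> U" by (auto simp: G_def)
  interpret A: linear_map_on s s U "D a ^^ (k + l)" by (rule D_pow_linear)
  have "(D a ^^ (k + l)) (x + y) = 0"
    using A.add[OF kl(3,4)] D_pow_le[OF kl(1), of "k + l"] D_pow_le[OF kl(2), of "k + l"] by simp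
  then show "x + y \<in> G a" using kl by (auto simp: G_def U_simps)
next
  fix c x assume "x \<in> G a"
  then obtain k where k: "(D a ^^ k) x = 0" "x \<in> U" by (auto simp: G_def)
  interpret A: linear_map_on s s U "D a ^^ k" by (rule D_pow_linear)
  have "(D a ^^ k) (s c x) = 0" using A.scale[OF k(2), of c] k(1) by simp
  then show "s c x \<in> G a" using k by (auto simp: G_def U_simps)
qed

lemma D_in_G:
  assumes "x \<in> G b"
  shows "D a x \<in> G b"
proof -
  from assms obtain k where k: "(D b ^^ k) x = 0" "x \<in> U" by (auto simp: G_def)
  have "(D b ^^ k) (D a x) = 0"
    unfolding D_pow_commute[OF k(2)] k(1) by simp
  then show ?thesis using D_closed[OF k(2)] unfolding G_def by blast
qed

text \<open>On \<open>G b\<close> the operator \<open>D b\<close> is locally nilpotent and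
  \<open>D a\<close> is \<open>D b\<close> plus the nonzero scalar \<open>b - a\<close>, hence
  invertible. The induction on the nilpotency exponent carries this out modulo the stable subspace
  \<open>S\<close>.\<close>

lemma D_cancel_mem:
  assumes S: "S.subspace S" "\<And>x. x \<in> S \<Longrightarrow> T x \<in> S"
    and "x \<in> G b" "a \<noteq> b" "D a x \<in> S"
  shows "x \<in> S"
proof -
  from assms(3) obtain k where "(D b ^^ k) x = 0" "x \<in> U" by (auto simp: G_def)
  then show ?thesis using assms(5)
  proof (induction k arbitrary: x)
    case 0
    then show ?case using S(1) S.subspace_0 by auto
  next
    case (Suc k)
    have "D b x \<in> S"
    proof (rule Suc.IH)
      show "(D b ^^ k) (D b x) = 0" using Suc.prems(1) unfolding funpow_Suc_right by simp
      have "D b (D a x) \<in> S"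
        by (rule S.subspace_diff[OF S(1) S(2)[OF Suc.prems(3)] S.subspace_scale[OF S(1) Suc.prems(3)]])
      then show "D a (D b x) \<in> S"
                using D_commute[OF Suc.prems(2), where a = a and b = b] by simp
    qed (use Suc.prems D_closed in auto)
    then have "D a x - D b x \<in> S" using Suc.prems(3) S(1) S.subspace_diff by blast
    then have "s (b - a) x \<in> S" by (simp add: S.scale_left_diff_distrib)
    then have "s (inverse (b - a)) (s (b - a) x) \<in> S" using S(1) S.subspace_scale by blast
    then show ?case using \<open>a \<noteq> b\<close> by simp
  qed
qed

text \<open>A power of \<open>D b\<close> that kills the component at \<open>b\<close> leaves fewer
  weights; it is then cancelled on the remaining components by \<open>D_cancel_mem\<close>. With
  \<open>S = {0}\<close> this is independence of the eigenspaces, with a submodule it is homogeneity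
  of that submodule.\<close>

lemma sum_mem_imp_mem:
  assumes S: "S.subspace S" "\<And>x. x \<in> S \<Longrightarrow> T x \<in> S"
    and "finite A" "\<And>a. a \<in> A \<Longrightarrow> w a \<in> G a" "sum w A \<in> S" "a \<in> A"
  shows "w a \<in> S"
  using assms(3-6)
proof (induction A arbitrary: w a rule: finite_induct)
  case (insert b A)
  from insert.prems(1)[of b] obtain k where k: "(D b ^^ k) (w b) = 0" by (auto simp: G_def)
  interpret A: linear_map_on s s U "D b ^^ k" by (rule D_pow_linear)
  have pow: "(D b ^^ j) x \<in> S" if "x \<in> S" for x j
    by (induction j) (use S S.subspace_diff S.subspace_scale that in auto)
  have wU: "w c \<in> U" if "c \<in> insert b A" for c using insert.prems(1)[OF that] G_subset by blast
  have "(D b ^^ k) (sum w (insert b A)) = (\<Sum>c\<in>insert b A. (D b ^^ k) (w c))"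
    by (rule A.sum) (rule wU)
  then have 1: "(\<Sum>c\<in>A. (D b ^^ k) (w c)) \<in> S"
    using pow[OF insert.prems(2), of k] insert.hyps k by simp
  have DG: "(D b ^^ j) x \<in> G c" if "x \<in> G c" for x j c
    by (induction j) (use D_in_G that in auto)
  have A: "w c \<in> S" if c: "c \<in> A" for c
  proof -
    have "(D b ^^ k) (w c) \<in> S"
      by (rule insert.IH[OF _ 1 c]) (use DG insert.prems(1) in auto)
    moreover have "(D b ^^ j) (w c) \<in> S \<Longrightarrow> w c \<in> S" for j
    proof (induction j)
      case (Suc j)
      have "(D b ^^ j) (w c) \<in> S"
        by (rule D_cancel_mem[OF S DG[of "w c" c]]) (use Suc.prems c insert in auto)
      then show ?case by (rule Suc.IH)
    qed simp
    ultimately show ?thesis by blast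
  qed
  show ?case
  proof (cases "a = b")
    case True
    have "sum w A \<in> S" using A S(1) S.subspace_sum by blast
    then have "sum w (insert b A) - sum w A \<in> S" using insert.prems(2) S(1) S.subspace_diff by blast
    then show ?thesis using True insert.hyps by simp
  qed (use A insert.prems in auto)
qed auto

sublocale direct_sum s G
proof
  fix A f i
  assume *: "finite A" "\<And>i. i \<in> A \<Longrightarrow> f i \<in> G i" "sum f A = 0" "i \<in> A"
  have "f i \<in> {0}"
    by (rule sum_mem_imp_mem[of _ A]) (use * in auto)
  then show "f i = 0" by simp
qed (rule G_subspace)

lemma comp_mem:
  assumes S: "S.subspace S" "\<And>x. x \<in> S \<Longrightarrow> T x \<in> S"
    and x: "x \<in> S.span (\<Union>a. G a)" "x \<in> S"
  shows "comp x a \<in> S"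
proof (rule sum_mem_imp_mem[OF S, where A = "insert a {a. comp x a \<noteq> 0}"])
  show "(\<Sum>a\<in>insert a {a. comp x a \<noteq> 0}. comp x a) \<in> S"
    by (subst sum_comp[OF x(1)]) (use x finite_comp in auto)
qed (use x comp_in finite_comp in auto)

lemma eigenvector_in_G: "x \<in> U \<Longrightarrow> T x = s a x \<Longrightarrow> x \<in> G a"
  by (auto simp: G_def intro: exI[of _ 1])

end

lemma Sum_any_single: "(\<And>j. j \<noteq> i \<Longrightarrow> g j = 0) \<Longrightarrow> Sum_any g = g i"
  by (subst Sum_any.expand_superset[of "{i}"]) auto

lemma Sum_any_lessThan: "(\<And>j. j \<ge> N \<Longrightarrow> g j = 0) \<Longrightarrow> Sum_any g = (\<Sum>j<N::nat. g j)"
  by (rule Sum_any.expand_superset) (auto simp: not_le[symmetric])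

text \<open>Applied with \<open>h = of_nat\<close>, to derive directness of the weight spaces of the
  algebra from that of the eigenspaces for all complex numbers.\<close>

lemma (in direct_sum) direct_sum_reindex:
  assumes "inj h" "\<And>i. subspace (H i)" "\<And>i. H i \<subseteq> G (h i)"
  shows "direct_sum s H"
proof
  fix A f i
  assume *: "finite A" "\<And>i. i \<in> A \<Longrightarrow> f i \<in> H i" "sum f A = 0" "i \<in> A"
  have "(f \<circ> inv h) (h i) = 0"
  proof (rule independent_G[of "h ` A"])
    show "sum (f \<circ> inv h) (h ` A) = 0"
      using * assms(1) by (subst sum.reindex) (auto simp: inj_on_def)
  qed (use * assms subsetD[OF assms(3)] in auto)
  then show "f i = 0" using assms(1) by simp
qed (rule assms(2))

section \<open>Commutation relations\<close>

sublocale weak_module \<subseteq> VS: vector_space s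
  by (rule vector_space)

context weak_module
begin

abbreviation C where "C \<equiv> mcarrier M"
abbreviation Y where "Y \<equiv> mmode M"

lemmas C_simps = VS.subspace_add[OF subspace] VS.subspace_diff[OF subspace]
  VS.subspace_scale[OF subspace] VS.subspace_0[OF subspace] VS.subspace_sum[OF subspace]

lemma mode_linear: "linear_map_on s s C (Y v n)"
  by unfold_locales (auto simp: subspace linear_right)

lemmas mode_add = linear_map_on.add[OF mode_linear]
lemmas mode_scale = linear_map_on.scale[OF mode_linear]
lemmas mode_zero = linear_map_on.zero[OF mode_linear]
lemmas mode_diff = linear_map_on.diff[OF mode_linear]
lemmas mode_sum = linear_map_on.sum[OF mode_linear]

lemma mode_add_left: "w \<in> C \<Longrightarrow> Y (u + v) n w = Y u n w + Y v n w"
  and mode_scale_left: "w \<in> C \<Longrightarrow> Y (vscale V c u) n w = s c (Y u n w)"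
  using linear_left[of w n] by (simp_all add: Vector_Spaces.linear_iff)

lemma mode_zero_left: "w \<in> C \<Longrightarrow> Y 0 n w = 0"
  using mode_add_left[of w 0 0 n] by simp

text \<open>The Jacobi identity at \<open>l = 0\<close>: there \<open>0 gchoose j\<close> vanishes
  for \<open>j > 0\<close>, which leaves the commutator on the right.\<close>

lemma commutator:
  assumes "w \<in> C"
  shows "Y u m (Y v n w) - Y v n (Y u m w) =
    Sum_any (\<lambda>j::nat. s (of_int m gchoose j) (Y (vmode V u (int j) v) (m + n - int j) w))"
proof -
  have "Sum_any (\<lambda>j::nat. s (of_int m gchoose j) (Y (vmode V u (0 + int j) v) (m + n - int j) w)) =
      Sum_any (\<lambda>j::nat. s ((-1) ^ j * (of_int 0 gchoose j))
        (Y u (m + 0 - int j) (Y v (n + int j) w)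
         - s ((-1) powi 0) (Y v (n + 0 - int j) (Y u (m + int j) w))))"
    using jacobi assms unfolding jacobi_identity_def by blast
  also have "\<dots> = Y u m (Y v n w) - Y v n (Y u m w)"
    by (subst Sum_any_single[of 0]) (auto simp: gbinomial_0 gr0_conv_Suc neq0_conv)
  finally show ?thesis by simp
qed

end

lemma linear_UNIV_iff: "Vector_Spaces.linear s t f \<longleftrightarrow> vector_space s \<and> vector_space t \<and> linear_on s t UNIV f"
  by (auto simp: Vector_Spaces.linear_iff linear_on_def)

locale voa_module = alg: voa V + weak_module V s M
  for V :: "'v::ab_group_add voa_data"
    and s :: "complex \<Rightarrow> 'm::ab_group_add \<Rightarrow> 'm"
    and M :: "('v, 'm) vmodule"

sublocale voa \<subseteq> VV: vector_space "vscale V"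
  by (rule vector_space)

text \<open>The algebra acts on itself, so the commutator formula and the linearity rules for
  modules apply to it; the rewrites hide the auxiliary record.\<close>

sublocale voa \<subseteq> self: weak_module V "vscale V" "\<lparr>mcarrier = UNIV, mmode = vmode V\<rparr>"
  rewrites "mcarrier \<lparr>mcarrier = UNIV, mmode = vmode V\<rparr> = UNIV"
    and "mmode \<lparr>mcarrier = UNIV, mmode = vmode V\<rparr> = vmode V"
proof -
  show "weak_module V (vscale V) \<lparr>mcarrier = UNIV, mmode = vmode V\<rparr>"
    using linear_left linear_right truncation
    by unfold_locales (auto simp: vacuum jacobi linear_UNIV_iff linear_on_def)
qed simp_all

section \<open>Weights in the algebra and the operator \<open>L(1)\<close>\<close>

context voa
begin

lemma voa_module_self: "voa_module V (vscale V) \<lparr>mcarrier = UNIV, mmode = vmode V\<rparr>"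
  by (rule voa_module.intro) unfold_locales

lemma L_add: "Lop V n (u + v) = Lop V n u + Lop V n v"
  and L_scale: "Lop V n (vscale V c v) = vscale V c (Lop V n v)"
  and L_zero [simp]: "Lop V n 0 = 0"
  unfolding Lop_def by (simp_all add: self.mode_add self.mode_scale self.mode_zero)

lemma L_minus_1: "Lop V (-1) v = vmode V v (-2) (vac V)"
proof -
  have "Lop V (-1) v = vmode V (Lop V (-1) v) (-1) (vac V)" by (simp add: creation)
  also have "\<dots> = vmode V v (-2) (vac V)" by (simp add: derivative)
  finally show ?thesis .
qed

lemma conf_eq: "conf V = Lop V (-2) (vac V)"
  by (simp add: Lop_def creation)

lemma L_commutator:
  assumes "m + n \<noteq> 0"
  shows "Lop V m (Lop V n v) - Lop V n (Lop V m v) = vscale V (of_int (m - n)) (Lop V (m + n) v)"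
proof -
  obtain c where "\<forall>m n v. Lop V m (Lop V n v) - Lop V n (Lop V m v) =
      vscale V (of_int (m - n)) (Lop V (m + n) v)
      + (if m + n = 0 then vscale V (of_int (m ^ 3 - m) / 12 * c) v else 0)"
    using virasoro by blast
  with assms show ?thesis by simp
qed

lemma conf_wt: "Lop V 0 (conf V) = vscale V 2 (conf V)"
  using L_commutator[of 0 "-2" "vac V"]
  by (simp add: conf_eq[symmetric]) (simp add: Lop_def creation self.mode_zero)

text \<open>The relation \<open>[L(1), L(-2)] = 3 L(-1)\<close> has no central term, and
  \<open>L(1)\<close> and \<open>L(-1)\<close> kill the vacuum. This makes \<open>L(0)\<close> equal
  to its opposite mode in \<open>opp_conf\<close>.\<close>

lemma L1_conf: "Lop V 1 (conf V) = 0"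
  using L_commutator[of 1 "-2" "vac V"]
  by (simp add: conf_eq[symmetric]) (simp add: Lop_def creation self.mode_zero)

lemma L0_L1: "Lop V 0 v = vscale V a v \<Longrightarrow> Lop V 0 (Lop V 1 v) = vscale V (a - 1) (Lop V 1 v)"
  using L_commutator[of 0 1 v] by (simp add: L_scale VV.scale_left_distrib VV.scale_left_diff_distrib algebra_simps)

sublocale L0: endomorphism_on "vscale V" UNIV "Lop V 0"
  by unfold_locales (auto simp: linear_on_def L_add L_scale)

lemma wt_space_subset_G: "wt_space V k \<subseteq> L0.G (of_nat k)"
  by (auto simp: wt_space_def intro: L0.eigenvector_in_G)

sublocale wt: direct_sum "vscale V" "wt_space V"
proof (rule L0.direct_sum_reindex[where h = of_nat])
  show "VV.subspace (wt_space V k)" for k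
    by (rule VV.subspaceI)
      (auto simp: wt_space_def L_add L_scale VV.scale_right_distrib mult.commute)
qed (auto simp: wt_space_subset_G[THEN subsetD])

lemma hcomp_eq: "hcomp V v = wt.comp v"
  unfolding hcomp_def wt.comp_def ..

lemma spanned: "v \<in> VV.span (\<Union>k. wt_space V k)"
  using grading by simp

lemma spanned_G: "v \<in> VV.span (\<Union>a. L0.G a)"
proof -
  have "(\<Union>k. wt_space V k) \<subseteq> (\<Union>a. L0.G a)" using wt_space_subset_G by blast
  then show ?thesis using spanned VV.span_mono by blast
qed

text \<open>The weight spaces with natural weights span, and the projection to the eigenvalue
  \<open>r\<close> kills each of them. Consequently \<open>L(1)^i v\<close> vanishes for large
  \<open>i\<close>, which makes the sums in opposite modes finite.\<close>

lemma negative_weight: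
  assumes "Lop V 0 v = vscale V (of_int r) v" "r < 0"
  shows "v = 0"
proof -
  let ?S = "{x. L0.comp x (of_int r) = 0}"
  have "VV.subspace ?S"
    by (rule VV.subspaceI)
      (auto simp: L0.comp_add L0.comp_scale spanned_G L0.comp_in_G[of 0 0])
  moreover have "wt_space V k \<subseteq> ?S" for k
  proof
    fix x assume "x \<in> wt_space V k"
    then have "x \<in> L0.G (of_nat k)" using wt_space_subset_G by blast
    moreover have "complex_of_int r \<noteq> of_nat k"
      using \<open>r < 0\<close> by (metis of_int_eq_iff of_int_of_nat_eq negative_zless of_nat_0_le_iff not_le)
    ultimately show "x \<in> ?S" by (simp add: L0.comp_in_G)
  qed
  ultimately have "VV.span (\<Union>k. wt_space V k) \<subseteq> ?S" by (intro VV.span_minimal) auto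
  then have "L0.comp v (of_int r) = 0" using spanned by blast
  moreover have "v \<in> L0.G (of_int r)" using assms(1) by (intro L0.eigenvector_in_G) auto
  ultimately show ?thesis by (simp add: L0.comp_in_G)
qed

lemma L1_pow_wt:
  assumes "v \<in> wt_space V k"
  shows "i \<le> k \<Longrightarrow> (Lop V 1 ^^ i) v \<in> wt_space V (k - i)"
    and "i > k \<Longrightarrow> (Lop V 1 ^^ i) v = 0"
proof -
  have *: "Lop V 0 ((Lop V 1 ^^ i) v) = vscale V (of_int (int k - int i)) ((Lop V 1 ^^ i) v)" for i
  proof (induction i)
    case 0
    then show ?case using assms by (simp add: wt_space_def)
  next
    case (Suc i)
    then show ?case using L0_L1[OF Suc] by (simp add: algebra_simps)
  qed
  show "(Lop V 1 ^^ i) v \<in> wt_space V (k - i)" if "i \<le> k"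
    using *[of i] that by (simp add: wt_space_def of_nat_diff)
  show "(Lop V 1 ^^ i) v = 0" if "i > k"
    using negative_weight[OF *[of i]] that by simp
qed

lemma hcomp_wt: "v \<in> wt_space V k \<Longrightarrow> hcomp V v = (\<lambda>j. if j = k then v else 0)"
  and hcomp_in: "hcomp V v k \<in> wt_space V k"
  and finite_hcomp: "finite {k. hcomp V v k \<noteq> 0}"
  and hcomp_add: "hcomp V (u + v) = (\<lambda>k. hcomp V u k + hcomp V v k)"
  and hcomp_scale: "hcomp V (vscale V c v) = (\<lambda>k. vscale V c (hcomp V v k))"
  unfolding hcomp_eq
  by (auto simp: wt.comp_in_G wt.comp_in wt.finite_comp wt.comp_add wt.comp_scale spanned)

lemma homogeneous_induct [case_names wt add]:
  assumes "\<And>k v. v \<in> wt_space V k \<Longrightarrow> P v" "\<And>u v. P u \<Longrightarrow> P v \<Longrightarrow> P (u + v)"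
  shows "P v"
proof -
  have "P 0" by (rule assms(1)[of _ 0]) simp
  from spanned[of v] show ?thesis
  proof (induction rule: VV.span_induct_alt)
    case (step c x y)
    then have "P (vscale V c x)" using assms(1) VV.subspace_scale[OF wt.subspace_G] by blast
    then show ?case using assms(2) step by blast
  qed fact
qed

end

lemma gbinomial_1: "j \<ge> 2 \<Longrightarrow> (1 :: complex) gchoose j = 0"
  using binomial_gbinomial[of 1 j, where 'a = complex] by (simp add: binomial_eq_0)

lemma gbinomial_2: "(2 :: complex) gchoose 2 = 1" "j \<ge> 3 \<Longrightarrow> (2 :: complex) gchoose j = 0"
  using binomial_gbinomial[of 2 j, where 'a = complex] binomial_gbinomial[of 2 2, where 'a = complex]
  by (simp_all add: binomial_eq_0)

text \<open>The coefficients of \<open>(1 - x)^(-2)\<close>, which occur in the Jacobi identity at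
  \<open>l = -2\<close>.\<close>

lemma gbinomial_minus_2: "(-1) ^ j * ((-2 :: complex) gchoose j) = of_nat (Suc j)"
proof -
  have "(-2 :: complex) gchoose j = (-1) ^ j * (of_nat (Suc j) gchoose j)"
    by (subst gbinomial_minus) (simp add: algebra_simps)
  then show ?thesis
    unfolding binomial_gbinomial[symmetric] by (simp flip: power_mult_distrib mult.assoc)
qed

context voa_module
begin

text \<open>Weak modules have no derivative axiom. It follows from the Jacobi identity with the
  vacuum as second vector, \<open>l = -2\<close> and \<open>m = 0\<close>: the left side is a mode
  of \<open>vmode V v (-2) (vac V)\<close>, which is \<open>L(-1) v\<close>, and on the right the
  vacuum modes leave at most one \<open>j\<close>.\<close>

lemma module_derivative:
  assumes w: "w \<in> C"
  shows "Y (Lop V (-1) v) n w = s (- of_int n) (Y v (n - 1) w)"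
proof -
  let ?t = "\<lambda>j::nat. s (of_nat (Suc j)) (Y v (-2 - int j) (Y (vac V) (n + int j) w)
         - Y (vac V) (n - 2 - int j) (Y v (int j) w))"
  have "Sum_any (\<lambda>j::nat. s (of_int 0 gchoose j) (Y (vmode V v (-2 + int j) (vac V)) (0 + n - int j) w)) =
      Sum_any (\<lambda>j::nat. s ((-1) ^ j * (of_int (-2) gchoose j))
        (Y v (0 + -2 - int j) (Y (vac V) (n + int j) w)
         - s ((-1) powi (-2)) (Y (vac V) (n + -2 - int j) (Y v (0 + int j) w))))"
    using jacobi w unfolding jacobi_identity_def by blast
  also have "\<dots> = Sum_any ?t"
    by (rule Sum_any.cong) (simp add: gbinomial_minus_2)
  also have "\<dots> = s (- of_int n) (Y v (n - 1) w)"
  \<comment> \<open>For \<open>n < 0\<close> only the first product survives, at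
    \<open>j = -1 - n\<close>; for \<open>n > 0\<close> only the second, at
    \<open>j = n - 1\<close>. Both give the factor \<open>-n\<close>.\<close>
  proof (cases n "0::int" rule: linorder_cases)
    case less
    have "?t j = 0" if "j \<noteq> nat (-1 - n)" for j
    proof -
      have "n + int j \<noteq> -1" using that less by linarith
      then show ?thesis using less w closed by (simp add: vacuum mode_zero)
    qed
    then have "Sum_any ?t = ?t (nat (-1 - n))" by (rule Sum_any_single)
    then show ?thesis using less w closed by (simp add: vacuum of_nat_nat)
  next
    case equal
    then have "?t = (\<lambda>_. 0)" using w closed by (auto simp: vacuum mode_zero)
    then have "Sum_any ?t = 0" by (simp only: Sum_any.neutral)
    then show ?thesis using equal by simp
  next
    case greater
    have "?t j = 0" if "j \<noteq> nat (n - 1)" for j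
    proof -
      have "n - 2 - int j \<noteq> -1" using that greater by linarith
      then show ?thesis using greater w closed by (simp add: vacuum mode_zero)
    qed
    then have "Sum_any ?t = ?t (nat (n - 1))" by (rule Sum_any_single)
    then show ?thesis using greater w closed by (simp add: vacuum of_nat_nat mode_zero)
  qed
  finally show ?thesis
    by (subst (asm) Sum_any_single[of 0]) (auto simp: gbinomial_0 gr0_conv_Suc alg.L_minus_1)
qed

text \<open>The modes 0 and 1 of the conformal vector are \<open>L(-1)\<close> and
  \<open>L(0)\<close>; they contribute \<open>-n - 1\<close> and \<open>k\<close>.\<close>

lemma L0_commutator:
  assumes w: "w \<in> C" and v: "v \<in> wt_space V k"
  shows "Y (conf V) 1 (Y v n w) = Y v n (Y (conf V) 1 w) + s (of_int (int k - n - 1)) (Y v n w)"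
proof -
  have "Y (conf V) 1 (Y v n w) - Y v n (Y (conf V) 1 w) =
    (\<Sum>j<2::nat. s (of_int 1 gchoose j) (Y (vmode V (conf V) (int j) v) (1 + n - int j) w))"
    unfolding commutator[OF w] by (rule Sum_any_lessThan) (simp add: gbinomial_1)
  also have "\<dots> = Y (Lop V (-1) v) (n + 1) w + Y (Lop V 0 v) n w"
    by (simp add: eval_nat_numeral Lop_def add.commute)
  also have "\<dots> = s (of_int (int k - n - 1)) (Y v n w)"
    using v w
    by (simp add: wt_space_def module_derivative mode_scale_left algebra_simps)
  finally show ?thesis by (simp add: algebra_simps)
qed

end

context voa
begin

lemma mode_wt:
  assumes "u \<in> wt_space V K" "Lop V 0 v = vscale V (of_int r) v"
  shows "Lop V 0 (vmode V u n v) = vscale V (of_int (int K + r - n - 1)) (vmode V u n v)"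
  using voa_module.L0_commutator[OF voa_module_self _ assms(1), of v n] assms(2)
  by (simp add: Lop_def self.mode_scale algebra_simps)

text \<open>For the mode 2 of the conformal vector the commutator formula has three terms, with
  \<open>L(-1) u\<close>, \<open>2 L(0) u\<close> and \<open>L(1) u\<close>. Iterating the relation
  produces the triple sum of \<open>dL_mode\<close>.\<close>

lemma L1_mode:
  assumes u: "u \<in> wt_space V k"
  shows "Lop V 1 (vmode V u n v) = vmode V u n (Lop V 1 v)
    + vscale V (of_int (2 * int k - n - 2)) (vmode V u (n + 1) v) + vmode V (Lop V 1 u) n v"
proof -
  have "vmode V (conf V) 2 (vmode V u n v) - vmode V u n (vmode V (conf V) 2 v) =
    (\<Sum>j<3::nat. vscale V (of_int 2 gchoose j) (vmode V (vmode V (conf V) (int j) u) (2 + n - int j) v))"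
    unfolding self.commutator[OF UNIV_I] by (rule Sum_any_lessThan) (simp add: gbinomial_2)
  also have "\<dots> = vmode V (Lop V (-1) u) (n + 2) v + vscale V 2 (vmode V (Lop V 0 u) (n + 1) v)
      + vmode V (Lop V 1 u) n v"
    by (simp add: eval_nat_numeral gbinomial_2(1)[unfolded numeral_2_eq_2] Lop_def add.commute)
  also have "\<dots> = vscale V (of_int (2 * int k - n - 2)) (vmode V u (n + 1) v) + vmode V (Lop V 1 u) n v"
    using u
    by (simp add: wt_space_def derivative self.mode_scale_left algebra_simps)
  finally show ?thesis by (simp add: Lop_def algebra_simps)
qed

end

section \<open>Opposite modes\<close>

text \<open>In \<open>dL_mode\<close>, \<open>a\<close> and \<open>c\<close> count the applications
  of \<open>L(1)\<close> to the two vectors and \<open>b\<close> the raising of the mode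
  index.\<close>

definition triples :: "nat \<Rightarrow> (nat \<times> nat \<times> nat) set"
  where "triples i = {(a, b, c). a + b + c = i}"

lemma finite_triples: "finite (triples i)"
  by (rule finite_subset[of _ "{..i} \<times> {..i} \<times> {..i}"]) (auto simp: triples_def)

text \<open>\<open>h\<close> has to vanish at index 0 because the shifted sum never reaches that
  index.\<close>

lemma sum_triples_shift:
  fixes h :: "nat \<Rightarrow> nat \<Rightarrow> nat \<Rightarrow> 'a::comm_monoid_add"
  shows "(\<And>b c. h 0 b c = 0) \<Longrightarrow> (\<Sum>(a, b, c)\<in>triples i. h (Suc a) b c) = (\<Sum>(a, b, c)\<in>triples (Suc i). h a b c)"
    and "(\<And>a c. h a 0 c = 0) \<Longrightarrow> (\<Sum>(a, b, c)\<in>triples i. h a (Suc b) c) = (\<Sum>(a, b, c)\<in>triples (Suc i). h a b c)"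
    and "(\<And>a b. h a b 0 = 0) \<Longrightarrow> (\<Sum>(a, b, c)\<in>triples i. h a b (Suc c)) = (\<Sum>(a, b, c)\<in>triples (Suc i). h a b c)"
proof -
  note fin = finite_subset[OF _ finite_triples[of "Suc i"]]
  show "(\<Sum>(a, b, c)\<in>triples i. h (Suc a) b c) = (\<Sum>(a, b, c)\<in>triples (Suc i). h a b c)" if "\<And>b c. h 0 b c = 0"
    by (rule sum.reindex_bij_witness_not_neutral[where i = "\<lambda>(a, b, c). (a - 1, b, c)"
          and j = "\<lambda>(a, b, c). (Suc a, b, c)" and S' = "{}" and T' = "{x \<in> triples (Suc i). fst x = 0}"])
      (auto simp: triples_def that intro!: fin)
  show "(\<Sum>(a, b, c)\<in>triples i. h a (Suc b) c) = (\<Sum>(a, b, c)\<in>triples (Suc i). h a b c)" if "\<And>a c. h a 0 c = 0"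
    by (rule sum.reindex_bij_witness_not_neutral[where i = "\<lambda>(a, b, c). (a, b - 1, c)"
          and j = "\<lambda>(a, b, c). (a, Suc b, c)" and S' = "{}" and T' = "{x \<in> triples (Suc i). fst (snd x) = 0}"])
      (auto simp: triples_def that intro!: fin)
  show "(\<Sum>(a, b, c)\<in>triples i. h a b (Suc c)) = (\<Sum>(a, b, c)\<in>triples (Suc i). h a b c)" if "\<And>a b. h a b 0 = 0"
    by (rule sum.reindex_bij_witness_not_neutral[where i = "\<lambda>(a, b, c). (a, b, c - 1)"
          and j = "\<lambda>(a, b, c). (a, b, Suc c)" and S' = "{}" and T' = "{x \<in> triples (Suc i). snd (snd x) = 0}"])
      (auto simp: triples_def that intro!: fin)
qed

lemma sum_triples_le:
  "(\<Sum>i\<le>I. \<Sum>x\<in>triples i. f x) = (\<Sum>x\<in>{(a, b, c). a + b + c \<le> I}. f x)"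
proof -
  have fin: "finite {(a, b, c). a + b + c \<le> I}"
    by (rule finite_subset[of _ "{..I} \<times> {..I} \<times> {..I}"]) auto
  have "(\<Sum>x\<in>{(a, b, c). a + b + c \<le> I}. f x) =
      (\<Sum>i\<le>I. \<Sum>x\<in>{x \<in> {(a, b, c). a + b + c \<le> I}. (\<lambda>(a, b, c). a + b + c) x = i}. f x)"
    by (rule sum.group[symmetric]) (use fin in auto)
  also have "\<dots> = (\<Sum>i\<le>I. \<Sum>x\<in>triples i. f x)"
    by (rule sum.cong[OF refl], rule sum.cong) (auto simp: triples_def)
  finally show ?thesis by simp
qed

context voa
begin

text \<open>Divided powers, the coefficients of \<open>e^(x L(1))\<close>. They absorb the
  factorials, so that \<open>dL_mode\<close> has binomial coefficients.\<close>

definition dL :: "nat \<Rightarrow> 'v \<Rightarrow> 'v"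
  where "dL i v = vscale V (1 / fact i) ((Lop V 1 ^^ i) v)"

lemma L_sum: "Lop V n (sum g A) = (\<Sum>i\<in>A. Lop V n (g i))"
  unfolding Lop_def by (rule self.mode_sum) simp

lemma dL_0 [simp]: "dL 0 v = v"
  by (simp add: dL_def)

lemma dL_Suc: "Lop V 1 (dL i v) = vscale V (of_nat (Suc i)) (dL (Suc i) v)"
proof -
  have "(of_nat (Suc i) :: complex) * (1 / fact (Suc i)) = 1 / fact i"
    by (simp only: fact_Suc of_nat_mult) (simp add: field_simps del: of_nat_Suc)
  then show ?thesis by (simp only: dL_def L_scale funpow.simps o_apply VV.scale_scale)
qed

lemma dL_wt:
  assumes "v \<in> wt_space V k"
  shows "i \<le> k \<Longrightarrow> dL i v \<in> wt_space V (k - i)" and "i > k \<Longrightarrow> dL i v = 0"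
  using L1_pow_wt[OF assms, of i] VV.subspace_scale[OF wt.subspace_G] by (auto simp: dL_def)

text \<open>The component form of \<open>e^(xL(1)) Y(u,z) e^(-xL(1)) = Y(e^(x(1-xz)L(1)) (1-xz)^(-2L(0)) u, z/(1-xz))\<close>.\<close>

lemma dL_mode:
  assumes u: "u \<in> wt_space V K"
  shows "dL i (vmode V u n v) = (\<Sum>(a, b, c)\<in>triples i.
    vscale V (of_int (2 * int K - int a - n - 2) gchoose b) (vmode V (dL a u) (n + int b) (dL c v)))"
proof (induction i)
  case 0
  have "triples 0 = {(0, 0, 0)}" by (auto simp: triples_def)
  then show ?case by simp
next
  case (Suc i)
  define cf where "cf a b = (of_int (2 * int K - int a - n - 2) :: complex) gchoose b" for a b :: nat
  define m where "m a b c = vmode V (dL a u) (n + int b) (dL c v)" for a b c :: nat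
  \<comment> \<open>\<open>h1\<close>, \<open>h2\<close>, \<open>h3\<close> collect the terms in
    which \<open>L(1)\<close> acts on \<open>v\<close>, on the mode index and on \<open>u\<close>,
    written at the raised exponent. Each vanishes where that exponent is 0, as
    \<open>sum_triples_shift\<close> requires.\<close>
  define h1 where "h1 a b c = vscale V (of_nat c * cf a b) (m a b c)" for a b c
  define h2 where "h2 a b c = vscale V (if b = 0 then 0 else
      of_int (2 * int K - 2 * int a - n - int b - 1) * cf a (b - 1)) (m a b c)" for a b c
  define h3 where "h3 a b c = vscale V (if a = 0 then 0 else of_nat a * cf (a - 1) b) (m a b c)" for a b c
  have L1m: "vscale V (cf a b) (Lop V 1 (m a b c)) = h1 a b (Suc c) + h2 a (Suc b) c + h3 (Suc a) b c" for a b c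
  \<comment> \<open>\<open>dL a u\<close> has weight \<open>K - a\<close> in this case and is zero
    otherwise, so \<open>L1_mode\<close> is applied only where the subtraction is exact.\<close>
  proof (cases "a \<le> K")
    case True
    have "Lop V 1 (m a b c) = vmode V (dL a u) (n + int b) (vscale V (of_nat (Suc c)) (dL (Suc c) v))
        + vscale V (of_int (2 * int (K - a) - (n + int b) - 2)) (m a (Suc b) c)
        + vmode V (vscale V (of_nat (Suc a)) (dL (Suc a) u)) (n + int b) (dL c v)"
      unfolding m_def L1_mode[OF dL_wt(1)[OF u True]] dL_Suc by (simp add: algebra_simps)
    then have "Lop V 1 (m a b c) = vscale V (of_nat (Suc c)) (m a b (Suc c))
        + vscale V (of_int (2 * int (K - a) - (n + int b) - 2)) (m a (Suc b) c)
        + vscale V (of_nat (Suc a)) (m (Suc a) b c)"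
      by (simp only: m_def self.mode_scale[OF UNIV_I] self.mode_scale_left[OF UNIV_I])
    moreover have "2 * int (K - a) - (n + int b) - 2 = 2 * int K - 2 * int a - n - int (Suc b) - 1"
      using True by (simp add: of_nat_diff)
    ultimately have "Lop V 1 (m a b c) = vscale V (of_nat (Suc c)) (m a b (Suc c))
        + vscale V (of_int (2 * int K - 2 * int a - n - int (Suc b) - 1)) (m a (Suc b) c)
        + vscale V (of_nat (Suc a)) (m (Suc a) b c)"
      by (simp only:)
    then show ?thesis
      by (simp only: h1_def h2_def h3_def VV.scale_right_distrib VV.scale_scale mult.commute[of "cf a b"]
          nat.simps if_False diff_Suc_1)
  next
    case False
    then have "dL a u = 0" "dL (Suc a) u = 0" using dL_wt(2)[OF u] by auto
    then show ?thesis by (simp add: h1_def h2_def h3_def m_def self.mode_zero_left)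
  qed
  \<comment> \<open>By Pascal's rule and absorption,
    \<open>(x - b') (x gchoose b') = (b' + 1) (x gchoose (b' + 1))\<close>, the terms with
    \<open>x gchoose b'\<close> cancel. On \<open>triples (Suc i)\<close> the remaining factor
    \<open>a + b + c\<close> is \<open>Suc i\<close>, which cancels against the one from
    \<open>dL_Suc\<close>.\<close>
  have coef: "of_nat c * cf a b + (if b = 0 then 0 else of_int (2 * int K - 2 * int a - n - int b - 1) * cf a (b - 1))
      + (if a = 0 then 0 else of_nat a * cf (a - 1) b) = of_nat (a + b + c) * cf a b" for a b c
  proof -
    define x where "x = (of_int (2 * int K - int a - n - 2) :: complex)"
    have x: "cf a b = x gchoose b" for b by (simp add: cf_def x_def)
    have x1: "cf (a - 1) b = (x + 1) gchoose b" if "a \<noteq> 0"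
      using that by (simp add: cf_def x_def of_nat_diff algebra_simps)
    show ?thesis
    proof (cases b)
      case 0
      then show ?thesis using x1 by (simp add: x algebra_simps)
    next
      case (Suc b')
      have 1: "of_nat (Suc b') * (x gchoose Suc b') = (x - of_nat b') * (x gchoose b')"
        using gbinomial_mult_1[of x b'] by (simp add: algebra_simps)
      have 2: "(x + 1) gchoose Suc b' = (x gchoose b') + (x gchoose Suc b')"
        by (rule gbinomial_Suc_Suc)
      have 3: "of_int (2 * int K - 2 * int a - n - int b - 1) = x - of_nat b' - of_nat a"
        by (simp add: x_def Suc)
      have "of_nat c * (x gchoose Suc b') + (x - of_nat b' - of_nat a) * (x gchoose b')
          + of_nat a * ((x gchoose b') + (x gchoose Suc b')) = of_nat (a + Suc b' + c) * (x gchoose Suc b')"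
        using 1 by (simp add: algebra_simps)
      moreover have "(if a = 0 then 0 else of_nat a * cf (a - 1) b)
          = of_nat a * ((x gchoose b') + (x gchoose Suc b'))"
        using x1 2 Suc by simp
      ultimately show ?thesis
        by (simp only: 3) (simp only: x Suc nat.distinct if_False diff_Suc_1)
    qed
  qed
  have "vscale V (of_nat (Suc i)) (dL (Suc i) (vmode V u n v)) = Lop V 1 (dL i (vmode V u n v))"
    by (simp only: dL_Suc)
  also have "\<dots> = Lop V 1 (\<Sum>(a, b, c)\<in>triples i. vscale V (cf a b) (m a b c))"
    by (simp only: Suc cf_def m_def)
  also have "\<dots> = (\<Sum>(a, b, c)\<in>triples i. h1 a b (Suc c) + h2 a (Suc b) c + h3 (Suc a) b c)"
    unfolding L_sum by (rule sum.cong) (simp_all only: split_def L1m[symmetric] L_scale)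
  also have "\<dots> = (\<Sum>(a, b, c)\<in>triples i. h1 a b (Suc c)) + (\<Sum>(a, b, c)\<in>triples i. h2 a (Suc b) c)
      + (\<Sum>(a, b, c)\<in>triples i. h3 (Suc a) b c)"
    by (simp add: split_def sum.distrib)
  also have "\<dots> = (\<Sum>(a, b, c)\<in>triples (Suc i). h1 a b c) + (\<Sum>(a, b, c)\<in>triples (Suc i). h2 a b c)
      + (\<Sum>(a, b, c)\<in>triples (Suc i). h3 a b c)"
    by (subst sum_triples_shift(3)[of h1], simp add: h1_def)
      (subst sum_triples_shift(2)[of h2], simp add: h2_def,
       subst sum_triples_shift(1)[of h3], simp add: h3_def, rule refl)
  also have "\<dots> = (\<Sum>(a, b, c)\<in>triples (Suc i). vscale V (of_nat (Suc i) * cf a b) (m a b c))"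
    unfolding sum.distrib[symmetric]
    by (rule sum.cong) (auto simp: h1_def h2_def h3_def VV.scale_left_distrib[symmetric] coef triples_def
        simp del: of_nat_Suc of_nat_add)
  also have "\<dots> = vscale V (of_nat (Suc i)) (\<Sum>(a, b, c)\<in>triples (Suc i). vscale V (cf a b) (m a b c))"
    by (simp add: VV.scale_sum_right split_def del: of_nat_Suc)
  finally show ?case
    unfolding VV.scale_cancel_left cf_def m_def by (simp del: of_nat_Suc)
qed

end

context voa_module
begin

abbreviation opp where "opp \<equiv> opp_mode V s Y"

text \<open>The contribution of the component of weight \<open>k\<close> to the opposite mode. It
  makes sense for every \<open>v\<close> and is linear in it, which carries linearity over to
  inhomogeneous vectors.\<close>

definition hopp :: "nat \<Rightarrow> 'v \<Rightarrow> int \<Rightarrow> 'm \<Rightarrow> 'm"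
  where "hopp k v n w = s ((-1) ^ k) (\<Sum>i\<le>k. Y (alg.dL i v) (2 * int k - int i - n - 2) w)"

lemma opp_eq_Sum_any_hopp:
  assumes w: "w \<in> C"
  shows "opp v n w = Sum_any (\<lambda>k. hopp k (hcomp V v k) n w)"
proof -
  have "Sum_any (\<lambda>i. s ((-1) ^ k / fact i) (Y ((Lop V 1 ^^ i) (hcomp V v k)) (2 * int k - int i - n - 2) w)) =
    hopp k (hcomp V v k) n w" (is "Sum_any ?f = _") for k
  proof -
    have "?f i = 0" if "i \<notin> {..k}" for i
      using alg.L1_pow_wt(2)[OF alg.hcomp_in, of k i v] that by (simp add: mode_zero_left[OF w])
    then have "Sum_any ?f = (\<Sum>i\<le>k. ?f i)"
      by (intro Sum_any.expand_superset) auto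
    also have "\<dots> = hopp k (hcomp V v k) n w"
      unfolding hopp_def VS.scale_sum_right
      by (rule sum.cong) (simp_all add: alg.dL_def mode_scale_left[OF w])
    finally show ?thesis .
  qed
  then show ?thesis unfolding opp_mode_def by simp
qed

lemma dL_add: "alg.dL i (u + v) = alg.dL i u + alg.dL i v"
  and dL_scale: "alg.dL i (vscale V c v) = vscale V c (alg.dL i v)"
proof -
  have "(Lop V 1 ^^ i) (u + v) = (Lop V 1 ^^ i) u + (Lop V 1 ^^ i) v"
    "(Lop V 1 ^^ i) (vscale V c v) = vscale V c ((Lop V 1 ^^ i) v)"
    by (induction i) (simp_all add: alg.L_add alg.L_scale)
  then show "alg.dL i (u + v) = alg.dL i u + alg.dL i v"
    "alg.dL i (vscale V c v) = vscale V c (alg.dL i v)"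
    by (simp_all add: alg.dL_def alg.VV.scale_right_distrib mult.commute)
qed

lemma hopp_zero_left: "w \<in> C \<Longrightarrow> hopp k 0 n w = 0"
  using dL_scale[of _ 0 0] by (simp add: hopp_def mode_zero_left)

lemma hopp_add_left: "w \<in> C \<Longrightarrow> hopp k (u + v) n w = hopp k u n w + hopp k v n w"
  and hopp_scale_left: "w \<in> C \<Longrightarrow> hopp k (vscale V c u) n w = s c (hopp k u n w)"
  by (simp_all add: hopp_def dL_add dL_scale mode_add_left mode_scale_left sum.distrib
      VS.scale_right_distrib VS.scale_sum_right mult.commute)

lemma opp_eq_dL:
  assumes "w \<in> C" "v \<in> wt_space V k"
  shows "opp v n w = s ((-1) ^ k) (\<Sum>i\<le>k. Y (alg.dL i v) (2 * int k - int i - n - 2) w)"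
  unfolding opp_eq_Sum_any_hopp[OF assms(1)] hopp_def[symmetric]
  by (subst Sum_any_single[of k]) (auto simp: alg.hcomp_wt[OF assms(2)] hopp_zero_left[OF assms(1)])

text \<open>Allowing any finite index set above the support lets several vectors be compared over a
  common one.\<close>

lemma opp_eq_sum:
  assumes "w \<in> C" "finite A" "{k. hcomp V v k \<noteq> 0} \<subseteq> A"
  shows "opp v n w = (\<Sum>k\<in>A. hopp k (hcomp V v k) n w)"
  unfolding opp_eq_Sum_any_hopp[OF assms(1)]
  by (rule Sum_any.expand_superset) (use assms hopp_zero_left in auto)

lemma opp_add_left:
  assumes w: "w \<in> C"
  shows "opp (u + v) n w = opp u n w + opp v n w"
proof -
  let ?A = "{k. hcomp V u k \<noteq> 0} \<union> {k. hcomp V v k \<noteq> 0}"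
  have fin: "finite ?A" using alg.finite_hcomp by auto
  have "opp (u + v) n w = (\<Sum>k\<in>?A. hopp k (hcomp V (u + v) k) n w)"
    by (rule opp_eq_sum[OF w fin]) (auto simp: alg.hcomp_add)
  also have "\<dots> = opp u n w + opp v n w"
    using opp_eq_sum[OF w fin, of u n] opp_eq_sum[OF w fin, of v n]
    by (simp add: alg.hcomp_add hopp_add_left[OF w] sum.distrib)
  finally show ?thesis .
qed

lemma opp_scale_left:
  assumes w: "w \<in> C"
  shows "opp (vscale V c v) n w = s c (opp v n w)"
proof -
  let ?A = "{k. hcomp V v k \<noteq> 0}"
  have fin: "finite ?A" using alg.finite_hcomp by auto
  have "opp (vscale V c v) n w = (\<Sum>k\<in>?A. hopp k (hcomp V (vscale V c v) k) n w)"
    by (rule opp_eq_sum[OF w fin]) (auto simp: alg.hcomp_scale)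
  then show ?thesis
    using opp_eq_sum[OF w fin, of v n]
    by (simp add: alg.hcomp_scale hopp_scale_left[OF w] VS.scale_sum_right)
qed

lemma opp_zero_left: "w \<in> C \<Longrightarrow> opp 0 n w = 0"
  using opp_scale_left[of w 0 0] by simp

lemma hopp_linear: "linear_map_on s s C (hopp k v n)"
  by unfold_locales
    (auto simp: linear_on_def subspace hopp_def mode_add mode_scale sum.distrib VS.scale_right_distrib
      VS.scale_sum_right mult.commute)

lemma hopp_closed: "w \<in> C \<Longrightarrow> hopp k v n w \<in> C"
  unfolding hopp_def by (intro C_simps closed)

lemma opp_closed: "w \<in> C \<Longrightarrow> opp v n w \<in> C"
  by (simp add: opp_eq_sum[OF _ alg.finite_hcomp subset_refl] C_simps hopp_closed)

lemma opp_linear: "linear_map_on s s C (opp v n)"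
proof unfold_locales
  let ?A = "{k. hcomp V v k \<noteq> 0}"
  have "opp v n w = (\<Sum>k\<in>?A. hopp k (hcomp V v k) n w)" if "w \<in> C" for w
    by (rule opp_eq_sum[OF that alg.finite_hcomp]) auto
  then show "linear_on s s C (opp v n)"
    using linear_map_on.add[OF hopp_linear] linear_map_on.scale[OF hopp_linear]
    by (simp add: linear_on_def C_simps sum.distrib VS.scale_sum_right)
qed (rule subspace)

lemmas opp_add = linear_map_on.add[OF opp_linear]
lemmas opp_scale = linear_map_on.scale[OF opp_linear]

text \<open>The summation range may exceed the weight, which may be negative if the vector is zero.\<close>

lemma opp_homogeneous:
  assumes w: "w \<in> C" and v: "Lop V 0 v = vscale V (of_int r) v" and I: "r \<le> int I"
  shows "opp v n w = s ((-1) powi r) (\<Sum>i\<le>I. Y (alg.dL i v) (2 * r - int i - n - 2) w)"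
proof (cases "r < 0")
  case True
  then have "v = 0" using alg.negative_weight[OF v] by simp
  then show ?thesis using dL_scale[of _ 0 0] by (simp add: opp_zero_left w mode_zero_left)
next
  case False
  define k where "k = nat r"
  have r: "r = int k" using False by (simp add: k_def)
  have v: "v \<in> wt_space V k" using v by (simp add: wt_space_def r)
  have "(\<Sum>i\<le>I. Y (alg.dL i v) (2 * r - int i - n - 2) w) = (\<Sum>i\<le>k. Y (alg.dL i v) (2 * r - int i - n - 2) w)"
    by (rule sum.mono_neutral_right)
      (use I r alg.dL_wt(2)[OF v] in \<open>auto simp: mode_zero_left w\<close>)
  then show ?thesis using opp_eq_dL[OF w v] by (simp add: r)
qed

end

text \<open>Negating the upper entry turns \<open>(y - j) gchoose (J - j)\<close> into a sign times
  \<open>(J - y - 1) gchoose (J - j)\<close>, whose upper entry is free of \<open>j\<close>.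
  Vandermonde applies, and a second negation removes the sign.\<close>

lemma gbinomial_alternating_Vandermonde:
  fixes x y :: "'a::field_char_0"
  shows "(\<Sum>j\<le>J. (-1) ^ j * (x gchoose j) * ((y - of_nat j) gchoose (J - j))) = (y - x) gchoose J"
proof -
  have "(-1) ^ j * (x gchoose j) * ((y - of_nat j) gchoose (J - j)) =
      (-1) ^ J * ((x gchoose j) * ((of_nat J - y - 1) gchoose (J - j)))" if "j \<le> J" for j
  proof -
    have "of_nat (J - j) - (y - of_nat j) - 1 = of_nat J - y - (1 :: 'a)"
      using that by (simp add: of_nat_diff)
    then have 1: "(y - of_nat j) gchoose (J - j) = (-1) ^ (J - j) * ((of_nat J - y - 1) gchoose (J - j))"
      by (subst gbinomial_negated_upper) (simp only:)
    have "(-1 :: 'a) ^ j * (-1) ^ (J - j) = (-1) ^ J"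
      using that by (simp flip: power_add)
    then show ?thesis unfolding 1 by (metis (no_types) mult.assoc mult.left_commute)
  qed
  then have "(\<Sum>j\<le>J. (-1) ^ j * (x gchoose j) * ((y - of_nat j) gchoose (J - j))) =
      (-1) ^ J * (\<Sum>j\<le>J. (x gchoose j) * ((of_nat J - y - 1) gchoose (J - j)))"
    unfolding sum_distrib_left by (intro sum.cong refl) simp
  also have "\<dots> = (-1) ^ J * ((x + (of_nat J - y - 1)) gchoose J)"
    by (simp only: atMost_atLeast0 gbinomial_Vandermonde)
  also have "\<dots> = (y - x) gchoose J"
    by (subst (2) gbinomial_negated_upper) (simp add: algebra_simps)
  finally show ?thesis .
qed

lemma sum_rotate: "(\<Sum>a\<in>A. \<Sum>c\<in>B. \<Sum>j\<in>D. f a c j) = (\<Sum>j\<in>D. \<Sum>a\<in>A. \<Sum>c\<in>B. f a c j)"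
proof -
  have "(\<Sum>a\<in>A. \<Sum>c\<in>B. \<Sum>j\<in>D. f a c j) = (\<Sum>a\<in>A. \<Sum>j\<in>D. \<Sum>c\<in>B. f a c j)"
    by (intro sum.cong refl sum.swap)
  also have "\<dots> = (\<Sum>j\<in>D. \<Sum>a\<in>A. \<Sum>c\<in>B. f a c j)"
    by (rule sum.swap)
  finally show ?thesis .
qed

lemma minus_one_powi: "(-1 :: complex) powi n = (if even n then 1 else -1)"
  using power_int_minus_left[of "1 :: complex" n] by simp

text \<open>Truncation is restated as an eventuality so that finitely many bounds combine without
  explicit maxima.\<close>

lemma eventually_int:
  assumes "\<exists>N::int. \<forall>n\<ge>N. P n"
  shows "\<forall>\<^sub>F j in sequentially. P (a + int j)"
proof -
  from assms obtain N where N: "\<forall>n\<ge>N. P n" by blast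
  show ?thesis
    unfolding eventually_sequentially by (rule exI[of _ "nat (N - a)"]) (auto intro!: N[rule_format])
qed

context voa_module
begin

lemma sum_left: "w \<in> C \<Longrightarrow> Y (sum g A) n w = (\<Sum>i\<in>A. Y (g i) n w)"
  by (induction A rule: infinite_finite_induct) (simp_all add: mode_zero_left mode_add_left)

lemma opp_opp:
  assumes w: "w \<in> C" and u: "u \<in> wt_space V K" and v: "v \<in> wt_space V k"
  shows "opp v p (opp u q w) = s ((-1) ^ (K + k)) (\<Sum>a\<le>K. \<Sum>c\<le>k.
    Y (alg.dL c v) (2 * int k - int c - p - 2) (Y (alg.dL a u) (2 * int K - int a - q - 2) w))"
proof -
  let ?z = "\<lambda>a. Y (alg.dL a u) (2 * int K - int a - q - 2) w"
  have z: "?z a \<in> C" for a using closed[OF w] .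
  have Z: "(\<Sum>a\<le>K. ?z a) \<in> C" by (rule C_simps) (rule z)
  have "opp v p (opp u q w) = s ((-1) ^ K) (opp v p (\<Sum>a\<le>K. ?z a))"
    by (simp add: opp_eq_dL[OF w u] opp_scale Z)
  also have "\<dots> = s ((-1) ^ K) (s ((-1) ^ k) (\<Sum>c\<le>k. Y (alg.dL c v) (2 * int k - int c - p - 2) (\<Sum>a\<le>K. ?z a)))"
    by (simp add: opp_eq_dL[OF Z v])
  also have "\<dots> = s ((-1) ^ (K + k)) (\<Sum>c\<le>k. \<Sum>a\<le>K. Y (alg.dL c v) (2 * int k - int c - p - 2) (?z a))"
    by (simp add: mode_sum z power_add)
  also have "\<dots> = s ((-1) ^ (K + k)) (\<Sum>a\<le>K. \<Sum>c\<le>k. Y (alg.dL c v) (2 * int k - int c - p - 2) (?z a))"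
    by (subst sum.swap) (rule refl)
  finally show ?thesis .
qed

text \<open>After the two opposite modes on the right are expanded, each pair \<open>(a, c)\<close> contributes the Jacobi
  identity for \<open>L(1)^a u\<close> and \<open>L(1)^c v\<close> with reflected indices; the left sides are matched
  by the alternating Vandermonde identity.\<close>

lemma opp_jacobi:
  assumes w: "w \<in> C" and u: "u \<in> wt_space V K" and v: "v \<in> wt_space V k"
  shows "\<forall>\<^sub>F N in sequentially.
    (\<Sum>j<N. s (of_int m gchoose j) (opp (vmode V u (l + int j) v) (m + n - int j) w)) =
    (\<Sum>j<N. s ((-1) ^ j * (of_int l gchoose j))
        (opp v (n + int j) (opp u (m + l - int j) w)
         - s ((-1) powi l) (opp u (m + int j) (opp v (n + l - int j) w))))"
proof -
  let ?u = "\<lambda>a. alg.dL a u" and ?v = "\<lambda>c. alg.dL c v"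
  \<comment> \<open>The reflected indices: \<open>M' a\<close> and \<open>N' c\<close> are the mode
    indices in the \<open>a\<close>-th and \<open>c\<close>-th terms of the opposite modes of
    \<open>u\<close> and \<open>v\<close> with indices \<open>m + l\<close> and
    \<open>n + l\<close>.\<close>
  define M' where "M' a = 2 * int K - int a - m - l - 2" for a :: nat
  define N' where "N' c = 2 * int k - int c - n - l - 2" for c :: nat
  define E where "E a c J = Y (vmode V (?u a) (l + int J) (?v c)) (M' a + N' c - int J) w" for a c J :: nat
  define A where "A a c j = Y (?u a) (M' a + l - int j) (Y (?v c) (N' c + int j) w)" for a c j :: nat
  define B where "B a c j = Y (?v c) (N' c + l - int j) (Y (?u a) (M' a + int j) w)" for a c j :: nat
  define e where "e = (-1 :: complex) powi l"
  \<comment> \<open>The opposite modes exchange the two products: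
    \<open>B - e A = -e (A - e B)\<close> because \<open>e\<close> squares to 1. The sign
    \<open>(-1) ^ (K + k)\<close> comes from the two opposite modes.\<close>
  define q where "q = - ((-1) ^ (K + k) * e)"
  have ee: "e * e = 1" by (simp add: e_def minus_one_powi)
  \<comment> \<open>One \<open>N\<close> is chosen for all pairs of \<open>a\<close> and
    \<open>c\<close>, so that every Jacobi identity involved becomes one of sums over
    \<open>j < N\<close>.\<close>
  have ev: "\<forall>\<^sub>F N in sequentially. \<forall>a\<in>{..K}. \<forall>c\<in>{..k}. \<forall>J\<ge>N.
      vmode V (?u a) (l + int J) (?v c) = 0 \<and> Y (?v c) (N' c + int J) w = 0 \<and> Y (?u a) (M' a + int J) w = 0"
    by (intro eventually_ball_finite finite_atMost ballI eventually_all_ge_at_top eventually_conj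
        eventually_int[OF alg.truncation] eventually_int[OF truncation[OF w]])
  then show ?thesis
  proof (rule eventually_mono)
    fix N assume N: "\<forall>a\<in>{..K}. \<forall>c\<in>{..k}. \<forall>J\<ge>N.
      vmode V (?u a) (l + int J) (?v c) = 0 \<and> Y (?v c) (N' c + int J) w = 0 \<and> Y (?u a) (M' a + int J) w = 0"
    have E0: "E a c J = 0" if "a > K \<or> c > k \<or> J \<ge> N" for a c J
    proof -
      have "vmode V (?u a) (l + int J) (?v c) = 0"
      proof (cases "a > K \<or> c > k")
        case True
        then show ?thesis
          using alg.dL_wt(2)[OF u, of a] alg.dL_wt(2)[OF v, of c]
          by (auto simp: alg.self.mode_zero alg.self.mode_zero_left)
      next
        case False
        then show ?thesis using N that by auto
      qed
      then show ?thesis by (simp add: E_def mode_zero_left w)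
    qed
    have E_nonzero: "a \<le> K \<and> c \<le> k \<and> J < N" if "E a c J \<noteq> 0" for a c J
      using that E0 by (meson not_le)
    have jac: "(\<Sum>J<N. s (of_int (M' a) gchoose J) (E a c J)) =
        (\<Sum>j<N. s ((-1) ^ j * (of_int l gchoose j)) (A a c j - s e (B a c j)))" if "a \<le> K" "c \<le> k" for a c
    proof -
      have "Sum_any (\<lambda>J. s (of_int (M' a) gchoose J) (E a c J)) =
        Sum_any (\<lambda>j. s ((-1) ^ j * (of_int l gchoose j)) (A a c j - s e (B a c j)))"
        using jacobi w unfolding jacobi_identity_def E_def A_def B_def e_def by blast
      moreover have "Sum_any (\<lambda>J. s (of_int (M' a) gchoose J) (E a c J)) =
          (\<Sum>J<N. s (of_int (M' a) gchoose J) (E a c J))"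
        by (rule Sum_any_lessThan) (simp add: E0)
      moreover have "Sum_any (\<lambda>j. s ((-1) ^ j * (of_int l gchoose j)) (A a c j - s e (B a c j))) =
        (\<Sum>j<N. s ((-1) ^ j * (of_int l gchoose j)) (A a c j - s e (B a c j)))"
        by (rule Sum_any_lessThan) (use N that in \<open>simp add: A_def B_def mode_zero\<close>)
      ultimately show ?thesis by simp
    qed
    have rhs: "opp v (n + int j) (opp u (m + l - int j) w) - s e (opp u (m + int j) (opp v (n + l - int j) w)) =
        s q (\<Sum>a\<le>K. \<Sum>c\<le>k. A a c j - s e (B a c j))" for j
    proof -
      have 1: "opp v (n + int j) (opp u (m + l - int j) w) = s ((-1) ^ (K + k)) (\<Sum>a\<le>K. \<Sum>c\<le>k. B a c j)"
        unfolding opp_opp[OF w u v] B_def M'_def N'_def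
        by (intro arg_cong[where f = "s _"] sum.cong refl arg_cong2[where f = "\<lambda>i j. Y _ i (Y _ j w)"]) auto
      have "opp u (m + int j) (opp v (n + l - int j) w) = s ((-1) ^ (k + K)) (\<Sum>c\<le>k. \<Sum>a\<le>K. A a c j)"
        unfolding opp_opp[OF w v u] A_def M'_def N'_def
        by (intro arg_cong[where f = "s _"] sum.cong refl arg_cong2[where f = "\<lambda>i j. Y _ i (Y _ j w)"]) auto
      then have 2: "opp u (m + int j) (opp v (n + l - int j) w) = s ((-1) ^ (K + k)) (\<Sum>a\<le>K. \<Sum>c\<le>k. A a c j)"
        by (subst sum.swap) (simp add: add.commute)
      have "s q (\<Sum>a\<le>K. \<Sum>c\<le>k. A a c j - s e (B a c j)) =
          s q (\<Sum>a\<le>K. \<Sum>c\<le>k. A a c j) - s (q * e) (\<Sum>a\<le>K. \<Sum>c\<le>k. B a c j)"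
        by (simp add: sum_subtractf VS.scale_right_diff_distrib VS.scale_sum_right[symmetric])
      also have "q * e = - ((-1) ^ (K + k))"
        using ee by (simp add: q_def mult.assoc)
      finally show ?thesis unfolding 1 2 by (simp add: q_def mult.commute)
    qed
    have lhs: "opp (vmode V u (l + int j) v) (m + n - int j) w = s (q * (-1) ^ j)
        (\<Sum>a\<le>K. \<Sum>c\<le>k. \<Sum>b<N - j. s (of_int (M' a + m - int j) gchoose b) (E a c (j + b)))"
      if j: "j < N" for j
    proof -
      \<comment> \<open>\<open>r\<close> is the weight of the product and may be negative.
        \<open>I\<close> only has to bound \<open>r\<close> and every \<open>a + b + c\<close> with
        \<open>a \<le> K\<close>, \<open>b < N\<close> and \<open>c \<le> k\<close>.\<close>
      define r where "r = int K + int k - (l + int j) - 1"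
      define I where "I = K + k + N + nat \<bar>l\<bar>"
      let ?x = "vmode V u (l + int j) v"
      have x: "Lop V 0 ?x = vscale V (of_int r) ?x"
        unfolding r_def by (rule alg.mode_wt[OF u]) (use v in \<open>simp add: wt_space_def\<close>)
      have rI: "r \<le> int I" unfolding r_def I_def by linarith
      let ?g = "\<lambda>(a, b, c). s (of_int (M' a + m - int j) gchoose b) (E a c (j + b))"
      have "Y (alg.dL i ?x) (2 * r - int i - (m + n - int j) - 2) w = (\<Sum>x\<in>triples i. ?g x)" for i
      proof -
        have "Y (alg.dL i ?x) p w = (\<Sum>(a, b, c)\<in>triples i.
            s (of_int (2 * int K - int a - (l + int j) - 2) gchoose b)
              (Y (vmode V (?u a) (l + int j + int b) (?v c)) p w))" for p
          unfolding alg.dL_mode[OF u]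
          by (simp add: sum_left[OF w] split_def mode_scale_left[OF w])
        then show ?thesis
          unfolding E_def
          by (auto simp: triples_def M'_def N'_def r_def split_def algebra_simps intro!: sum.cong
              arg_cong2[where f = s] arg_cong2[where f = "\<lambda>x p. Y x p w"])
      qed
      then have "opp ?x (m + n - int j) w = s ((-1) powi r) (\<Sum>i\<le>I. \<Sum>x\<in>triples i. ?g x)"
        unfolding opp_homogeneous[OF w x rI] by simp
      also have "(\<Sum>i\<le>I. \<Sum>x\<in>triples i. ?g x) = (\<Sum>x\<in>{(a, b, c). a + b + c \<le> I}. ?g x)"
        by (rule sum_triples_le)
      also have "\<dots> = (\<Sum>x\<in>{..K} \<times> {..<N - j} \<times> {..k}. ?g x)"
      proof (rule sum.mono_neutral_right)
        show "finite {(a, b, c). a + b + c \<le> I}"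
          by (rule finite_subset[of _ "{..I} \<times> {..I} \<times> {..I}"]) auto
      qed (auto simp: I_def dest!: E_nonzero)
      also have "\<dots> = (\<Sum>a\<le>K. \<Sum>b<N - j. \<Sum>c\<le>k. ?g (a, b, c))"
        by (simp add: sum.cartesian_product split_def)
      also have "\<dots> = (\<Sum>a\<le>K. \<Sum>c\<le>k. \<Sum>b<N - j. ?g (a, b, c))"
        by (rule sum.cong[OF refl], rule sum.swap)
      \<comment> \<open>The minus sign in \<open>q\<close> is the \<open>- 1\<close> in the weight
        \<open>r\<close>.\<close>
      also have "(-1) powi r = q * (-1) ^ j"
        unfolding r_def q_def e_def
        by (simp add: minus_one_powi minus_one_power_iff)
      finally show ?thesis by simp
    qed
    have "(\<Sum>j<N. s (of_int m gchoose j) (opp (vmode V u (l + int j) v) (m + n - int j) w)) =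
       (\<Sum>j<N. s q (\<Sum>a\<le>K. \<Sum>c\<le>k. \<Sum>b<N - j.
          s ((-1) ^ j * (of_int m gchoose j) * (of_int (M' a + m - int j) gchoose b)) (E a c (j + b))))"
      by (rule sum.cong[OF refl]) (simp add: lhs VS.scale_sum_right mult_ac)
    also have "\<dots> = s q (\<Sum>a\<le>K. \<Sum>c\<le>k. \<Sum>j<N. \<Sum>b<N - j.
          s ((-1) ^ j * (of_int m gchoose j) * (of_int (M' a + m - int j) gchoose b)) (E a c (j + b)))"
      by (simp only: VS.scale_sum_right[symmetric] sum.swap[of _ _ "{..<N}"])
    also have "\<dots> = s q (\<Sum>a\<le>K. \<Sum>c\<le>k. \<Sum>J<N. s (of_int (M' a) gchoose J) (E a c J))"
    proof -
      have "(\<Sum>j<N. \<Sum>b<N - j.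
          s ((-1) ^ j * (of_int m gchoose j) * (of_int (M' a + m - int j) gchoose b)) (E a c (j + b)))
          = (\<Sum>J<N. s (of_int (M' a) gchoose J) (E a c J))" for a c
      proof -
        let ?h = "\<lambda>j b. s ((-1) ^ j * (of_int m gchoose j) * (of_int (M' a + m - int j) gchoose b)) (E a c (j + b))"
        \<comment> \<open>Grouped by \<open>J = j + b\<close>, the coefficients sum by
          \<open>gbinomial_alternating_Vandermonde\<close> with \<open>x = m\<close> and
          \<open>y = M' a + m\<close>; the result \<open>M' a gchoose J\<close> is the coefficient
          in the ordinary Jacobi identity.\<close>
        have "(\<Sum>j<N. \<Sum>b<N - j. ?h j b) = (\<Sum>(j, b)\<in>{(j, b). j + b < N}. ?h j b)"
          by (subst sum.Sigma) (auto intro!: sum.cong)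
        also have "\<dots> = (\<Sum>J<N. \<Sum>j\<le>J. ?h j (J - j))"
          by (rule sum.triangle_reindex)
        also have "\<dots> = (\<Sum>J<N. s (\<Sum>j\<le>J. (-1) ^ j * (of_int m gchoose j) *
            ((of_int (M' a + m) - of_nat j) gchoose (J - j))) (E a c J))"
          by (rule sum.cong[OF refl]) (simp add: VS.scale_sum_left)
        also have "\<dots> = (\<Sum>J<N. s (of_int (M' a) gchoose J) (E a c J))"
          by (simp add: gbinomial_alternating_Vandermonde)
        finally show ?thesis .
      qed
      then show ?thesis by simp
    qed
    also have "\<dots> = s q (\<Sum>a\<le>K. \<Sum>c\<le>k. \<Sum>j<N. s ((-1) ^ j * (of_int l gchoose j)) (A a c j - s e (B a c j)))"
      by (simp add: jac)
    also have "\<dots> = (\<Sum>j<N. s ((-1) ^ j * (of_int l gchoose j)) (s q (\<Sum>a\<le>K. \<Sum>c\<le>k. A a c j - s e (B a c j))))"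
      unfolding VS.scale_sum_right by (subst sum_rotate) (simp only: VS.scale_left_commute[of q])
    also have "\<dots> = (\<Sum>j<N. s ((-1) ^ j * (of_int l gchoose j))
        (opp v (n + int j) (opp u (m + l - int j) w)
         - s e (opp u (m + int j) (opp v (n + l - int j) w))))"
      by (simp only: rhs)
    finally show "(\<Sum>j<N. s (of_int m gchoose j) (opp (vmode V u (l + int j) v) (m + n - int j) w)) =
      (\<Sum>j<N. s ((-1) ^ j * (of_int l gchoose j))
        (opp v (n + int j) (opp u (m + l - int j) w)
         - s ((-1) powi l) (opp u (m + int j) (opp v (n + l - int j) w))))"
      unfolding e_def .
  qed
qed

end

section \<open>Weight spaces of modules and weight shifts\<close>

sublocale weak_module \<subseteq> E: endomorphism_on s "mcarrier M" "mmode M (conf V) 1"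
  by unfold_locales (auto simp: subspace linear_right closed)

lemma (in linear_map_on) subspace_image: "T.subspace (f ` W)"
proof (rule T.subspaceI)
  show "0 \<in> f ` W" using S.subspace_0[OF subspace_dom] by (intro image_eqI[of _ _ 0]) auto
  show "x + y \<in> f ` W" if xy: "x \<in> f ` W" "y \<in> f ` W" for x y
  proof -
    obtain a b where ab: "a \<in> W" "b \<in> W" "x = f a" "y = f b" using xy by blast
    show ?thesis
      by (rule image_eqI[of _ _ "a + b"]) (use ab add S.subspace_add[OF subspace_dom] in auto)
  qed
  show "t c x \<in> f ` W" if x: "x \<in> f ` W" for c x
  proof -
    obtain a where a: "a \<in> W" "x = f a" using x by blast
    show ?thesis
      by (rule image_eqI[of _ _ "s c a"]) (use a scale S.subspace_scale[OF subspace_dom] in auto)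
  qed
qed

text \<open>The image is a \<open>T\<close>-stable subspace containing \<open>(D a ^^ k) x\<close>;
  cancelling \<open>D a\<close> on \<open>G b\<close> \<open>k\<close> times gives \<open>x\<close>.
  By this, generalized eigenvectors of a transpose annihilate the other weights.\<close>

lemma (in endomorphism_on) G_subset_D_pow_image:
  assumes "a \<noteq> b"
  shows "G b \<subseteq> (D a ^^ k) ` U"
proof
  interpret A: linear_map_on s s U "D a ^^ k" by (rule D_pow_linear)
  fix x assume x: "x \<in> G b"
  let ?S = "(D a ^^ k) ` U"
  have stable: "T x \<in> ?S" if "x \<in> ?S" for x
  proof -
    from that obtain y where y: "y \<in> U" "x = (D a ^^ k) y" by blast
    \<comment> \<open>\<open>D 0\<close> is \<open>T\<close> in the form to which
      \<open>D_pow_commute\<close> applies.\<close>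
    have "D 0 x = (D a ^^ k) (D 0 y)"
      unfolding y(2) by (rule D_pow_commute[OF y(1), symmetric])
    then have "T x = (D a ^^ k) (T y)" by simp
    then show ?thesis using closed[OF y(1)] by (rule image_eqI)
  qed
  have "y \<in> ?S" if "y \<in> G b" "(D a ^^ j) y \<in> ?S" for y j
    using that
  proof (induction j arbitrary: y)
    case (Suc j)
    have "D a y \<in> ?S"
      by (rule Suc.IH) (use Suc.prems D_in_G in \<open>auto simp only: funpow_Suc_right o_apply\<close>)
    then show ?case using D_cancel_mem[OF A.subspace_image stable Suc.prems(1) assms] by blast
  qed simp
  then show "x \<in> ?S" using x G_subset by blast
qed

lemma sum_fun_apply: "(sum g A) x = (\<Sum>i\<in>A. g i x)"
  by (induction A rule: infinite_finite_induct) auto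

context voa_module
begin

lemma gen_eigenspace_eq: "gen_eigenspace V s M = E.G"
  by (auto simp: gen_eigenspace_def E.G_def fun_eq_iff)

text \<open>By the commutator with \<open>L(0)\<close>, the mode intertwines \<open>D a\<close> with
  \<open>D (a + d)\<close>, where \<open>d\<close> is its weight shift.\<close>

lemma mode_shift:
  assumes w: "w \<in> E.G a" and v: "v \<in> wt_space V k"
  shows "Y v n w \<in> E.G (a + of_int (int k - n - 1))"
proof -
  let ?d = "of_int (int k - n - 1) :: complex"
  have *: "(E.D (a + ?d) ^^ j) (Y v n x) = Y v n ((E.D a ^^ j) x)" if "x \<in> C" for j x
  proof (induction j)
    case (Suc j)
    let ?x = "(E.D a ^^ j) x"
    have x: "?x \<in> C" by (rule E.D_pow_closed[OF that])
    have "E.D (a + ?d) (Y v n ?x) = Y v n (E.D a ?x)"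
      using L0_commutator[OF x v, of n]
      by (simp only: mode_diff[OF closed[OF x] VS.subspace_scale[OF subspace x]] mode_scale[OF x]
          VS.scale_left_distrib) simp
    then show ?case by (simp only: funpow.simps o_apply Suc)
  qed simp
  from w obtain j where "(E.D a ^^ j) w = 0" "w \<in> C" by (auto simp: E.G_def)
  then have "(E.D (a + ?d) ^^ j) (Y v n w) = 0" "Y v n w \<in> C"
    by (simp_all only: * mode_zero closed)
  then show ?thesis unfolding E.G_def by blast
qed

text \<open>Each \<open>L(1)\<close> lowers the weight of the vector and the mode index by one, so
  all terms of an opposite mode shift weights equally.\<close>

lemma opp_shift:
  assumes w: "w \<in> E.G a" and v: "v \<in> wt_space V k"
  shows "opp v n w \<in> E.G (a - of_int (int k - n - 1))"
proof -
  have wC: "w \<in> C" using w E.G_subset by blast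
  have "Y (alg.dL i v) (2 * int k - int i - n - 2) w \<in> E.G (a - of_int (int k - n - 1))" if "i \<le> k" for i
  proof -
    have "int (k - i) - (2 * int k - int i - n - 2) - 1 = - (int k - n - 1)"
      using that by (simp add: of_nat_diff)
    then show ?thesis
      using mode_shift[OF w alg.dL_wt(1)[OF v that], of "2 * int k - int i - n - 2"]
      by (simp only: of_int_minus add_uminus_conv_diff)
  qed
  then show ?thesis
    unfolding opp_eq_dL[OF wC v]
    by (intro VS.subspace_scale[OF E.G_subspace] VS.subspace_sum[OF E.G_subspace]) auto
qed

lemma opp_vacuum: "w \<in> C \<Longrightarrow> opp (vac V) n w = (if n = -1 then w else 0)"
proof -
  assume w: "w \<in> C"
  have "vac V \<in> wt_space V 0" by (simp add: wt_space_def Lop_def alg.creation)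
  from opp_eq_dL[OF w this, of n] show ?thesis by (simp add: vacuum w)
qed

text \<open>Only \<open>i = 0\<close> survives because \<open>L(1)\<close> kills the conformal
  vector; its sign is \<open>(-1) ^ 2\<close> and its index \<open>4 - 1 - 2 = 1\<close>. Hence
  \<open>L(0)\<close> on the contragredient is the transpose of \<open>L(0)\<close>.\<close>

lemma opp_conf: "w \<in> C \<Longrightarrow> opp (conf V) 1 w = Y (conf V) 1 w"
proof -
  assume w: "w \<in> C"
  have "conf V \<in> wt_space V 2" by (simp add: wt_space_def alg.conf_wt)
  moreover have "alg.dL 1 (conf V) = 0" "alg.dL 2 (conf V) = 0"
    by (simp_all add: alg.dL_def alg.L1_conf numeral_2_eq_2)
  ultimately show ?thesis
    using opp_eq_dL[OF w, of "conf V" 2 1] by (simp add: numeral_2_eq_2 mode_zero_left w)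
qed

text \<open>Being an identity of finite sums, the opposite Jacobi identity extends bilinearly.\<close>

lemma opp_jacobi_all:
  assumes w: "w \<in> C"
  shows "\<forall>\<^sub>F N in sequentially.
    (\<Sum>j<N. s (of_int m gchoose j) (opp (vmode V u (l + int j) v) (m + n - int j) w)) =
    (\<Sum>j<N. s ((-1) ^ j * (of_int l gchoose j))
        (opp v (n + int j) (opp u (m + l - int j) w)
         - s ((-1) powi l) (opp u (m + int j) (opp v (n + l - int j) w))))"
    (is "?P u v")
proof (induction u rule: alg.homogeneous_induct)
  case (wt K u)
  show ?case
  proof (induction v rule: alg.homogeneous_induct)
    case (wt k v)
    then show ?case using opp_jacobi[OF w \<open>u \<in> wt_space V K\<close>] by blast
  next
    case (add v1 v2)
    then show ?case
      by (rule eventually_elim2)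
        (simp add: alg.self.mode_add opp_add_left opp_add opp_closed w VS.scale_right_distrib
          VS.scale_right_diff_distrib sum.distrib sum_subtractf)
  qed
next
  case (add u1 u2)
  then show ?case
    by (rule eventually_elim2)
      (simp add: alg.self.mode_add_left opp_add_left opp_add opp_closed w VS.scale_right_distrib
        VS.scale_right_diff_distrib sum.distrib sum_subtractf)
qed

end

section \<open>The contragredient module\<close>

locale voa_gr_module = voa_module V s M + gr_module V s M
  for V :: "'v::ab_group_add voa_data"
    and s :: "complex \<Rightarrow> 'm::ab_group_add \<Rightarrow> 'm"
    and M :: "('v, 'm) vmodule"
begin

lemma spanned: "w \<in> C \<Longrightarrow> w \<in> VS.span (\<Union>a. E.G a)"
  using grading by (simp add: gen_eigenspace_eq)

lemma span_G: "VS.span (\<Union>a. E.G a) = C"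
  using grading by (simp add: gen_eigenspace_eq)

lemma finite_dim_le:
  obtains F where "finite F" "F \<subseteq> (\<Union>b\<in>{b. Re b \<le> r}. E.G b)" "(\<Union>b\<in>{b. Re b \<le> r}. E.G b) \<subseteq> VS.span F"
  using finite_dimE[OF vector_space grading_restricted[of "of_real r"]] by (auto simp: gen_eigenspace_eq)

text \<open>Finitely many homogeneous vectors span all weight spaces up to \<open>r\<close>; a
  weight that none of them has gives zero component on their whole span.\<close>

lemma finite_weights: "finite {a. Re a \<le> r \<and> E.G a \<noteq> {0}}"
proof -
  obtain F where F: "finite F" "F \<subseteq> (\<Union>b\<in>{b. Re b \<le> r}. E.G b)" "(\<Union>b\<in>{b. Re b \<le> r}. E.G b) \<subseteq> VS.span F"
    by (rule finite_dim_le)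
  from F(2) have "\<forall>x\<in>F. \<exists>b. x \<in> E.G b" by blast
  then obtain h where h: "\<And>x. x \<in> F \<Longrightarrow> x \<in> E.G (h x)" by metis
  have "a \<in> h ` F" if a: "Re a \<le> r" "E.G a \<noteq> {0}" for a
  proof (rule ccontr)
    assume na: "a \<notin> h ` F"
    have FC: "F \<subseteq> C" using F(2) E.G_subset by blast
    have sub: "VS.subspace {x \<in> C. E.comp x a = 0}"
      by (rule VS.subspaceI) (auto simp: C_simps E.comp_add E.comp_scale spanned E.comp_in_G[of 0 a])
    have "F \<subseteq> {x \<in> C. E.comp x a = 0}"
      using FC h na by (auto simp: E.comp_in_G[OF h])
    then have "VS.span F \<subseteq> {x \<in> C. E.comp x a = 0}" by (rule VS.span_minimal[OF _ sub])
    moreover have "E.G a \<subseteq> VS.span F" using F(3) a(1) by blast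
    ultimately have "E.G a \<subseteq> {0}" using E.comp_in_G[of _ a] by fastforce
    then show False using a(2) E.zero_in_G by blast
  qed
  then have "{a. Re a \<le> r \<and> E.G a \<noteq> {0}} \<subseteq> h ` F" by blast
  then show ?thesis using F(1) finite_surj by blast
qed

text \<open>This bound is what truncates the modes of the contragredient.\<close>

lemma weights_bounded_below:
  obtains r where "\<And>a. E.G a \<noteq> {0} \<Longrightarrow> r \<le> Re a"
proof -
  let ?A = "insert 0 (Re ` {a. Re a \<le> 0 \<and> E.G a \<noteq> {0}})"
  have fin: "finite ?A" using finite_weights[of 0] by simp
  show thesis
  proof (rule that[of "Min ?A"])
    fix a assume "E.G a \<noteq> {0}"
    show "Min ?A \<le> Re a"
    proof (cases "Re a \<le> 0")
      case True
      then show ?thesis using fin \<open>E.G a \<noteq> {0}\<close> by (intro Min_le) auto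
    next
      case False
      moreover have "Min ?A \<le> 0" using fin by (intro Min_le) auto
      ultimately show ?thesis by linarith
    qed
  qed
qed

text \<open>The graded dual: functionals supported on finitely many weights, extended by zero so
  that each is a single function.\<close>

definition dual_carrier :: "('m \<Rightarrow> complex) set"
  where "dual_carrier = {f. linear_on s (*) C f \<and> (\<forall>w. w \<notin> C \<longrightarrow> f w = 0) \<and>
    (\<exists>A. finite A \<and> (\<forall>a. a \<notin> A \<longrightarrow> (\<forall>w\<in>E.G a. f w = 0)))}"

definition contragredient :: "('v, 'm \<Rightarrow> complex) vmodule"
  where "contragredient = \<lparr>mcarrier = dual_carrier,
    mmode = \<lambda>v n f w. if w \<in> C then f (opp v n w) else 0\<rparr>"

lemma dual_linear: "linear_on s (*) C f \<Longrightarrow> linear_map_on s (*) C f"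
  by (intro linear_map_on.intro linear_map_on_axioms.intro vector_space vector_space_mult subspace)

lemma dual_carrier_linear: "f \<in> dual_carrier \<Longrightarrow> linear_map_on s (*) C f"
  by (rule dual_linear) (simp add: dual_carrier_def)

lemma dual_outside: "f \<in> dual_carrier \<Longrightarrow> w \<notin> C \<Longrightarrow> f w = 0"
  by (simp add: dual_carrier_def)

lemma functional_eqI:
  assumes "linear_on s (*) C f" "linear_on s (*) C g" "\<And>a w. w \<in> E.G a \<Longrightarrow> f w = g w" "w \<in> C"
  shows "f w = g w"
proof -
  interpret f: linear_map_on s "(*)" C f by (rule dual_linear) fact
  interpret g: linear_map_on s "(*)" C g by (rule dual_linear) fact
  have "linear_map_on s (*) C (\<lambda>x. f x - g x)"
    by (rule dual_linear) (auto simp: linear_on_def f.add g.add f.scale g.scale algebra_simps)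
  then have "f w - g w = 0"
    by (rule linear_map_on.zero_on_span[of s "(*)" C _ "\<Union>a. E.G a"])
      (use assms(3,4) spanned subsetD[OF E.G_subset] in auto)
  then show ?thesis by simp
qed

lemma dual_eqI:
  assumes "f \<in> dual_carrier" "g \<in> dual_carrier" "\<And>a w. w \<in> E.G a \<Longrightarrow> f w = g w"
  shows "f = g"
proof
  fix w show "f w = g w"
    using functional_eqI[of f g w] assms by (cases "w \<in> C") (auto simp: dual_carrier_def)
qed

lemma dual_subspace: "module.subspace fscale dual_carrier"
proof -
  interpret F: vector_space fscale by (rule vector_space_fscale)
  show ?thesis
  proof (rule F.subspaceI)
    show "0 \<in> dual_carrier" by (auto simp: dual_carrier_def linear_on_def)
  next
    fix f g assume f: "f \<in> dual_carrier" and g: "g \<in> dual_carrier"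
    obtain A where A: "finite A" "\<And>a w. a \<notin> A \<Longrightarrow> w \<in> E.G a \<Longrightarrow> f w = 0"
      using f by (auto simp: dual_carrier_def)
    obtain B where B: "finite B" "\<And>a w. a \<notin> B \<Longrightarrow> w \<in> E.G a \<Longrightarrow> g w = 0"
      using g by (auto simp: dual_carrier_def)
    have "linear_on s (*) C (f + g)"
      using f g by (auto simp: dual_carrier_def linear_on_def algebra_simps)
    moreover have "\<forall>a. a \<notin> A \<union> B \<longrightarrow> (\<forall>w\<in>E.G a. (f + g) w = 0)" using A(2) B(2) by auto
    ultimately show "f + g \<in> dual_carrier"
      using f g A(1) B(1) unfolding dual_carrier_def by (auto intro!: exI[of _ "A \<union> B"])
  next
    fix c f assume "f \<in> dual_carrier"
    then show "fscale c f \<in> dual_carrier"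
      by (auto simp: dual_carrier_def linear_on_def fscale_def algebra_simps)
  qed
qed

lemma mode_contra: "mmode contragredient v n f = (\<lambda>w. if w \<in> C then f (opp v n w) else 0)"
  by (simp add: contragredient_def)

lemma carrier_contra: "mcarrier contragredient = dual_carrier"
  by (simp add: contragredient_def)

lemma contra_add_left:
  "f \<in> dual_carrier \<Longrightarrow> mmode contragredient (u + v) n f = mmode contragredient u n f + mmode contragredient v n f"
  using linear_map_on.add[OF dual_carrier_linear] by (auto simp: mode_contra opp_add_left opp_closed fun_eq_iff)

lemma contra_mode_vanishes:
  assumes f: "f \<in> dual_carrier" and A: "\<And>a w. a \<notin> A \<Longrightarrow> w \<in> E.G a \<Longrightarrow> f w = 0"
    and v: "v \<in> wt_space V k" and "b \<notin> (\<lambda>a. a + of_int (int k - n - 1)) ` A" "w \<in> E.G b"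
  shows "mmode contragredient v n f w = 0"
proof -
  have "b - of_int (int k - n - 1) \<notin> A"
    using assms(4) by (metis diff_add_cancel imageI)
  then show ?thesis
    using A opp_shift[OF assms(5) v] assms(5) E.G_subset by (auto simp: mode_contra)
qed

lemma contra_linear_on: "f \<in> dual_carrier \<Longrightarrow> linear_on s (*) C (mmode contragredient v n f)"
  using linear_map_on.add[OF dual_carrier_linear] linear_map_on.scale[OF dual_carrier_linear]
  by (simp add: linear_on_def mode_contra C_simps opp_add opp_scale opp_closed)

lemma contra_closed:
  assumes f: "f \<in> dual_carrier"
  shows "mmode contragredient v n f \<in> dual_carrier"
proof -
  interpret F: vector_space fscale by (rule vector_space_fscale)
  show ?thesis
  proof (induction v rule: alg.homogeneous_induct)
    case (wt k v)
    obtain A where A: "finite A" "\<And>a w. a \<notin> A \<Longrightarrow> w \<in> E.G a \<Longrightarrow> f w = 0"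
      using f by (auto simp: dual_carrier_def)
    have "\<forall>b. b \<notin> (\<lambda>a. a + of_int (int k - n - 1)) ` A \<longrightarrow> (\<forall>w\<in>E.G b. mmode contragredient v n f w = 0)"
      by (intro allI impI ballI) (rule contra_mode_vanishes[OF f A(2) wt])
    moreover have "finite ((\<lambda>a. a + of_int (int k - n - 1)) ` A)" using A(1) by (rule finite_imageI)
    ultimately show ?case
      unfolding dual_carrier_def using contra_linear_on[OF f, of v n]
      by (intro CollectI conjI) (auto simp only: mode_contra if_False)
  next
    case (add u v)
    then show ?case unfolding contra_add_left[OF f] by (rule F.subspace_add[OF dual_subspace])
  qed
qed

lemma contra_truncation:
  assumes f: "f \<in> dual_carrier"
  shows "\<exists>N. \<forall>n\<ge>N. mmode contragredient v n f = 0"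
proof (induction v rule: alg.homogeneous_induct)
  case (wt k v)
  obtain A where A: "finite A" "\<And>a w. a \<notin> A \<Longrightarrow> w \<in> E.G a \<Longrightarrow> f w = 0"
    using f by (auto simp: dual_carrier_def)
  obtain r where r: "\<And>a. E.G a \<noteq> {0} \<Longrightarrow> r \<le> Re a" by (rule weights_bounded_below) blast
  define R where "R = Max (insert 0 (Re ` A))"
  have R: "Re a \<le> R" if "a \<in> A" for a unfolding R_def using A(1) that by (intro Max_ge) auto
  \<comment> \<open>For \<open>n \<ge> ?N\<close> the support of \<open>f\<close> would be moved to
    weights of real part at most \<open>r - 1\<close>, where the module is zero.\<close>
  let ?N = "\<lceil>R - r + real k\<rceil>"
  have "mmode contragredient v n f = 0" if n: "n \<ge> ?N" for n
  proof (rule dual_eqI)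
    fix b w assume w: "w \<in> E.G b"
    show "mmode contragredient v n f w = 0 w"
    proof (cases "E.G b = {0}")
      case True
      then show ?thesis
        using w linear_map_on.zero[OF dual_linear[OF contra_linear_on[OF f]]] by auto
    next
      case False
      have "b \<notin> (\<lambda>a. a + of_int (int k - n - 1)) ` A"
      proof
        assume "b \<in> (\<lambda>a. a + of_int (int k - n - 1)) ` A"
        then obtain a where a: "a \<in> A" "b = a + of_int (int k - n - 1)" by blast
        then have "Re b = Re a + (real k - of_int n - 1)" by simp
        moreover have "R - r + real k \<le> of_int n" using n by linarith
        ultimately show False using r[OF False] R[OF a(1)] by linarith
      qed
      from contra_mode_vanishes[OF f A(2) wt this w] show ?thesis by simp
    qed
  qed (use contra_closed[OF f] dual_subspace module.subspace_0 vector_space_fscale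
        module_iff_vector_space in blast)+
  then show ?case by blast
next
  case (add u v)
  then obtain N N' where "\<forall>n\<ge>N. mmode contragredient u n f = 0" "\<forall>n\<ge>N'. mmode contragredient v n f = 0"
    by blast
  then show ?case
    by (intro exI[of _ "max N N'"]) (simp add: contra_add_left[OF f])
qed

text \<open>Transposition reverses products, and \<open>opp_jacobi_all\<close> has them in reversed
  order, so it suffices to apply \<open>f\<close>. The check is made at each \<open>w\<close>
  separately since the cutoff in \<open>opp_jacobi_all\<close> depends on \<open>w\<close>.\<close>

lemma contra_jacobi: "jacobi_identity V fscale dual_carrier (mmode contragredient)"
  unfolding jacobi_identity_def
proof (intro allI ballI)
  fix u v l m n f assume f: "f \<in> dual_carrier"
  interpret f: linear_map_on s "(*)" C f by (rule dual_carrier_linear[OF f])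
  let ?Y = "mmode contragredient"
  let ?L = "\<lambda>j::nat. fscale (of_int m gchoose j) (?Y (vmode V u (l + int j) v) (m + n - int j) f)"
  let ?R = "\<lambda>j::nat. fscale ((-1) ^ j * (of_int l gchoose j)) (?Y u (m + l - int j) (?Y v (n + int j) f)
         - fscale ((-1) powi l) (?Y v (n + l - int j) (?Y u (m + int j) f)))"
  have Y0: "?Y u n 0 = 0" for u n by (auto simp: mode_contra)
  have YZ: "?Y 0 n f = 0" for n by (auto simp: mode_contra opp_zero_left)
  have "\<forall>\<^sub>F N in sequentially. \<forall>j\<ge>N. vmode V u (l + int j) v = 0 \<and> ?Y v (n + int j) f = 0 \<and> ?Y u (m + int j) f = 0"
    by (intro eventually_all_ge_at_top eventually_conj eventually_int[OF alg.truncation]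
        eventually_int[OF contra_truncation[OF f]])
  then have ev: "\<forall>\<^sub>F N in sequentially. Sum_any ?L = (\<Sum>j<N. ?L j) \<and> Sum_any ?R = (\<Sum>j<N. ?R j)"
  proof (rule eventually_mono)
    fix N assume N: "\<forall>j\<ge>N. vmode V u (l + int j) v = 0 \<and> ?Y v (n + int j) f = 0 \<and> ?Y u (m + int j) f = 0"
    have "?L j = 0" "?R j = 0" if "j \<ge> N" for j
      using N that by (auto simp: YZ Y0 fscale_def)
    then show "Sum_any ?L = (\<Sum>j<N. ?L j) \<and> Sum_any ?R = (\<Sum>j<N. ?R j)"
      by (intro conjI Sum_any_lessThan) auto
  qed
  show "Sum_any ?L = Sum_any ?R"
  proof
    fix w
    show "Sum_any ?L w = Sum_any ?R w"
    proof (cases "w \<in> C")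
      case False
      obtain N where "Sum_any ?L = (\<Sum>j<N. ?L j)" "Sum_any ?R = (\<Sum>j<N. ?R j)"
        using eventually_happens'[OF sequentially_bot ev] by blast
      then show ?thesis using False by (simp add: sum_fun_apply mode_contra fscale_def)
    next
      case w: True
      obtain N where N: "Sum_any ?L = (\<Sum>j<N. ?L j)" "Sum_any ?R = (\<Sum>j<N. ?R j)" and
        J: "(\<Sum>j<N. s (of_int m gchoose j) (opp (vmode V u (l + int j) v) (m + n - int j) w)) =
          (\<Sum>j<N. s ((-1) ^ j * (of_int l gchoose j))
            (opp v (n + int j) (opp u (m + l - int j) w)
             - s ((-1) powi l) (opp u (m + int j) (opp v (n + l - int j) w))))"
        using eventually_happens'[OF sequentially_bot eventually_conj[OF ev opp_jacobi_all[OF w, of m u l v n]]]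
        by blast
      have "(\<Sum>j<N. ?L j) w = f (\<Sum>j<N. s (of_int m gchoose j) (opp (vmode V u (l + int j) v) (m + n - int j) w))"
        by (subst f.sum) (simp_all add: sum_fun_apply mode_contra fscale_def f.scale opp_closed w C_simps)
      also have "\<dots> = (\<Sum>j<N. ?R j) w"
        unfolding J
        by (subst f.sum)
          (simp_all add: sum_fun_apply mode_contra fscale_def f.scale f.diff opp_closed w C_simps)
      finally show ?thesis using N by simp
    qed
  qed
qed

lemma contra_weak_module: "weak_module V fscale contragredient"
proof -
  interpret F: vector_space fscale by (rule vector_space_fscale)
  show ?thesis
  proof (rule weak_module.intro)
    show "vector_space (fscale :: complex \<Rightarrow> ('m \<Rightarrow> complex) \<Rightarrow> _)" by (rule vector_space_fscale)
    show "F.subspace (mcarrier contragredient)" by (simp add: carrier_contra dual_subspace)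
    show "jacobi_identity V fscale (mcarrier contragredient) (mmode contragredient)"
      by (simp add: carrier_contra contra_jacobi)
    fix v n show "linear_on fscale fscale (mcarrier contragredient) (mmode contragredient v n)"
      by (auto simp: linear_on_def mode_contra fscale_def)
  next
    fix f n assume f: "f \<in> mcarrier contragredient"
    then have f': "f \<in> dual_carrier" by (simp add: carrier_contra)
    interpret f: linear_map_on s "(*)" C f by (rule dual_carrier_linear[OF f'])
    show "mmode contragredient v n f \<in> mcarrier contragredient" for v
      using contra_closed[OF f'] by (simp add: carrier_contra)
    show "Vector_Spaces.linear (vscale V) fscale (\<lambda>v. mmode contragredient v n f)"
      unfolding linear_UNIV_iff
      using f' by (auto simp: linear_on_def contra_add_left alg.vector_space vector_space_fscale)
        (auto simp: mode_contra fscale_def opp_scale_left f.scale opp_closed)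
    show "\<exists>N. \<forall>n\<ge>N. mmode contragredient v n f = 0" for v
      using contra_truncation[OF f'] .
    show "mmode contragredient (vac V) n f = (if n = -1 then f else 0)"
      using dual_outside[OF f'] by (auto simp: mode_contra opp_vacuum fun_eq_iff)
  qed
qed

lemma contra_conf_pow:
  assumes "f \<in> dual_carrier" "w \<in> C"
  shows "((\<lambda>g. mmode contragredient (conf V) 1 g - fscale a g) ^^ k) f w = f ((E.D a ^^ k) w)"
  using assms
proof (induction k arbitrary: w)
  case (Suc k)
  interpret f: linear_map_on s "(*)" C f by (rule dual_carrier_linear[OF assms(1)])
  let ?g = "((\<lambda>g. mmode contragredient (conf V) 1 g - fscale a g) ^^ k) f"
  have "((\<lambda>g. mmode contragredient (conf V) 1 g - fscale a g) ^^ Suc k) f w = ?g (Y (conf V) 1 w) - a * ?g w"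
    using Suc.prems by (simp add: mode_contra opp_conf fscale_def)
  also have "\<dots> = f ((E.D a ^^ k) (Y (conf V) 1 w)) - a * f ((E.D a ^^ k) w)"
    by (simp only: Suc.IH[OF Suc.prems(1) closed[OF Suc.prems(2)]] Suc.IH[OF Suc.prems])
  also have "\<dots> = f ((E.D a ^^ k) (E.D a w))"
  proof -
    interpret D: linear_map_on s s C "E.D a ^^ k" by (rule E.D_pow_linear)
    show ?thesis
      using Suc.prems closed E.D_pow_closed by (simp only: D.diff D.scale C_simps f.diff f.scale)
  qed
  finally show ?case by (simp only: funpow_Suc_right o_apply)
qed simp

lemma comp_other: "w \<in> E.G b \<Longrightarrow> b \<noteq> a \<Longrightarrow> E.comp w a = 0"
  by (simp add: E.comp_in_G)

text \<open>Projecting to one weight forces finite support; this is the source of the functionals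
  constructed below.\<close>

lemma contra_component:
  assumes "linear_on s (*) (E.G a) f"
  shows "(\<lambda>w. if w \<in> C then f (E.comp w a) else 0) \<in> dual_carrier"
proof -
  interpret f: linear_map_on s "(*)" "E.G a" f
    by (intro linear_map_on.intro linear_map_on_axioms.intro vector_space vector_space_mult E.G_subspace assms)
  have "(if w \<in> C then f (E.comp w a) else 0) = 0" if "b \<noteq> a" "w \<in> E.G b" for b w
    using comp_other[OF that(2) that(1)] by simp
  moreover have "linear_on s (*) C (\<lambda>w. if w \<in> C then f (E.comp w a) else 0)"
    by (simp add: linear_on_def C_simps E.comp_add E.comp_scale spanned f.add f.scale E.comp_in)
  ultimately show ?thesis
    unfolding dual_carrier_def by (intro CollectI conjI exI[of _ "{a}"]) simp_all
qed

lemma dual_linear_on_G: "f \<in> dual_carrier \<Longrightarrow> linear_on s (*) (E.G a) f"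
  using linear_map_on.linear_on[OF dual_carrier_linear] subsetD[OF E.G_subset]
  by (simp add: linear_on_def)

lemma dual_sum_components:
  assumes f: "f \<in> dual_carrier" and A: "finite A" "\<And>a w. a \<notin> A \<Longrightarrow> w \<in> E.G a \<Longrightarrow> f w = 0"
  shows "(\<Sum>a\<in>A. (\<lambda>w. if w \<in> C then f (E.comp w a) else 0)) = f" (is "(\<Sum>a\<in>A. ?f a) = f")
proof (rule dual_eqI[OF _ f])
  interpret F: vector_space fscale by (rule vector_space_fscale)
  interpret f: linear_map_on s "(*)" C f by (rule dual_carrier_linear[OF f])
  show "(\<Sum>a\<in>A. ?f a) \<in> dual_carrier"
    by (rule F.subspace_sum[OF dual_subspace]) (rule contra_component[OF dual_linear_on_G[OF f]])
  fix b w assume w: "w \<in> E.G b"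
  then have "w \<in> C" using E.G_subset by blast
  then have "(\<Sum>a\<in>A. ?f a) w = (\<Sum>a\<in>A. if a = b then f w else 0)"
    unfolding sum_fun_apply by (intro sum.cong) (auto simp: E.comp_in_G[OF w])
  also have "\<dots> = f w" using A w by auto
  finally show "(\<Sum>a\<in>A. ?f a) w = f w" .
qed

lemma finite_basis_G:
  obtains B where "finite B" "B \<subseteq> E.G a" "E.G a \<subseteq> VS.span B" "VS.independent B"
proof -
  obtain F where F: "finite F" "(\<Union>b\<in>{b. Re b \<le> Re a}. E.G b) \<subseteq> VS.span F"
    using finite_dim_le[of "Re a"] by metis
  have sub: "E.G a \<subseteq> VS.span F" by (rule subset_trans[OF _ F(2)]) auto
  show thesis
    by (rule VS.span_subset_basis[OF sub]) (use F(1) that in metis)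
qed

text \<open>Membership in \<open>E.G a\<close> gives an exponent for each vector; finite dimension
  makes it uniform, as nilpotency of the transpose requires.\<close>

lemma nilpotent_on_G:
  obtains k where "\<And>w. w \<in> E.G a \<Longrightarrow> (E.D a ^^ k) w = 0"
proof -
  obtain F where F: "finite F" "F \<subseteq> E.G a" "E.G a \<subseteq> VS.span F" "VS.independent F"
    by (rule finite_basis_G)
  from F(2) have "\<forall>x\<in>F. \<exists>k. (E.D a ^^ k) x = 0" by (auto simp: E.G_def)
  then obtain h where h: "\<And>x. x \<in> F \<Longrightarrow> (E.D a ^^ h x) x = 0" by metis
  let ?k = "Max (h ` F)"
  interpret D: linear_map_on s s C "E.D a ^^ ?k" by (rule E.D_pow_linear)
  have "(E.D a ^^ ?k) w = 0" if "w \<in> E.G a" for w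
  proof (rule D.zero_on_span[of F])
    show "F \<subseteq> C" by (rule subset_trans[OF F(2) E.G_subset])
    show "w \<in> VS.span F" by (rule subsetD[OF F(3) that])
    show "(E.D a ^^ ?k) x = 0" if "x \<in> F" for x
      by (rule E.D_pow_le[OF h[OF that]]) (use F(1) that in auto)
  qed
  then show thesis by (rule that)
qed

text \<open>The other weight spaces lie in the image of \<open>(L(0) - a)^k\<close>, so a functional
  killed by the transpose vanishes there. Conversely this power is zero on weight \<open>a\<close>
  for a uniform \<open>k\<close>.\<close>

lemma contra_gen_eigenspace:
  "gen_eigenspace V fscale contragredient a = {f \<in> dual_carrier. \<forall>b. b \<noteq> a \<longrightarrow> (\<forall>w\<in>E.G b. f w = 0)}"
proof (intro equalityI subsetI)
  fix f assume "f \<in> gen_eigenspace V fscale contragredient a"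
  then obtain k where f: "f \<in> dual_carrier"
    and k: "((\<lambda>g. mmode contragredient (conf V) 1 g - fscale a g) ^^ k) f = 0"
    by (auto simp: gen_eigenspace_def carrier_contra)
  have "f w = 0" if "b \<noteq> a" "w \<in> E.G b" for b w
  proof -
    have "w \<in> (E.D a ^^ k) ` C" using E.G_subset_D_pow_image[of a b k] that by blast
    then obtain y where "y \<in> C" "w = (E.D a ^^ k) y" by blast
    then show ?thesis using contra_conf_pow[OF f, of y k a] k by simp
  qed
  then show "f \<in> {f \<in> dual_carrier. \<forall>b. b \<noteq> a \<longrightarrow> (\<forall>w\<in>E.G b. f w = 0)}" using f by blast
next
  fix f assume "f \<in> {f \<in> dual_carrier. \<forall>b. b \<noteq> a \<longrightarrow> (\<forall>w\<in>E.G b. f w = 0)}"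
  then have f: "f \<in> dual_carrier" and 0: "\<And>b w. b \<noteq> a \<Longrightarrow> w \<in> E.G b \<Longrightarrow> f w = 0" by auto
  interpret f: linear_map_on s "(*)" C f by (rule dual_carrier_linear[OF f])
  obtain k where k: "\<And>w. w \<in> E.G a \<Longrightarrow> (E.D a ^^ k) w = 0" by (rule nilpotent_on_G) blast
  let ?g = "((\<lambda>g. mmode contragredient (conf V) 1 g - fscale a g) ^^ k) f"
  interpret F: vector_space fscale by (rule vector_space_fscale)
  have g: "((\<lambda>g. mmode contragredient (conf V) 1 g - fscale a g) ^^ j) f \<in> dual_carrier" for j
  proof (induction j)
    case (Suc j)
    show ?case
      unfolding funpow.simps o_apply
      by (rule F.subspace_diff[OF dual_subspace contra_closed[OF Suc] F.subspace_scale[OF dual_subspace Suc]])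
  qed (use f in simp)
  have DG: "(E.D a ^^ j) w \<in> E.G b" if "w \<in> E.G b" for j w b
    by (induction j) (use that E.D_in_G in auto)
  have "?g = 0"
  proof (rule dual_eqI[OF g F.subspace_0[OF dual_subspace]])
    fix b w assume w: "w \<in> E.G b"
    then have "?g w = f ((E.D a ^^ k) w)" using contra_conf_pow[OF f] E.G_subset by blast
    also have "\<dots> = 0" using k 0 w DG[OF w] by (cases "b = a") auto
    finally show "?g w = 0 w" by simp
  qed
  then show "f \<in> gen_eigenspace V fscale contragredient a"
    using f by (auto simp: gen_eigenspace_def carrier_contra)
qed

lemma contra_gr_module: "gr_module V fscale contragredient"
proof -
  interpret F: vector_space fscale by (rule vector_space_fscale)
  interpret W: weak_module V fscale contragredient by (rule contra_weak_module)
  show ?thesis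
  proof
    let ?G = "gen_eigenspace V fscale contragredient"
    show "F.span (\<Union>a. ?G a) = mcarrier contragredient"
    proof
      have "(\<Union>a. ?G a) \<subseteq> dual_carrier" by (auto simp: contra_gen_eigenspace)
      then show "F.span (\<Union>a. ?G a) \<subseteq> mcarrier contragredient"
        using F.span_minimal[OF _ dual_subspace] by (simp add: carrier_contra)
      show "mcarrier contragredient \<subseteq> F.span (\<Union>a. ?G a)"
      proof
        fix f assume "f \<in> mcarrier contragredient"
        then have f: "f \<in> dual_carrier" by (simp add: carrier_contra)
        interpret f: linear_map_on s "(*)" C f by (rule dual_carrier_linear[OF f])
        obtain A where A: "finite A" "\<And>a w. a \<notin> A \<Longrightarrow> w \<in> E.G a \<Longrightarrow> f w = 0"
          using f by (auto simp: dual_carrier_def)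
        let ?f = "\<lambda>a w. if w \<in> C then f (E.comp w a) else 0"
        have fG: "?f a \<in> ?G a" for a
          using contra_component[OF dual_linear_on_G[OF f], of a] by (auto simp: contra_gen_eigenspace E.comp_in_G)
        have "(\<Sum>a\<in>A. ?f a) = f" by (rule dual_sum_components[OF f A])
        moreover have "(\<Sum>a\<in>A. ?f a) \<in> F.span (\<Union>a. ?G a)"
          by (rule F.span_sum) (use fG in \<open>blast intro: F.span_base\<close>)
        ultimately show "f \<in> F.span (\<Union>a. ?G a)" by simp
      qed
    qed
    fix a
    \<comment> \<open>A functional in \<open>?S\<close> is determined by its values on the finite
      set \<open>F\<close>, which spans the weights of real part up to \<open>Re a\<close>.\<close>
    let ?S = "{f \<in> dual_carrier. \<forall>b. Re b > Re a \<longrightarrow> (\<forall>w\<in>E.G b. f w = 0)}"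
    obtain F where F: "finite F" "F \<subseteq> (\<Union>b\<in>{b. Re b \<le> Re a}. E.G b)"
      "(\<Union>b\<in>{b. Re b \<le> Re a}. E.G b) \<subseteq> VS.span F"
      by (rule finite_dim_le)
    have "finite_dim fscale ?S"
    proof (rule finite_dim_eval[OF _ F(1)])
      show "F.subspace ?S"
      proof (rule F.subspaceI)
        show "0 \<in> ?S" using F.subspace_0[OF dual_subspace] by simp
        show "f + g \<in> ?S" if "f \<in> ?S" "g \<in> ?S" for f g
          using that F.subspace_add[OF dual_subspace] by simp
        show "fscale c f \<in> ?S" if "f \<in> ?S" for f c
          using that F.subspace_scale[OF dual_subspace] by (simp add: fscale_def)
      qed
      fix f assume f: "f \<in> ?S" and fF: "\<And>e. e \<in> F \<Longrightarrow> f e = 0"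
      interpret f: linear_map_on s "(*)" C f by (rule dual_carrier_linear) (use f in simp)
      have FC: "F \<subseteq> C" using F(2) E.G_subset by blast
      show "f = 0"
      proof (rule dual_eqI[OF _ F.subspace_0[OF dual_subspace]])
        fix b w assume w: "w \<in> E.G b"
        show "f w = 0 w"
        proof (cases "Re b \<le> Re a")
          case True
          then have "w \<in> VS.span F" using w F(3) by blast
          then show ?thesis using f.zero_on_span[OF FC fF] by simp
        qed (use f w in \<open>auto simp: not_le\<close>)
      qed (use f in simp)
    qed
    moreover have "(\<Union>b\<in>{b. Re b \<le> Re a}. ?G b) \<subseteq> ?S"
    proof
      fix f assume "f \<in> (\<Union>b\<in>{b. Re b \<le> Re a}. ?G b)"
      then obtain c where c: "Re c \<le> Re a" "f \<in> dual_carrier" "\<And>b w. b \<noteq> c \<Longrightarrow> w \<in> E.G b \<Longrightarrow> f w = 0"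
        by (auto simp: contra_gen_eigenspace)
      have "f w = 0" if "Re b > Re a" "w \<in> E.G b" for b w
        by (rule c(3)[OF _ that(2)]) (use c(1) that(1) in auto)
      then show "f \<in> ?S" using c(2) by blast
    qed
    ultimately show "finite_dim fscale (\<Union>b\<in>{b. Re b \<le> Re a}. ?G b)"
      unfolding finite_dim_def by (meson order_trans)
  qed
qed

end

section \<open>Passing from opposite modes to modes, and duality with the lowest vectors\<close>

context voa_module
begin

text \<open>The opposite modes are triangular with respect to the weight: the leading term of \<open>Y'(v)_n\<close> is a
  mode of \<open>v\<close> itself, the others involve vectors of lower weight and shift weights equally.\<close>

lemma opp_triangular:
  assumes U: "VS.subspace U" and w: "w \<in> C"
    and opp: "\<And>k v n. v \<in> wt_space V k \<Longrightarrow> Q (int k - n - 1) \<Longrightarrow> opp v n w \<in> U"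
    and v: "v \<in> wt_space V k" and Q: "Q (n + 1 - int k)"
  shows "Y v n w \<in> U"
  using v Q
proof (induction k arbitrary: v n rule: less_induct)
  case (less k)
  let ?y = "\<lambda>i. Y (alg.dL i v) (n - int i) w"
  \<comment> \<open>The index is reflected so that the leading term is \<open>Y v n w\<close>. The
    \<open>i\<close>-th term has the same weight shift and a vector of weight \<open>k - i\<close>,
    so the induction hypothesis covers \<open>i > 0\<close>.\<close>
  have "opp v (2 * int k - n - 2) w = s ((-1) ^ k) (\<Sum>i\<le>k. ?y i)"
    unfolding opp_eq_dL[OF w less.prems(1)]
    by (intro arg_cong[where f = "s _"] sum.cong arg_cong2[where f = "\<lambda>x p. Y x p w"]) auto
  moreover have "opp v (2 * int k - n - 2) w \<in> U"
    by (rule opp[OF less.prems(1)]) (use less.prems(2) in \<open>simp add: algebra_simps\<close>)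
  ultimately have "s ((-1) ^ k) (\<Sum>i\<le>k. ?y i) \<in> U" by simp
  then have "s ((-1) ^ k) (s ((-1) ^ k) (\<Sum>i\<le>k. ?y i)) \<in> U" by (rule VS.subspace_scale[OF U])
  then have "(\<Sum>i\<le>k. ?y i) \<in> U"
    by (simp flip: power_add)
  moreover have "(\<Sum>i\<in>{..k} - {0}. ?y i) \<in> U"
  proof (rule VS.subspace_sum[OF U])
    fix i assume "i \<in> {..k} - {0}"
    then have i: "i \<le> k" "i > 0" by auto
    show "?y i \<in> U"
      by (rule less.IH[OF _ alg.dL_wt(1)[OF less.prems(1) i(1)]])
        (use i less.prems(2) in \<open>auto simp: of_nat_diff algebra_simps\<close>)
  qed
  moreover have "(\<Sum>i\<le>k. ?y i) = ?y 0 + (\<Sum>i\<in>{..k} - {0}. ?y i)"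
    by (rule sum.remove) auto
  ultimately show ?case using VS.subspace_diff[OF U] by fastforce
qed

text \<open>Invariance of a pairing yields stability under opposite modes, whereas submodules are
  defined by the modes themselves.\<close>

lemma mode_mem_if_opp_mem:
  assumes U: "VS.subspace U" and w: "w \<in> C" and opp: "\<And>v n. opp v n w \<in> U"
  shows "Y v n w \<in> U"
proof (induction v rule: alg.homogeneous_induct)
  case (wt k v)
  show ?case by (rule opp_triangular[where Q = "\<lambda>_. True", OF U w opp wt]) simp
next
  case (add u v)
  then show ?case using VS.subspace_add[OF U] by (simp add: mode_add_left w)
qed

end

context voa_gr_module
begin

lemma dual_separates:
  assumes x: "x \<in> C" "x \<noteq> 0"
  shows "\<exists>f\<in>dual_carrier. f x \<noteq> 0"
proof -
  interpret P: vector_space_pair s "(*) :: complex \<Rightarrow> complex \<Rightarrow> complex"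
    by (intro vector_space_pair.intro vector_space vector_space_mult)
  have "\<exists>a. E.comp x a \<noteq> 0"
  proof (rule ccontr)
    assume "\<nexists>a. E.comp x a \<noteq> 0"
    then have "E.comp x = (\<lambda>_. 0)" by auto
    then show False using E.Sum_any_comp[OF spanned[OF x(1)]] x(2) by simp
  qed
  then obtain a where a: "E.comp x a \<noteq> 0" by blast
  have "VS.independent {E.comp x a}" using a by simp
  from P.linear_independent_extend[OF this, of "\<lambda>_. 1"] obtain g
    where g: "Vector_Spaces.linear s (*) g" "g (E.comp x a) = (1 :: complex)" by auto
  have "linear_on s (*) (E.G a) g"
    using g(1) by (simp add: linear_UNIV_iff linear_on_def)
  from contra_component[OF this] show ?thesis using g(2) x(1) by (intro bexI) auto
qed

text \<open>Reflexivity of a finite-dimensional weight space: the \<open>c b\<close> are the dual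
  basis of \<open>B\<close>, and \<open>g\<close> is evaluation at the combination of
  \<open>B\<close> with coefficients \<open>g (c b)\<close>. On the whole graded dual,
  \<open>g\<close> may correspond to an infinite formal sum of vectors.\<close>

lemma dual_functional_eval:
  assumes g: "linear_on fscale (*) dual_carrier g"
  shows "\<exists>x\<in>E.G a. \<forall>f\<in>dual_carrier. (\<forall>b. b \<noteq> a \<longrightarrow> (\<forall>w\<in>E.G b. f w = 0)) \<longrightarrow> g f = f x"
proof -
  obtain B where B: "finite B" "B \<subseteq> E.G a" "E.G a \<subseteq> VS.span B" "VS.independent B"
    by (rule finite_basis_G)
  interpret g: linear_map_on fscale "(*)" dual_carrier g
    by (intro linear_map_on.intro linear_map_on_axioms.intro vector_space_fscale vector_space_mult dual_subspace g)
  define c where "c b = (\<lambda>w. if w \<in> C then VS.representation B (E.comp w a) b else 0)" for b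
  have c: "c b \<in> dual_carrier" for b
    unfolding c_def
    by (rule contra_component)
      (use B in \<open>simp add: linear_on_def VS.representation_add VS.representation_scale subset_iff\<close>)
  let ?x = "\<Sum>b\<in>B. s (g (c b)) b"
  have x: "?x \<in> E.G a"
    using B(2) by (intro VS.subspace_sum[OF E.G_subspace] VS.subspace_scale[OF E.G_subspace]) auto
  have "g f = f ?x" if f: "f \<in> dual_carrier" and f0: "\<And>b w. b \<noteq> a \<Longrightarrow> w \<in> E.G b \<Longrightarrow> f w = 0" for f
  proof -
    interpret f: linear_map_on s "(*)" C f by (rule dual_carrier_linear[OF f])
    interpret F: vector_space fscale by (rule vector_space_fscale)
    have BC: "b \<in> C" if "b \<in> B" for b using B(2) E.G_subset that by blast
    have sc: "fscale (f b) (c b) \<in> dual_carrier" for b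
      by (rule F.subspace_scale[OF dual_subspace c])
    have "f = (\<Sum>b\<in>B. fscale (f b) (c b))"
    proof (rule dual_eqI[OF f])
      show "(\<Sum>b\<in>B. fscale (f b) (c b)) \<in> dual_carrier"
        by (rule F.subspace_sum[OF dual_subspace]) (rule sc)
      fix d w assume w: "w \<in> E.G d"
      then have wC: "w \<in> C" using E.G_subset by blast
      have eq: "(\<Sum>b\<in>B. fscale (f b) (c b)) w = (\<Sum>b\<in>B. f b * VS.representation B (E.comp w a) b)"
        by (simp add: sum_fun_apply fscale_def c_def wC)
      show "f w = (\<Sum>b\<in>B. fscale (f b) (c b)) w"
      proof (cases "d = a")
        case True
        have "f w = f (\<Sum>b\<in>B. s (VS.representation B w b) b)"
          using VS.sum_representation_eq[OF B(4) _ B(1) subset_refl, of w] w B(3) True by auto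
        also have "\<dots> = (\<Sum>b\<in>B. VS.representation B w b * f b)"
          by (subst f.sum) (auto simp: f.scale BC C_simps)
        finally show ?thesis unfolding eq using w True by (simp add: E.comp_in_G mult.commute)
      next
        case False
        then show ?thesis
          unfolding eq using w f0 by (simp add: comp_other VS.representation_zero)
      qed
    qed
    then have "g f = g (\<Sum>b\<in>B. fscale (f b) (c b))" by simp
    also have "\<dots> = (\<Sum>b\<in>B. f b * g (c b))"
      by (subst g.sum) (auto simp: sc g.scale[OF c])
    also have "\<dots> = f ?x"
      by (subst f.sum) (auto simp: f.scale BC C_simps mult.commute)
    finally show ?thesis .
  qed
  then show ?thesis using x by (intro bexI[of _ ?x]) auto
qed

text \<open>Dually: the weight-raising modes of the contragredient have the dual of \<open>\<Omega>\<close> as cokernel.\<close>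

lemma dual_coinvariant_vanishes:
  assumes g: "linear_on fscale (*) dual_carrier g"
    and g0: "\<And>k v n f. f \<in> dual_carrier \<Longrightarrow> v \<in> wt_space V k \<Longrightarrow> int k - n - 1 > 0 \<Longrightarrow>
      g (mmode contragredient v n f) = 0"
    and f: "f \<in> dual_carrier" and f0: "\<And>w. w \<in> Omega V M \<Longrightarrow> f w = 0"
  shows "g f = 0"
proof -
  let ?p = "\<lambda>f a w. if w \<in> C then f (E.comp w a) else 0"
  have p: "?p h a \<in> dual_carrier" if "h \<in> dual_carrier" for h a
    by (rule contra_component[OF dual_linear_on_G[OF that]])
  have p0: "?p h a w = 0" if "b \<noteq> a" "w \<in> E.G b" "h \<in> dual_carrier" for h a b w
    using comp_other[OF that(2,1)] linear_map_on.zero[OF dual_carrier_linear[OF that(3)]] by simp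
  interpret g: linear_map_on fscale "(*)" dual_carrier g
    by (intro linear_map_on.intro linear_map_on_axioms.intro vector_space_fscale vector_space_mult dual_subspace g)
  have gp: "g (?p f a) = 0" for a
  proof -
    obtain x where x: "x \<in> E.G a"
      and gx: "\<And>h. h \<in> dual_carrier \<Longrightarrow> (\<And>b w. b \<noteq> a \<Longrightarrow> w \<in> E.G b \<Longrightarrow> h w = 0) \<Longrightarrow> g h = h x"
      using dual_functional_eval[OF g, of a] by blast
    have xC: "x \<in> C" using x E.G_subset by blast
    have "opp v n x = 0" if v: "v \<in> wt_space V k" and n: "int k - n - 1 > 0" for k v n
    proof (rule ccontr)
      assume nz: "opp v n x \<noteq> 0"
      \<comment> \<open>\<open>h\<close> is cut down to weight \<open>?c\<close>, so that its image
        under the mode is concentrated in weight \<open>a\<close>, where \<open>g\<close> is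
        evaluation at \<open>x\<close>.\<close>
      let ?c = "a - of_int (int k - n - 1)"
      from dual_separates[OF opp_closed[OF xC] nz] obtain h
        where h: "h \<in> dual_carrier" "h (opp v n x) \<noteq> 0" by blast
      have "g (mmode contragredient v n (?p h ?c)) = mmode contragredient v n (?p h ?c) x"
      proof (rule gx[OF contra_closed[OF p[OF h(1)]]])
        fix b w assume b: "b \<noteq> a" and w: "w \<in> E.G b"
        show "mmode contragredient v n (?p h ?c) w = 0"
        proof (rule contra_mode_vanishes[OF p[OF h(1)] _ v _ w])
          show "?p h ?c w = 0" if "d \<notin> {?c}" "w \<in> E.G d" for d w
            by (rule p0[OF _ that(2) h(1)]) (use that(1) in auto)
        qed (use b in simp)
      qed
      also have "\<dots> = h (opp v n x)"
        using xC opp_closed[OF xC] E.comp_in_G[OF opp_shift[OF x v, of n]] by (simp add: mode_contra)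
      finally show False using g0[OF p[OF h(1)] v n] h(2) by simp
    qed
    \<comment> \<open>The raising modes of the dual are transposes of opposite modes that now
      annihilate \<open>x\<close>; by triangularity all weight-lowering modes annihilate
      \<open>x\<close> too.\<close>
    then have "Y v n x \<in> {0}" if "v \<in> wt_space V k" "int k - n - 1 < 0" for v k n
      by (intro opp_triangular[where Q = "\<lambda>d. d > 0", OF _ xC _ that(1)]) (use that(2) in auto)
    then have "x \<in> Omega V M" using xC by (auto simp: Omega_def)
    moreover have "g (?p f a) = ?p f a x" by (rule gx[OF p[OF f]]) (rule p0[OF _ _ f])
    ultimately show ?thesis using f0 x by (simp add: E.comp_in_G)
  qed
  obtain A where A: "finite A" "\<And>a w. a \<notin> A \<Longrightarrow> w \<in> E.G a \<Longrightarrow> f w = 0"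
    using f by (auto simp: dual_carrier_def)
  have "f = (\<Sum>a\<in>A. ?p f a)" by (rule dual_sum_components[OF f A, symmetric])
  then have "g f = g (\<Sum>a\<in>A. ?p f a)" by simp
  also have "\<dots> = (\<Sum>a\<in>A. g (?p f a))" by (rule g.sum) (rule p[OF f])
  finally show ?thesis by (simp add: gp)
qed

section \<open>Submodules\<close>

text \<open>A submodule is stable under \<open>L(0)\<close>, hence contains the weight components of
  its elements; this gives the grading.\<close>

lemma submodule:
  assumes "vsubmodule s M U"
  shows "voa_gr_module V s (M\<lparr>mcarrier := U\<rparr>)"
proof -
  have U: "U \<subseteq> C" "VS.subspace U" "\<And>v n w. w \<in> U \<Longrightarrow> Y v n w \<in> U"
    using assms by (auto simp: vsubmodule_def)
  have W: "weak_module V s (M\<lparr>mcarrier := U\<rparr>)"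
  proof (rule weak_module.intro)
    show "linear_on s s (mcarrier (M\<lparr>mcarrier := U\<rparr>)) (mmode (M\<lparr>mcarrier := U\<rparr>) v n)" for v n
      using linear_right[of v n] subsetD[OF U(1)] by (auto simp: linear_on_def)
    show "jacobi_identity V s (mcarrier (M\<lparr>mcarrier := U\<rparr>)) (mmode (M\<lparr>mcarrier := U\<rparr>))"
      using jacobi U(1) by (auto simp: jacobi_identity_def)
  qed (use U vector_space linear_left truncation vacuum in auto)
  have G: "gen_eigenspace V s (M\<lparr>mcarrier := U\<rparr>) a = E.G a \<inter> U" for a
    using U(1) by (auto simp: gen_eigenspace_def E.G_def)
  have "gr_module V s (M\<lparr>mcarrier := U\<rparr>)"
  proof (intro gr_module.intro gr_module_axioms.intro W)
    show "VS.span (\<Union>a. gen_eigenspace V s (M\<lparr>mcarrier := U\<rparr>) a) = mcarrier (M\<lparr>mcarrier := U\<rparr>)"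
    proof
      show "VS.span (\<Union>a. gen_eigenspace V s (M\<lparr>mcarrier := U\<rparr>) a) \<subseteq> mcarrier (M\<lparr>mcarrier := U\<rparr>)"
        unfolding G using U(2) by (intro VS.span_minimal) auto
      show "mcarrier (M\<lparr>mcarrier := U\<rparr>) \<subseteq> VS.span (\<Union>a. gen_eigenspace V s (M\<lparr>mcarrier := U\<rparr>) a)"
      proof
        fix x assume "x \<in> mcarrier (M\<lparr>mcarrier := U\<rparr>)"
        then have x: "x \<in> U" by simp
        then have xC: "x \<in> C" using U(1) by blast
        have "E.comp x a \<in> E.G a \<inter> U" for a
          using E.comp_mem[OF U(2) U(3) spanned[OF xC] x] E.comp_in[OF spanned[OF xC]] by blast
        then have "(\<Sum>a | E.comp x a \<noteq> 0. E.comp x a) \<in> VS.span (\<Union>a. E.G a \<inter> U)"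
          by (intro VS.span_sum) (blast intro: VS.span_base)
        then show "x \<in> VS.span (\<Union>a. gen_eigenspace V s (M\<lparr>mcarrier := U\<rparr>) a)"
          unfolding G using E.Sum_any_comp[OF spanned[OF xC]] by (simp add: Sum_any.expand_set)
      qed
    qed
    show "finite_dim s (\<Union>\<mu>\<in>{\<mu>. Re \<mu> \<le> Re a}. gen_eigenspace V s (M\<lparr>mcarrier := U\<rparr>) \<mu>)" for a
    proof -
      have "(\<Union>\<mu>\<in>{\<mu>. Re \<mu> \<le> Re a}. gen_eigenspace V s (M\<lparr>mcarrier := U\<rparr>) \<mu>)
          \<subseteq> (\<Union>\<mu>\<in>{\<mu>. Re \<mu> \<le> Re a}. gen_eigenspace V s M \<mu>)"
        unfolding G gen_eigenspace_eq by blast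
      then show ?thesis using grading_restricted[of a] unfolding finite_dim_def by (meson subset_trans)
    qed
  qed
  then show ?thesis
    by (intro voa_gr_module.intro voa_module.intro alg.voa_axioms W)
qed

lemma generated_vsubmodule: "S \<subseteq> C \<Longrightarrow> vsubmodule s M (generated_submodule s M S)"
  unfolding generated_submodule_def vsubmodule_def
  by (auto simp: VS.subspace_def closed intro!: VS.subspace_Inter) (use subspace closed in \<open>auto simp: VS.subspace_def\<close>)

text \<open>Weight vectors span, so one of them lies outside the submodule generated by
  \<open>\<Omega>\<close>. The submodule that it generates has no new lowest vectors, so it stays
  outside there.\<close>

lemma cyclic_not_lowest_generated:
  assumes "\<not> lowest_generated V s M"
  obtains M1 :: "('v, 'm) vmodule" and w a where "voa_gr_module V s M1" "w \<in> gen_eigenspace V s M1 a"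
    "\<And>U. vsubmodule s M1 U \<Longrightarrow> w \<in> U \<Longrightarrow> U = mcarrier M1"
    "w \<notin> generated_submodule s M1 (Omega V M1)"
proof -
  let ?N = "generated_submodule s M (Omega V M)"
  have Omega_C: "Omega V M \<subseteq> C" by (auto simp: Omega_def)
  have N: "vsubmodule s M ?N" by (rule generated_vsubmodule[OF Omega_C])
  have "?N \<noteq> C" using assms by (simp add: lowest_generated_def)
  have "\<exists>a w. w \<in> E.G a \<and> w \<notin> ?N"
  proof (rule ccontr)
    assume "\<nexists>a w. w \<in> E.G a \<and> w \<notin> ?N"
    then have "VS.span (\<Union>a. E.G a) \<subseteq> ?N"
      using N by (intro VS.span_minimal) (auto simp: vsubmodule_def)
    then show False using \<open>?N \<noteq> C\<close> N span_G by (auto simp: vsubmodule_def)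
  qed
  then obtain a w where w: "w \<in> E.G a" "w \<notin> ?N" by blast
  have wC: "w \<in> C" using w(1) E.G_subset by blast
  let ?U = "generated_submodule s M {w}"
  let ?M1 = "M\<lparr>mcarrier := ?U\<rparr>"
  have U: "vsubmodule s M ?U" using generated_vsubmodule[of "{w}"] wC by simp
  have wU: "w \<in> ?U" by (simp add: generated_submodule_def)
  show thesis
  proof (rule that)
    show "voa_gr_module V s ?M1" by (rule submodule[OF U])
    show "w \<in> gen_eigenspace V s ?M1 a"
      using w(1) wU by (auto simp: gen_eigenspace_def E.G_def)
    show "U' = mcarrier ?M1" if U': "vsubmodule s ?M1 U'" "w \<in> U'" for U'
    proof -
      have "vsubmodule s M U'" "U' \<subseteq> ?U" using U' U by (auto simp: vsubmodule_def)
      then have "?U \<subseteq> U'" using U'(2) by (auto simp: generated_submodule_def)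
      then show ?thesis using \<open>U' \<subseteq> ?U\<close> by simp
    qed
    from w(2) obtain U' where U': "vsubmodule s M U'" "Omega V M \<subseteq> U'" "w \<notin> U'"
      by (auto simp: generated_submodule_def)
    have "vsubmodule s ?M1 (U' \<inter> ?U)"
      using U U'(1) by (auto simp: vsubmodule_def VS.subspace_inter)
    moreover have "Omega V ?M1 \<subseteq> U' \<inter> ?U"
      using U'(2) U by (auto simp: Omega_def vsubmodule_def)
    ultimately show "w \<notin> generated_submodule s ?M1 (Omega V ?M1)"
      using U'(3) by (auto simp: generated_submodule_def)
  qed
qed

end

section \<open>Transport of structure\<close>

lemma linear_map_onI:
  "vector_space s \<Longrightarrow> vector_space t \<Longrightarrow> module.subspace s W \<Longrightarrow> linear_on s t W f \<Longrightarrow> linear_map_on s t W f"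
  by (intro linear_map_on.intro linear_map_on_axioms.intro)

context linear_map_on
begin

text \<open>An injective map preserves the support of \<open>g\<close>. If that is infinite, both
  sides are the default value 0 of \<open>Sum_any\<close>, so Jacobi sums are transported without a
  check of finiteness.\<close>

lemma Sum_any_inj:
  assumes "inj_on f W" "\<And>i. g i \<in> W"
  shows "f (Sum_any g) = Sum_any (\<lambda>i. f (g i))"
proof (cases "finite {i. g i \<noteq> 0}")
  case True
  then show ?thesis by (rule Sum_any[OF assms(2)])
next
  case False
  have "f (g i) \<noteq> 0 \<longleftrightarrow> g i \<noteq> 0" for i
    using inj_onD[OF assms(1), of "g i" 0] assms(2) S.subspace_0[OF subspace_dom] by auto
  then show ?thesis using False by simp
qed

lemma span_image_on:
  assumes "A \<subseteq> W"
  shows "T.span (f ` A) = f ` S.span A"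
proof
  have AW: "S.span A \<subseteq> W" by (rule S.span_minimal[OF assms subspace_dom])
  interpret r: linear_map_on s t "S.span A" f
    by unfold_locales (use linear_on subsetD[OF AW] in \<open>auto simp: linear_on_def\<close>)
  show "T.span (f ` A) \<subseteq> f ` S.span A"
    by (rule T.span_minimal[OF _ r.subspace_image]) (auto intro: S.span_base)
  have "S.subspace {x \<in> W. f x \<in> T.span (f ` A)}"
    using subspace_dom by (auto simp: S.subspace_def add scale T.span_add T.span_scale T.span_zero)
  then have "S.span A \<subseteq> {x \<in> W. f x \<in> T.span (f ` A)}"
    by (intro S.span_minimal) (use assms T.span_base in auto)
  then show "f ` S.span A \<subseteq> T.span (f ` A)" by blast
qed

lemma finite_dim_image:
  assumes "A \<subseteq> W" "finite_dim s A"
  shows "finite_dim t (f ` A)"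
proof -
  obtain F where F: "finite F" "F \<subseteq> A" "A \<subseteq> S.span F"
    using finite_dimE[OF S.vector_space_axioms assms(2)] by blast
  then have "f ` A \<subseteq> T.span (f ` F)" using span_image_on[of F] assms(1) by blast
  then show ?thesis using F(1) unfolding finite_dim_def by blast
qed

end

text \<open>Transport of structure. A contragredient consists of functions on \<open>'m\<close>, and
  the locale moves it into the space \<open>nat \<Rightarrow> complex\<close> in which the theorem
  asks for modules.\<close>

locale module_iso = voa_gr_module V s M + linear_map_on s t "mcarrier M" h
  for V :: "'v::ab_group_add voa_data" and s :: "complex \<Rightarrow> 'm::ab_group_add \<Rightarrow> 'm"
    and M :: "('v, 'm) vmodule" and t :: "complex \<Rightarrow> 'n::ab_group_add \<Rightarrow> 'n" and h :: "'m \<Rightarrow> 'n" +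
  assumes inj: "inj_on h (mcarrier M)"
begin

definition N :: "('v, 'n) vmodule"
  where "N = \<lparr>mcarrier = h ` C, mmode = \<lambda>v n x. h (Y v n (inv_into C h x))\<rparr>"

lemma carrier_N: "mcarrier N = h ` C"
  by (simp add: N_def)

lemma mode_N: "w \<in> C \<Longrightarrow> mmode N v n (h w) = h (Y v n w)"
  by (simp add: N_def inv_into_f_f[OF inj])

lemma weak_module_N: "weak_module V t N"
proof (rule weak_module.intro)
  show "vector_space t" by (rule T.vector_space_axioms)
  show "T.subspace (mcarrier N)" unfolding carrier_N by (rule subspace_image)
  show "linear_on t t (mcarrier N) (mmode N v n)" for v n
    unfolding linear_on_def carrier_N
  proof (intro conjI ballI allI)
    fix x y assume "x \<in> h ` C" "y \<in> h ` C"
    then obtain a b where ab: "x = h a" "y = h b" "a \<in> C" "b \<in> C" by blast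
    then have "mmode N v n (h (a + b)) = h (Y v n (a + b))" by (intro mode_N C_simps)
    then show "mmode N v n (x + y) = mmode N v n x + mmode N v n y"
      using ab by (simp add: mode_N mode_add add closed)
  next
    fix c x assume "x \<in> h ` C"
    then obtain a where a: "x = h a" "a \<in> C" by blast
    then have "mmode N v n (h (s c a)) = h (Y v n (s c a))" by (intro mode_N C_simps)
    then show "mmode N v n (t c x) = t c (mmode N v n x)"
      using a by (simp add: mode_N mode_scale scale closed)
  qed
  show "jacobi_identity V t (mcarrier N) (mmode N)"
    unfolding jacobi_identity_def carrier_N
  proof (intro allI ballI)
    fix u v l m n x assume "x \<in> h ` C"
    then obtain w where w: "w \<in> C" "x = h w" by blast
    let ?L = "\<lambda>j::nat. s (of_int m gchoose j) (Y (vmode V u (l + int j) v) (m + n - int j) w)"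
    let ?R = "\<lambda>j::nat. s ((-1) ^ j * (of_int l gchoose j)) (Y u (m + l - int j) (Y v (n + int j) w)
         - s ((-1) powi l) (Y v (n + l - int j) (Y u (m + int j) w)))"
    have "Sum_any (\<lambda>j. h (?L j)) = h (Sum_any ?L)"
      by (rule Sum_any_inj[symmetric, OF inj]) (simp add: C_simps closed w)
    also have "Sum_any ?L = Sum_any ?R" using jacobi w(1) unfolding jacobi_identity_def by blast
    also have "h (Sum_any ?R) = Sum_any (\<lambda>j. h (?R j))"
      by (rule Sum_any_inj[OF inj]) (simp add: C_simps closed w)
    finally show "Sum_any (\<lambda>j::nat. t (of_int m gchoose j) (mmode N (vmode V u (l + int j) v) (m + n - int j) x)) =
        Sum_any (\<lambda>j::nat. t ((-1) ^ j * (of_int l gchoose j)) (mmode N u (m + l - int j) (mmode N v (n + int j) x)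
         - t ((-1) powi l) (mmode N v (n + l - int j) (mmode N u (m + int j) x))))"
      unfolding w(2) by (simp add: mode_N w(1) closed scale diff C_simps)
  qed
next
  fix x assume "x \<in> mcarrier N"
  then obtain w where w: "w \<in> C" "x = h w" by (auto simp: carrier_N)
  show "mmode N v n x \<in> mcarrier N" for v n
    unfolding w(2) mode_N[OF w(1)] carrier_N using closed[OF w(1)] by blast
  show "Vector_Spaces.linear (vscale V) t (\<lambda>v. mmode N v n x)" for n
    unfolding linear_UNIV_iff w(2) mode_N[OF w(1)]
    by (simp add: linear_on_def alg.vector_space T.vector_space_axioms mode_add_left mode_scale_left w(1)
        add scale closed)
  show "\<exists>N'. \<forall>n\<ge>N'. mmode N v n x = 0" for v
    using truncation[OF w(1), of v] by (auto simp: w(2) mode_N[OF w(1)]) (metis zero)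
  show "mmode N (vac V) n x = (if n = -1 then x else 0)" for n
    by (simp add: w mode_N vacuum)
qed

lemma gen_eigenspace_N: "gen_eigenspace V t N a = h ` E.G a"
proof -
  have *: "((\<lambda>x. mmode N (conf V) 1 x - t a x) ^^ k) (h w) = h ((E.D a ^^ k) w)" if "w \<in> C" for k w
  proof (induction k)
    case (Suc k)
    have "(E.D a ^^ k) w \<in> C" by (rule E.D_pow_closed[OF that])
    then show ?case
      unfolding funpow.simps o_apply Suc by (simp add: mode_N diff scale closed C_simps)
  qed simp
  have "h x = 0 \<longleftrightarrow> x = 0" if "x \<in> C" for x
    using inj_onD[OF inj, of x 0] that C_simps(4) by auto
  then show ?thesis
    using E.D_pow_closed by (auto simp: gen_eigenspace_def E.G_def carrier_N *) blast
qed

lemma voa_gr_module_N: "voa_gr_module V t N"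
proof (intro voa_gr_module.intro voa_module.intro gr_module.intro gr_module_axioms.intro
    alg.voa_axioms weak_module_N)
  show "T.span (\<Union>a. gen_eigenspace V t N a) = mcarrier N"
  proof -
    have "(\<Union>a. gen_eigenspace V t N a) = h ` (\<Union>a. E.G a)" by (auto simp: gen_eigenspace_N)
    moreover have "(\<Union>a. E.G a) \<subseteq> C" using E.G_subset by blast
    ultimately show ?thesis using span_image_on span_G carrier_N by simp
  qed
  show "finite_dim t (\<Union>\<mu>\<in>{\<mu>. Re \<mu> \<le> Re a}. gen_eigenspace V t N \<mu>)" for a
  proof -
    have "(\<Union>\<mu>\<in>{\<mu>. Re \<mu> \<le> Re a}. gen_eigenspace V t N \<mu>) = h ` (\<Union>\<mu>\<in>{\<mu>. Re \<mu> \<le> Re a}. E.G \<mu>)"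
      by (auto simp: gen_eigenspace_N)
    moreover have "(\<Union>\<mu>\<in>{\<mu>. Re \<mu> \<le> Re a}. E.G \<mu>) \<subseteq> C" using E.G_subset by blast
    ultimately show ?thesis using finite_dim_image grading_restricted[of a] gen_eigenspace_eq by simp
  qed
qed

lemma opp_N:
  assumes w: "w \<in> C"
  shows "opp_mode V t (mmode N) v n (h w) = h (opp v n w)"
proof -
  interpret N: voa_gr_module V t N by (rule voa_gr_module_N)
  have hw: "h w \<in> N.C" using w by (simp add: carrier_N)
  have "N.hopp k x n (h w) = h (hopp k x n w)" for k x
  proof -
    have "(\<Sum>i\<le>k. N.Y (alg.dL i x) (2 * int k - int i - n - 2) (h w)) =
        h (\<Sum>i\<le>k. Y (alg.dL i x) (2 * int k - int i - n - 2) w)"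
      by (subst sum) (simp_all add: closed w mode_N)
    then show ?thesis
      unfolding N.hopp_def hopp_def by (simp add: scale C_simps closed w)
  qed
  then show ?thesis
    unfolding opp_eq_sum[OF w alg.finite_hcomp subset_refl] N.opp_eq_sum[OF hw alg.finite_hcomp subset_refl]
    by (subst sum) (simp_all add: hopp_closed w)
qed

end

context voa_gr_module
begin

text \<open>Grading restriction makes the dimension countable.\<close>

lemma embedding_exists:
  obtains h :: "'m \<Rightarrow> nat \<Rightarrow> complex" where "linear_on s fscale C h" "inj_on h C"
proof -
  have "\<forall>n::nat. \<exists>F. finite F \<and> (\<Union>b\<in>{b. Re b \<le> real n}. E.G b) \<subseteq> VS.span F"
    using finite_dim_le by metis
  then obtain F where F: "\<And>n::nat. finite (F n)" "\<And>n::nat. (\<Union>b\<in>{b. Re b \<le> real n}. E.G b) \<subseteq> VS.span (F n)"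
    by metis
  obtain B where B: "B \<subseteq> (\<Union>n. F n)" "VS.independent B" "(\<Union>n. F n) \<subseteq> VS.span B"
    using VS.maximal_independent_subset by blast
  have "E.G a \<subseteq> VS.span B" for a
  proof -
    obtain n :: nat where "Re a \<le> real n" using real_arch_simple by blast
    then have "E.G a \<subseteq> VS.span (F n)" using F(2)[of n] by blast
    also have "\<dots> \<subseteq> VS.span (VS.span B)" by (rule VS.span_mono) (use B(3) in blast)
    finally show ?thesis by (simp only: VS.span_span)
  qed
  then have "VS.span (\<Union>a. E.G a) \<subseteq> VS.span B" by (intro VS.span_minimal) auto
  then have span: "w \<in> VS.span B" if "w \<in> C" for w using span_G that by auto
  have "countable (\<Union>n. F n)" using F(1) by (intro countable_UN) (auto intro: countable_finite)
  then have "countable B" using B(1) countable_subset by blast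
  then obtain e :: "'m \<Rightarrow> nat" where e: "inj_on e B" by (auto simp: countable_def)
  \<comment> \<open>Coordinate \<open>i\<close> belongs to the basis vector numbered
    \<open>i\<close>. Indices that number no basis vector give redundant coordinates, still linear
    in \<open>w\<close>.\<close>
  let ?h = "\<lambda>w i. VS.representation B w (inv_into B e i)"
  show thesis
  proof (rule that)
    show "linear_on s fscale C ?h"
      by (auto simp: linear_on_def fscale_def VS.representation_add[OF B(2)] VS.representation_scale[OF B(2)] span)
    show "inj_on ?h C"
    proof (rule inj_onI)
      fix x y assume x: "x \<in> C" and y: "y \<in> C" and eq: "?h x = ?h y"
      have "VS.representation B x b = VS.representation B y b" for b
      proof (cases "b \<in> B")
        case True
        then show ?thesis using fun_cong[OF eq, of "e b"] by (simp add: inv_into_f_f[OF e])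
      next
        case False
        then have "VS.representation B z b = 0" for z using VS.representation_ne_zero[of B z b] by blast
        then show ?thesis by simp
      qed
      then have rep: "VS.representation B x = VS.representation B y" by (rule ext)
      have "x = (\<Sum>b | VS.representation B x b \<noteq> 0. s (VS.representation B x b) b)"
        by (rule VS.sum_nonzero_representation_eq[OF B(2) span[OF x], symmetric])
      also have "\<dots> = y"
        unfolding rep by (rule VS.sum_nonzero_representation_eq[OF B(2) span[OF y]])
      finally show "x = y" .
    qed
  qed
qed

lemma transport_exists:
  obtains h :: "'m \<Rightarrow> nat \<Rightarrow> complex" where "module_iso V s M fscale h"
proof -
  obtain h :: "'m \<Rightarrow> nat \<Rightarrow> complex" where h: "linear_on s fscale C h" "inj_on h C"
    by (rule embedding_exists)
  show thesis
    by (rule that[of h])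
      (intro module_iso.intro module_iso_axioms.intro linear_map_onI voa_gr_module_axioms h subspace vector_space vector_space_fscale)
qed

section \<open>Restriction of the contragredient to a submodule\<close>

lemma contra_voa_gr_module: "voa_gr_module V fscale contragredient"
  by (intro voa_gr_module.intro voa_module.intro alg.voa_axioms contra_weak_module contra_gr_module)

lemma dual_extends:
  assumes "VS.subspace W" "linear_on s (*) W f"
  obtains g where "linear_on s (*) UNIV g" "\<And>x. x \<in> W \<Longrightarrow> g x = (f x :: complex)"
proof -
  interpret P: vector_space_pair s "(*) :: complex \<Rightarrow> complex \<Rightarrow> complex"
    by (intro vector_space_pair.intro vector_space vector_space_mult)
  obtain B where B: "B \<subseteq> W" "VS.independent B" "W \<subseteq> VS.span B"
    using VS.maximal_independent_subset by blast
  from P.linear_independent_extend[OF B(2), of f] obtain g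
    where g: "Vector_Spaces.linear s (*) g" "\<And>x. x \<in> B \<Longrightarrow> g x = f x" by auto
  have gl: "linear_on s (*) UNIV g" using g(1) by (simp add: linear_UNIV_iff)
  have "linear_map_on s (*) W (\<lambda>x. g x - f x)"
    by (rule linear_map_onI[OF vector_space vector_space_mult assms(1)])
      (use gl assms(2) in \<open>auto simp: linear_on_def algebra_simps\<close>)
  from linear_map_on.zero_on_span[OF this B(1)] have "g x = f x" if "x \<in> W" for x
    using g(2) B(3) that by (auto simp: subset_iff)
  then show thesis using that gl by blast
qed

text \<open>A functional with value 1 at \<open>w\<close> and 0 on \<open>N\<close> is cut down to
  weight \<open>a\<close> to lie in the graded dual. It still vanishes on \<open>N\<close>, because
  \<open>N\<close> contains the weight components of its elements.\<close>

lemma vsubmodule_separated: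
  assumes N: "vsubmodule s M N" and w: "w \<in> E.G a" "w \<notin> N"
  obtains f where "f \<in> dual_carrier" "\<And>x. x \<in> N \<Longrightarrow> f x = 0" "f w \<noteq> 0"
proof -
  interpret P: vector_space_pair s "(*) :: complex \<Rightarrow> complex \<Rightarrow> complex"
    by (intro vector_space_pair.intro vector_space vector_space_mult)
  have NC: "N \<subseteq> C" "VS.subspace N" "\<And>v n x. x \<in> N \<Longrightarrow> Y v n x \<in> N"
    using N by (auto simp: vsubmodule_def)
  obtain B where B: "B \<subseteq> N" "VS.independent B" "N \<subseteq> VS.span B"
    using VS.maximal_independent_subset by blast
  have spanB: "VS.span B \<subseteq> N" by (rule VS.span_minimal[OF B(1) NC(2)])
  then have "VS.independent (insert w B)" using w(2) B(2) by (intro VS.independent_insertI) auto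
  from P.linear_independent_extend[OF this, of "\<lambda>x. if x = w then 1 else 0"] obtain g
    where g: "Vector_Spaces.linear s (*) g" "\<forall>x\<in>insert w B. g x = (if x = w then 1 else 0 :: complex)"
    by blast
  have gl: "linear_on s (*) UNIV g" using g(1) by (simp add: linear_UNIV_iff)
  have "linear_map_on s (*) UNIV g"
    by (rule linear_map_onI[OF vector_space vector_space_mult VS.subspace_UNIV gl])
  then have gN: "g x = 0" if "x \<in> N" for x
    by (rule linear_map_on.zero_on_span[of s "(*)" UNIV g B]) (use g(2) B w(2) that in auto)
  have "linear_on s (*) (E.G a) g" using gl by (simp add: linear_on_def)
  from contra_component[OF this] show thesis
  proof (rule that)
    show "(if x \<in> C then g (E.comp x a) else 0) = 0" if "x \<in> N" for x
      using gN E.comp_mem[OF NC(2) NC(3) spanned that] that NC(1) by auto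
    show "(if w \<in> C then g (E.comp w a) else 0) \<noteq> 0"
      using w(1) g(2) subsetD[OF E.G_subset w(1)] by (simp add: E.comp_in_G)
  qed
qed

text \<open>The zero outside \<open>N\<close> matches the convention in
  \<open>dual_carrier\<close>.\<close>

definition restrict :: "'m set \<Rightarrow> ('m \<Rightarrow> complex) \<Rightarrow> 'm \<Rightarrow> complex"
  where "restrict N f = (\<lambda>w. if w \<in> N then f w else 0)"

context
  fixes N :: "'m set"
  assumes N: "vsubmodule s M N"
begin

interpretation N: voa_gr_module V s "M\<lparr>mcarrier := N\<rparr>"
  rewrites "mcarrier (M\<lparr>mcarrier := N\<rparr>) = N" and "mmode (M\<lparr>mcarrier := N\<rparr>) = mmode M"
  by (rule submodule[OF N]) simp_all

lemma G_submodule: "N.E.G a = E.G a \<inter> N"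
  using N by (auto simp: N.E.G_def E.G_def vsubmodule_def)

lemma restrict_in_dual:
  assumes f: "f \<in> dual_carrier"
  shows "restrict N f \<in> N.dual_carrier"
proof -
  obtain A where A: "finite A" "\<And>a w. a \<notin> A \<Longrightarrow> w \<in> E.G a \<Longrightarrow> f w = 0"
    using f by (auto simp: dual_carrier_def)
  have NC: "x \<in> C" if "x \<in> N" for x using N that by (auto simp: vsubmodule_def)
  have lin: "linear_on s (*) N (restrict N f)"
    using linear_map_on.linear_on[OF dual_carrier_linear[OF f]] NC
    by (auto simp: linear_on_def restrict_def N.C_simps)
  have van: "\<forall>a. a \<notin> A \<longrightarrow> (\<forall>w\<in>N.E.G a. restrict N f w = 0)"
    using A(2) by (auto simp: G_submodule restrict_def)
  show ?thesis
    unfolding N.dual_carrier_def by (intro CollectI conjI exI[of _ A] lin van A(1)) (simp add: restrict_def)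
qed

lemma restrict_mode:
  assumes f: "f \<in> dual_carrier"
  shows "restrict N (mmode contragredient v n f) = mmode N.contragredient v n (restrict N f)"
proof
  fix w
  show "restrict N (mmode contragredient v n f) w = mmode N.contragredient v n (restrict N f) w"
    using N.opp_closed[of w v n] N by (auto simp: restrict_def mode_contra N.mode_contra vsubmodule_def)
qed

text \<open>Any linear extension to the ambient space is cut down to the finitely many weights of
  \<open>f\<close>. This changes nothing on \<open>N\<close>, whose grading is induced from
  \<open>M\<close>.\<close>

lemma restrict_surj: "restrict N ` dual_carrier = N.dual_carrier"
proof
  show "restrict N ` dual_carrier \<subseteq> N.dual_carrier" using restrict_in_dual by blast
  show "N.dual_carrier \<subseteq> restrict N ` dual_carrier"
  proof
    fix f assume f: "f \<in> N.dual_carrier"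
    interpret F: vector_space fscale by (rule vector_space_fscale)
    obtain A where A: "finite A" "\<And>a w. a \<notin> A \<Longrightarrow> w \<in> N.E.G a \<Longrightarrow> f w = 0"
      using f by (auto simp: N.dual_carrier_def)
    obtain g where g: "linear_on s (*) UNIV g" "\<And>x. x \<in> N \<Longrightarrow> g x = f x"
      by (rule dual_extends[OF N.subspace]) (use f in \<open>auto simp: N.dual_carrier_def\<close>)
    have g0: "g 0 = 0" using g(1) unfolding linear_on_def by (metis UNIV_I VS.scale_zero_left mult_zero_left)
    let ?g = "\<Sum>a\<in>A. (\<lambda>w. if w \<in> C then g (E.comp w a) else 0)"
    have "?g \<in> dual_carrier"
      by (rule F.subspace_sum[OF dual_subspace]) (rule contra_component, use g(1) in \<open>simp add: linear_on_def\<close>)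
    moreover have "restrict N ?g = f"
    proof (rule N.dual_eqI[OF restrict_in_dual[OF calculation] f])
      fix b w assume w: "w \<in> N.E.G b"
      then have wG: "w \<in> E.G b" "w \<in> N" by (auto simp: G_submodule)
      then have "w \<in> C" using E.G_subset by blast
      then have "restrict N ?g w = (\<Sum>a\<in>A. if a = b then g w else 0)"
        unfolding restrict_def sum_fun_apply using wG
        by (auto intro!: sum.cong simp: E.comp_in_G[OF wG(1)] g0)
      then show "restrict N ?g w = f w" using A w g(2)[OF wG(2)] by auto
    qed
    ultimately show "f \<in> restrict N ` dual_carrier" by blast
  qed
qed

end

section \<open>Invariant pairings with a cyclic module\<close>

text \<open>Invariance under \<open>L(0)\<close> makes different weights orthogonal, so
  \<open>b f w\<close> vanishes for all \<open>f\<close> once it does for \<open>f\<close> of weight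
  \<open>a\<close>. The vectors orthogonal to every \<open>f\<close> form a submodule by invariance,
  and it contains the generator \<open>w\<close>.\<close>

lemma invariant_pairing_vanishes:
  fixes b :: "('m \<Rightarrow> complex) \<Rightarrow> 'm \<Rightarrow> complex"
  assumes left: "\<And>y. y \<in> C \<Longrightarrow> linear_on fscale (*) dual_carrier (\<lambda>f. b f y)"
    and right: "\<And>f. f \<in> dual_carrier \<Longrightarrow> linear_on s (*) C (b f)"
    and invariant: "\<And>f y v n. f \<in> dual_carrier \<Longrightarrow> y \<in> C \<Longrightarrow> b (mmode contragredient v n f) y = b f (opp v n y)"
    and w: "w \<in> E.G a" and cyclic: "\<And>U. vsubmodule s M U \<Longrightarrow> w \<in> U \<Longrightarrow> U = C"
    and zero: "\<And>f. f \<in> gen_eigenspace V fscale contragredient a \<Longrightarrow> b f w = 0"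
    and f: "f \<in> dual_carrier" and y: "y \<in> C"
  shows "b f y = 0"
proof -
  interpret D: voa_gr_module V fscale contragredient
    rewrites "mcarrier contragredient = dual_carrier"
    by (rule contra_voa_gr_module) (rule carrier_contra)
  have wC: "w \<in> C" using w E.G_subset by blast
  interpret l: linear_map_on fscale "(*)" dual_carrier "\<lambda>f. b f w"
    by (rule linear_map_onI[OF vector_space_fscale vector_space_mult dual_subspace left[OF wC]])
  have bL: "b (D.E.D c g) x = b g (E.D c x)" if "g \<in> dual_carrier" "x \<in> C" for g x c
  proof -
    interpret l: linear_map_on fscale "(*)" dual_carrier "\<lambda>f. b f x"
      by (rule linear_map_onI[OF vector_space_fscale vector_space_mult dual_subspace left[OF that(2)]])
    interpret r: linear_map_on s "(*)" C "b g"
      by (rule linear_map_onI[OF vector_space vector_space_mult subspace right[OF that(1)]])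
    show ?thesis
      using invariant[OF that, of "conf V" 1] that
      by (simp only: l.diff l.scale r.diff r.scale D.closed D.C_simps closed C_simps opp_conf)
  qed
  have bLk: "b ((D.E.D c ^^ k) g) x = b g ((E.D c ^^ k) x)" if "g \<in> dual_carrier" "x \<in> C" for g x c k
    using that(2)
  proof (induction k arbitrary: x)
    case (Suc k)
    have "b ((D.E.D c ^^ Suc k) g) x = b ((D.E.D c ^^ k) g) (E.D c x)"
      using bL[OF D.E.D_pow_closed[OF that(1)] Suc.prems] by (simp only: funpow.simps o_apply)
    also have "\<dots> = b g ((E.D c ^^ k) (E.D c x))"
      by (rule Suc.IH[OF E.D_closed[OF Suc.prems]])
    finally show ?case by (simp only: funpow_Suc_right o_apply)
  qed simp
  have bG: "b g w = 0" if g: "g \<in> D.E.G c" for g c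
  proof (cases "c = a")
    case True
    then show ?thesis using zero g D.gen_eigenspace_eq by simp
  next
    case False
    \<comment> \<open>\<open>g\<close> is \<open>(L(0) - a)^k\<close> applied to some functional;
      moved across the pairing, this power kills \<open>w\<close>.\<close>
    from w obtain k where k: "(E.D a ^^ k) w = 0" by (auto simp: E.G_def)
    have "g \<in> (D.E.D a ^^ k) ` dual_carrier" using D.E.G_subset_D_pow_image[of a c k] False g by blast
    then obtain z where "z \<in> dual_carrier" "g = (D.E.D a ^^ k) z" by blast
    then show ?thesis
      using bLk[OF _ wC] k linear_map_on.zero[OF linear_map_onI[OF vector_space vector_space_mult subspace right]]
      by simp
  qed
  have bw: "b g w = 0" if "g \<in> dual_carrier" for g
  proof (rule l.zero_on_span[of "\<Union>c. D.E.G c"])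
    show "(\<Union>c. D.E.G c) \<subseteq> dual_carrier" by (intro UN_least D.E.G_subset)
    show "g \<in> D.VS.span (\<Union>c. D.E.G c)" by (rule D.spanned[OF that])
  qed (use bG in blast)
  let ?U = "{y \<in> C. \<forall>g\<in>dual_carrier. b g y = 0}"
  have r: "linear_map_on s (*) C (b g)" if "g \<in> dual_carrier" for g
    by (rule linear_map_onI[OF vector_space vector_space_mult subspace right[OF that]])
  have U: "VS.subspace ?U"
    by (rule VS.subspaceI)
      (auto simp: C_simps linear_map_on.zero[OF r] linear_map_on.add[OF r] linear_map_on.scale[OF r])
  have "opp v n x \<in> ?U" if "x \<in> ?U" for v n x
    using that by (auto simp: opp_closed contra_closed simp flip: invariant)
  then have "Y v n x \<in> ?U" if "x \<in> ?U" for v n x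
    by (intro mode_mem_if_opp_mem[OF U]) (use that in auto)
  then have "vsubmodule s M ?U" using U unfolding vsubmodule_def by blast
  moreover have "w \<in> ?U" using wC bw by blast
  ultimately have U_eq: "?U = C" by (rule cyclic)
  have "y \<in> ?U" unfolding U_eq by (rule y)
  then show ?thesis using f by blast
qed

end

section \<open>Tensor products\<close>

interpretation fs: vector_space fscale
  by (rule vector_space_fscale)

context linear_map_on
begin

lemma sum_list_closed: "(\<And>x. x \<in> set xs \<Longrightarrow> g x \<in> W) \<Longrightarrow> sum_list (map g xs) \<in> W"
  by (induction xs) (auto simp: S.subspace_0[OF subspace_dom] S.subspace_add[OF subspace_dom])

lemma sum_list: "(\<And>x. x \<in> set xs \<Longrightarrow> g x \<in> W) \<Longrightarrow> f (sum_list (map g xs)) = sum_list (map (\<lambda>x. f (g x)) xs)"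
  by (induction xs) (auto simp: add sum_list_closed)

end

lemma sum_list_fun_apply: "sum_list (map g xs) i = sum_list (map (\<lambda>x. g x i) xs)"
  by (induction xs) auto

text \<open>Lists of pure tensors give access to elements of the tensor product by induction;
  scalars are absorbed into the first factor.\<close>

definition tensors :: "(('i \<Rightarrow> complex) \<times> ('j \<Rightarrow> complex)) list \<Rightarrow> 'i \<times> 'j \<Rightarrow> complex"
  where "tensors xs = sum_list (map (\<lambda>(x, y). tensor x y) xs)"

lemma tensors_simps [simp]: "tensors [] = 0" "tensors ((x, y) # xs) = tensor x y + tensors xs"
  "tensors (xs @ ys) = tensors xs + tensors ys"
  by (simp_all add: tensors_def)

lemma tensor_fscale: "tensor (fscale c x) y = fscale c (tensor x y)" "tensor x (fscale c y) = fscale c (tensor x y)"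
  by (auto simp: tensor_def fscale_def)

lemma tensor_zero [simp]: "tensor x 0 = 0" "tensor 0 y = 0"
  by (auto simp: tensor_def)

lemma tensor_add: "tensor x (y + z) = tensor x y + tensor x z"
  by (auto simp: tensor_def algebra_simps)

lemma fscale_add: "fscale c (f + g) = fscale c f + fscale c g"
  by (auto simp: fscale_def algebra_simps)

lemma tensor_sum: "tensor x (sum g A) = (\<Sum>i\<in>A. tensor x (g i))"
  by (induction A rule: infinite_finite_induct) (simp_all add: tensor_add del: plus_fun_apply zero_fun_apply)

lemma fscale_tensors: "fscale c (tensors xs) = tensors (map (\<lambda>(x, y). (fscale c x, y)) xs)"
proof (induction xs)
  case Nil
  show ?case by (auto simp: fscale_def)
qed (auto simp: fscale_add tensor_fscale)

context
  fixes X :: "('i \<Rightarrow> complex) set" and Y :: "('j \<Rightarrow> complex) set"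
  assumes X: "module.subspace fscale X" and Y: "module.subspace fscale Y"
begin

lemma tensors_in: "set xs \<subseteq> X \<times> Y \<Longrightarrow> tensors xs \<in> tensor_space X Y"
proof (induction xs)
  case Nil
  show ?case unfolding tensor_space_def tensors_simps by (rule fs.span_zero)
next
  case (Cons a xs)
  obtain x y where a: "a = (x, y)" "x \<in> X" "y \<in> Y" using Cons.prems by (cases a) auto
  have "tensor x y \<in> tensor_space X Y" unfolding tensor_space_def by (rule fs.span_base) (use a in blast)
  moreover have "tensors xs \<in> tensor_space X Y" using Cons by simp
  ultimately show ?case unfolding a(1) tensors_simps tensor_space_def by (rule fs.span_add)
qed

lemma tensor_in: "x \<in> X \<Longrightarrow> y \<in> Y \<Longrightarrow> tensor x y \<in> tensor_space X Y"
  using tensors_in[of "[(x, y)]"] by simp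

lemma tensor_space_subspace: "module.subspace fscale (tensor_space X Y)"
  unfolding tensor_space_def by (rule fs.subspace_span)

lemma tensor_spaceE:
  assumes "w \<in> tensor_space X Y"
  obtains xs where "set xs \<subseteq> X \<times> Y" "w = tensors xs"
proof -
  have "\<exists>xs. set xs \<subseteq> X \<times> Y \<and> w = tensors xs"
    using assms unfolding tensor_space_def
  proof (induction w rule: fs.span_induct_alt)
    case base
    show ?case by (rule exI[of _ "[]"]) simp
  next
    case (step c z w)
    then obtain xs x y where "set xs \<subseteq> X \<times> Y" "w = tensors xs" "z = tensor x y" "x \<in> X" "y \<in> Y"
      by blast
    then show ?case
      using fs.subspace_scale[OF X] by (intro exI[of _ "(fscale c x, y) # xs"]) (auto simp: tensor_fscale)
  qed
  then show thesis using that by blast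
qed

lemma dual_space_linear: "\<psi> \<in> dual_space (tensor_space X Y) \<Longrightarrow> linear_map_on fscale (*) (tensor_space X Y) \<psi>"
  by (rule linear_map_onI[OF vector_space_fscale vector_space_mult tensor_space_subspace])
    (simp add: dual_space_def)

lemma dual_tensors:
  assumes "\<psi> \<in> dual_space (tensor_space X Y)" "set xs \<subseteq> X \<times> Y"
  shows "\<psi> (tensors xs) = sum_list (map (\<lambda>(x, y). \<psi> (tensor x y)) xs)"
proof -
  interpret l: linear_map_on fscale "(*)" "tensor_space X Y" \<psi> by (rule dual_space_linear[OF assms(1)])
  have "\<psi> (tensors xs) = sum_list (map (\<lambda>z. \<psi> (case z of (x, y) \<Rightarrow> tensor x y)) xs)"
    unfolding tensors_def by (rule l.sum_list) (use assms(2) tensor_in in auto)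
  then show ?thesis by (simp add: split_def)
qed

lemma dual_space_eqI:
  assumes "\<psi> \<in> dual_space (tensor_space X Y)" "\<phi> \<in> dual_space (tensor_space X Y)"
    and "\<And>x y. x \<in> X \<Longrightarrow> y \<in> Y \<Longrightarrow> \<psi> (tensor x y) = \<phi> (tensor x y)"
  shows "\<psi> = \<phi>"
proof
  fix w
  show "\<psi> w = \<phi> w"
  proof (cases "w \<in> tensor_space X Y")
    case True
    then obtain xs where xs: "set xs \<subseteq> X \<times> Y" "w = tensors xs" using tensor_spaceE by blast
    then show ?thesis
      unfolding xs(2) dual_tensors[OF assms(1) xs(1)] dual_tensors[OF assms(2) xs(1)]
      by (intro arg_cong[where f = sum_list] map_cong) (use assms(3) in auto)
  next
    case False
    then show ?thesis using assms(1,2) by (simp add: dual_space_def)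
  qed
qed

text \<open>\<open>\<phi>\<close> is given as a function of \<open>w\<close>, so its value cannot
  depend on how \<open>w\<close> is written as a sum of pure tensors. This settles well-definedness,
  and linearity is read off from lists.\<close>

lemma tensor_functional:
  assumes \<phi>: "\<And>xs. set xs \<subseteq> X \<times> Y \<Longrightarrow> \<phi> (tensors xs) = sum_list (map (\<lambda>(x, y). \<beta> x y) xs)"
    and \<beta>: "\<And>c x y. x \<in> X \<Longrightarrow> y \<in> Y \<Longrightarrow> \<beta> (fscale c x) y = c * \<beta> x y"
  shows "(\<lambda>w. if w \<in> tensor_space X Y then \<phi> w else 0) \<in> dual_space (tensor_space X Y)"
    and "x \<in> X \<Longrightarrow> y \<in> Y \<Longrightarrow> \<phi> (tensor x y) = \<beta> x y"
proof -
  have add: "\<phi> (w + z) = \<phi> w + \<phi> z" if w: "w \<in> tensor_space X Y" and z: "z \<in> tensor_space X Y" for w z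
  proof -
    obtain xs where xs: "set xs \<subseteq> X \<times> Y" "w = tensors xs" using tensor_spaceE[OF w] by blast
    obtain ys where ys: "set ys \<subseteq> X \<times> Y" "z = tensors ys" using tensor_spaceE[OF z] by blast
    show ?thesis using \<phi>[of "xs @ ys"] \<phi>[OF xs(1)] \<phi>[OF ys(1)] xs ys by simp
  qed
  have scale: "\<phi> (fscale c w) = c * \<phi> w" if w: "w \<in> tensor_space X Y" for c w
  proof -
    obtain xs where xs: "set xs \<subseteq> X \<times> Y" "w = tensors xs" using tensor_spaceE[OF w] by blast
    have "set (map (\<lambda>(x, y). (fscale c x, y)) xs) \<subseteq> X \<times> Y"
      using xs(1) fs.subspace_scale[OF X] by auto
    from \<phi>[OF this] have "\<phi> (fscale c w) = sum_list (map (\<lambda>(x, y). \<beta> (fscale c x) y) xs)"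
      by (simp add: xs(2) fscale_tensors split_def comp_def)
    also have "\<dots> = c * sum_list (map (\<lambda>(x, y). \<beta> x y) xs)"
      using xs(1) by (induction xs) (auto simp: \<beta> algebra_simps)
    finally show ?thesis using \<phi>[OF xs(1)] xs(2) by simp
  qed
  show "(\<lambda>w. if w \<in> tensor_space X Y then \<phi> w else 0) \<in> dual_space (tensor_space X Y)"
    using fs.subspace_add[OF tensor_space_subspace] fs.subspace_scale[OF tensor_space_subspace]
    by (auto simp: dual_space_def linear_on_def add scale)
  show "\<phi> (tensor x y) = \<beta> x y" if "x \<in> X" "y \<in> Y"
    using \<phi>[of "[(x, y)]"] that by simp
qed

text \<open>With one variable frozen, a sum of pure tensors is a combination of the factors in the
  other variable, so \<open>A\<close> and then \<open>B\<close> act by linearity.\<close>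

lemma tensor_op_tensors:
  assumes A: "linear_on fscale fscale X A" and B: "linear_on fscale fscale Y B" and xs: "set xs \<subseteq> X \<times> Y"
  shows "tensor_op A B (tensors xs) = tensors (map (\<lambda>(x, y). (A x, B y)) xs)"
proof
  fix ij :: "'i \<times> 'j"
  obtain i j where ij: "ij = (i, j)" by (cases ij)
  interpret A: linear_map_on fscale fscale X A
    by (rule linear_map_onI[OF vector_space_fscale vector_space_fscale X A])
  interpret B: linear_map_on fscale fscale Y B
    by (rule linear_map_onI[OF vector_space_fscale vector_space_fscale Y B])
  have xs': "fst z \<in> X" "snd z \<in> Y" if "z \<in> set xs" for z using xs that by auto
  have 1: "(\<lambda>i'. tensors xs (i', j')) = sum_list (map (\<lambda>z. fscale (snd z j') (fst z)) xs)" for j'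
    unfolding tensors_def fun_eq_iff sum_list_fun_apply
    by (auto simp: tensor_def fscale_def split_def mult.commute)
  have 2: "A (\<lambda>i'. tensors xs (i', j')) = sum_list (map (\<lambda>z. fscale (snd z j') (A (fst z))) xs)" for j'
    unfolding 1 by (subst A.sum_list) (simp_all add: fs.subspace_scale[OF X] A.scale xs' cong: map_cong)
  have 3: "(\<lambda>j'. A (\<lambda>i'. tensors xs (i', j')) i) = sum_list (map (\<lambda>z. fscale (A (fst z) i) (snd z)) xs)"
    unfolding 2 fun_eq_iff sum_list_fun_apply by (auto simp: fscale_def mult.commute)
  have "B (\<lambda>j'. A (\<lambda>i'. tensors xs (i', j')) i) = sum_list (map (\<lambda>z. fscale (A (fst z) i) (B (snd z))) xs)"
    unfolding 3 by (subst B.sum_list) (simp_all add: fs.subspace_scale[OF Y] B.scale xs' cong: map_cong)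
  then show "tensor_op A B (tensors xs) ij = tensors (map (\<lambda>(x, y). (A x, B y)) xs) ij"
    by (simp add: ij tensor_op_def tensors_def sum_list_fun_apply tensor_def fscale_def split_def comp_def)
qed

text \<open>The universal property: coordinates of \<open>y\<close> in a basis of \<open>Y\<close> reduce a bilinear form to
  tensor products of functionals, hence to \<^const>\<open>tensor_op\<close>.\<close>

lemma bilinear_functional_exists:
  assumes left: "\<And>y. y \<in> Y \<Longrightarrow> linear_on fscale (*) X (\<lambda>x. \<beta> x y)"
    and right: "\<And>x. x \<in> X \<Longrightarrow> linear_on fscale (*) Y (\<beta> x)"
  obtains \<psi> where "\<psi> \<in> dual_space (tensor_space X Y)" "\<And>x y. x \<in> X \<Longrightarrow> y \<in> Y \<Longrightarrow> \<psi> (tensor x y) = \<beta> x y"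
proof -
  obtain B where B: "B \<subseteq> Y" "fs.independent B" "Y \<subseteq> fs.span B"
    using fs.maximal_independent_subset by blast
  let ?r = "fs.representation B"
  \<comment> \<open>Functionals are encoded as operators whose output is a constant function, so
    that \<open>tensor_op\<close> applies; any index, here \<open>undefined\<close>, reads off the
    value. The condition \<open>b \<in> B\<close> confines \<open>\<beta> x b\<close> to arguments
    in \<open>Y\<close>.\<close>
  define A where "A b = (\<lambda>x (_ :: 'i). if b \<in> B then \<beta> x b else 0)" for b
  define R where "R b = (\<lambda>y (_ :: 'j). ?r y b)" for b
  define \<phi> where "\<phi> w = Sum_any (\<lambda>b. tensor_op (A b) (R b) w (undefined, undefined))" for w
  have A: "linear_on fscale fscale X (A b)" for b
    using left[of b] B(1) by (auto simp: linear_on_def A_def fscale_def fun_eq_iff)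
  have R: "linear_on fscale fscale Y (R b)" for b
    unfolding linear_on_def R_def
    using fs.representation_add[OF B(2)] fs.representation_scale[OF B(2)] subsetD[OF B(3)]
    by (simp add: fun_eq_iff) (simp add: fscale_def)
  have \<beta>_sum: "\<beta> x y = (\<Sum>b\<in>S. (if b \<in> B then \<beta> x b else 0) * ?r y b)"
    if x: "x \<in> X" and y: "y \<in> Y" and S: "finite S" "{b. ?r y b \<noteq> 0} \<subseteq> S" for x y S
  proof -
    interpret l: linear_map_on fscale "(*)" Y "\<beta> x"
      by (rule linear_map_onI[OF vector_space_fscale vector_space_mult Y right[OF x]])
    have rB: "b \<in> B" if "?r y b \<noteq> 0" for b using fs.representation_ne_zero that by blast
    have "\<beta> x y = \<beta> x (\<Sum>b | ?r y b \<noteq> 0. fscale (?r y b) b)"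
      using fs.sum_nonzero_representation_eq[OF B(2), of y] y B(3) by auto
    also have "\<dots> = (\<Sum>b | ?r y b \<noteq> 0. \<beta> x (fscale (?r y b) b))"
      by (rule l.sum) (use rB B(1) fs.subspace_scale[OF Y] in auto)
    also have "\<dots> = (\<Sum>b | ?r y b \<noteq> 0. (if b \<in> B then \<beta> x b else 0) * ?r y b)"
      by (rule sum.cong) (use rB subsetD[OF B(1)] l.scale in auto)
    also have "\<dots> = (\<Sum>b\<in>S. (if b \<in> B then \<beta> x b else 0) * ?r y b)"
      by (rule sum.mono_neutral_left) (use S in auto)
    finally show ?thesis .
  qed
  have \<phi>: "\<phi> (tensors xs) = sum_list (map (\<lambda>(x, y). \<beta> x y) xs)" if xs: "set xs \<subseteq> X \<times> Y" for xs
  proof -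
    let ?S = "\<Union>z\<in>set xs. {b. ?r (snd z) b \<noteq> 0}"
    have S: "finite ?S" using fs.finite_representation by auto
    have "tensor_op (A b) (R b) (tensors xs) (undefined, undefined) =
      sum_list (map (\<lambda>z. (if b \<in> B then \<beta> (fst z) b else 0) * ?r (snd z) b) xs)" for b
      unfolding tensor_op_tensors[OF A R xs] unfolding tensors_def sum_list_fun_apply
      by (simp add: split_def comp_def sum_list_fun_apply tensor_def A_def R_def)
    then have "\<phi> (tensors xs) = Sum_any (\<lambda>b. sum_list (map (\<lambda>z. (if b \<in> B then \<beta> (fst z) b else 0) * ?r (snd z) b) xs))"
      by (simp add: \<phi>_def)
    also have "\<dots> = (\<Sum>b\<in>?S. sum_list (map (\<lambda>z. (if b \<in> B then \<beta> (fst z) b else 0) * ?r (snd z) b) xs))"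
    proof (rule Sum_any.expand_superset[OF S], rule subsetI, rule ccontr)
      fix b assume b: "b \<in> {b. sum_list (map (\<lambda>z. (if b \<in> B then \<beta> (fst z) b else 0) * ?r (snd z) b) xs) \<noteq> 0}"
        and "b \<notin> ?S"
      then have "map (\<lambda>z. (if b \<in> B then \<beta> (fst z) b else 0) * ?r (snd z) b) xs = map (\<lambda>_. 0) xs" by simp
      with b show False by (simp only: mem_Collect_eq sum_list_0 not_True_eq_False simp_thms)
    qed
    also have "\<dots> = sum_list (map (\<lambda>z. \<Sum>b\<in>?S. (if b \<in> B then \<beta> (fst z) b else 0) * ?r (snd z) b) xs)"
    proof -
      have "(\<Sum>b\<in>T. sum_list (map (\<lambda>z. g z b) ys)) = sum_list (map (\<lambda>z. \<Sum>b\<in>T. g z b) ys)"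
        for T and g :: "_ \<Rightarrow> _ \<Rightarrow> complex" and ys :: "(('i \<Rightarrow> complex) \<times> ('j \<Rightarrow> complex)) list"
        by (induction ys) (auto simp: sum.distrib)
      then show ?thesis .
    qed
    also have "\<dots> = sum_list (map (\<lambda>(x, y). \<beta> x y) xs)"
    proof (intro arg_cong[where f = sum_list] map_cong refl)
      fix z assume z: "z \<in> set xs"
      obtain x y where xy: "z = (x, y)" by (cases z)
      have x: "x \<in> X" and y: "y \<in> Y" using z xs xy by auto
      have sub: "{b. ?r y b \<noteq> 0} \<subseteq> ?S" using z xy by force
      show "(\<Sum>b\<in>?S. (if b \<in> B then \<beta> (fst z) b else 0) * ?r (snd z) b) = (case z of (x, y) \<Rightarrow> \<beta> x y)"
        unfolding xy fst_conv snd_conv prod.case by (rule \<beta>_sum[OF x y S sub, symmetric])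
    qed
    finally show ?thesis .
  qed
  have "\<beta> (fscale c x) y = c * \<beta> x y" if "x \<in> X" "y \<in> Y" for c x y
    using left[OF that(2)] that by (simp add: linear_on_def)
  note \<psi> = tensor_functional[OF \<phi> this]
  show thesis
    by (rule that[OF \<psi>(1)]) (simp_all add: tensor_in \<psi>(2))
qed

end

lemma dual_space_subspace: "module.subspace fscale (dual_space W)"
proof -
  show ?thesis
    by (rule fs.subspaceI) (auto simp: dual_space_def linear_on_def fscale_def algebra_simps)
qed

section \<open>Conformal blocks on pure tensors\<close>

text \<open>Stated for a bare family \<open>Yw\<close>, since \<open>tensor_mode X Y (vac V)\<close>
  is not packaged as a module for \<open>V\<close>.\<close>

lemma (in voa) opp_mode_wt:
  assumes "vector_space s" "\<And>m. Yw 0 m w = 0" and v: "v \<in> wt_space V k"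
  shows "opp_mode V s Yw v n w =
    (\<Sum>i\<le>k. s ((-1) ^ k / fact i) (Yw ((Lop V 1 ^^ i) v) (2 * int k - int i - n - 2) w))"
proof -
  interpret S: vector_space s by fact
  let ?f = "\<lambda>j i. s ((-1) ^ j / fact i) (Yw ((Lop V 1 ^^ i) (hcomp V v j)) (2 * int j - int i - n - 2) w)"
  have L0: "(Lop V 1 ^^ i) 0 = 0" for i by (induction i) auto
  have "opp_mode V s Yw v n w = Sum_any (\<lambda>j. Sum_any (?f j))" by (simp add: opp_mode_def)
  also have "\<dots> = Sum_any (?f k)"
    by (rule Sum_any_single) (simp add: hcomp_wt[OF v] L0 assms(2))
  also have "\<dots> = (\<Sum>i\<le>k. ?f k i)"
  proof (rule Sum_any.expand_superset)
    have zero: "?f k i = 0" if "i > k" for i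
      using L1_pow_wt(2)[OF v that] by (simp add: hcomp_wt[OF v] assms(2))
    show "{i. ?f k i \<noteq> 0} \<subseteq> {..k}"
    proof (intro subsetI, rule ccontr)
      fix i assume i: "i \<in> {i. ?f k i \<noteq> 0}" "i \<notin> {..k}"
      from i(2) have "i > k" by simp
      from zero[OF this] i(1) show False by blast
    qed
  qed simp
  finally show ?thesis by (simp add: hcomp_wt[OF v])
qed

context
  fixes V :: "'v::ab_group_add voa_data"
    and X :: "('v, 'i \<Rightarrow> complex) vmodule" and Y :: "('v, 'j \<Rightarrow> complex) vmodule"
  assumes X: "voa_module V fscale X" and Y: "voa_module V fscale Y"
begin

interpretation X: voa_module V fscale X by (rule X)
interpretation Y: voa_module V fscale Y by (rule Y)

text \<open>The vacuum has only the mode \<open>-1\<close>, so \<open>n - 1 - i = -1\<close> leaves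
  the single term \<open>i = n\<close>.\<close>

lemma tensor_mode_left:
  assumes xs: "set xs \<subseteq> X.C \<times> Y.C"
  shows "tensor_mode X Y v (vac V) n (tensors xs) = tensors (map (\<lambda>(x, y). (mmode X v n x, y)) xs)"
proof -
  have t: "tensor_op (mmode X v i) (mmode Y (vac V) (n - 1 - i)) (tensors xs) =
      tensors (map (\<lambda>(x, y). (mmode X v i x, mmode Y (vac V) (n - 1 - i) y)) xs)" for i
    by (rule tensor_op_tensors[OF X.subspace Y.subspace X.linear_right Y.linear_right xs])
  have "tensors (map (\<lambda>(x, y). (mmode X v i x, mmode Y (vac V) (n - 1 - i) y)) xs) = 0" if "i \<noteq> n" for i
    using xs that by (induction xs) (auto simp: Y.vacuum)
  then have "tensor_mode X Y v (vac V) n (tensors xs) =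
      tensors (map (\<lambda>(x, y). (mmode X v n x, mmode Y (vac V) (n - 1 - n) y)) xs)"
    unfolding tensor_mode_def t by (rule Sum_any_single)
  also have "\<dots> = tensors (map (\<lambda>(x, y). (mmode X v n x, y)) xs)"
    by (intro arg_cong[where f = tensors] map_cong refl) (use xs in \<open>auto simp: Y.vacuum\<close>)
  finally show ?thesis .
qed

text \<open>The vacuum now acts in the first factor and leaves \<open>i = -1\<close>, where the mode
  of \<open>v\<close> has index \<open>n - 1 + 1 = n\<close>.\<close>

lemma tensor_mode_right:
  assumes xs: "set xs \<subseteq> X.C \<times> Y.C"
  shows "tensor_mode X Y (vac V) v n (tensors xs) = tensors (map (\<lambda>(x, y). (x, mmode Y v n y)) xs)"
proof -
  have t: "tensor_op (mmode X (vac V) i) (mmode Y v (n - 1 - i)) (tensors xs) =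
      tensors (map (\<lambda>(x, y). (mmode X (vac V) i x, mmode Y v (n - 1 - i) y)) xs)" for i
    by (rule tensor_op_tensors[OF X.subspace Y.subspace X.linear_right Y.linear_right xs])
  have "tensors (map (\<lambda>(x, y). (mmode X (vac V) i x, mmode Y v (n - 1 - i) y)) xs) = 0" if "i \<noteq> -1" for i
    using xs that by (induction xs) (auto simp: X.vacuum)
  then have "tensor_mode X Y (vac V) v n (tensors xs) =
      tensors (map (\<lambda>(x, y). (mmode X (vac V) (-1) x, mmode Y v (n - 1 - (-1)) y)) xs)"
    unfolding tensor_mode_def t by (rule Sum_any_single)
  also have "\<dots> = tensors (map (\<lambda>(x, y). (x, mmode Y v n y)) xs)"
    by (intro arg_cong[where f = tensors] map_cong refl) (use xs in \<open>auto simp: X.vacuum\<close>)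
  finally show ?thesis .
qed

lemma tensor_opp_right:
  assumes xs: "set xs \<subseteq> X.C \<times> Y.C" and v: "v \<in> wt_space V k"
  shows "opp_mode V fscale (tensor_mode X Y (vac V)) v n (tensors xs) =
    tensors (map (\<lambda>(x, y). (x, Y.opp v n y)) xs)"
proof -
  have "tensors (map (\<lambda>(x, y). (x, mmode Y 0 m y)) xs) = 0" for m
    using xs by (induction xs) (auto simp: Y.mode_zero_left)
  then have 0: "tensor_mode X Y (vac V) 0 m (tensors xs) = 0" for m
    by (simp only: tensor_mode_right[OF xs])
  have "opp_mode V fscale (tensor_mode X Y (vac V)) v n (tensors xs) = (\<Sum>i\<le>k. fscale ((-1) ^ k / fact i)
      (tensors (map (\<lambda>(x, y). (x, mmode Y ((Lop V 1 ^^ i) v) (2 * int k - int i - n - 2) y)) xs)))"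
    unfolding X.alg.opp_mode_wt[where Yw = "tensor_mode X Y (vac V)" and w = "tensors xs", OF vector_space_fscale 0 v]
    by (simp only: tensor_mode_right[OF xs])
  also have "\<dots> = tensors (map (\<lambda>(x, y). (x, Y.opp v n y)) xs)"
    using xs
  proof (induction xs)
    case Nil
    show ?case by (simp add: fscale_def zero_fun_def)
  next
    case (Cons z xs)
    obtain x y where z: "z = (x, y)" "y \<in> Y.C" using Cons.prems by (cases z) auto
    have "Y.opp v n y = (\<Sum>i\<le>k. fscale ((-1) ^ k / fact i) (mmode Y ((Lop V 1 ^^ i) v) (2 * int k - int i - n - 2) y))"
      by (rule X.alg.opp_mode_wt[OF vector_space_fscale _ v]) (simp add: Y.mode_zero_left z)
    then show ?case
      using Cons by (simp add: z fscale_add sum.distrib tensor_sum tensor_fscale del: plus_fun_apply)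
  qed
  finally show ?thesis .
qed

text \<open>All conditions are linear in \<open>w\<close>, so they may be tested on pure tensors,
  where the modes and their opposites act in one factor only.\<close>

lemma nodal_blocks_iff:
  "\<psi> \<in> nodal_blocks V (tensor_space X.C Y.C) (tensor_mode X Y) \<longleftrightarrow> \<psi> \<in> dual_space (tensor_space X.C Y.C) \<and>
    (\<forall>x\<in>X.C. \<forall>y\<in>Y.C. \<forall>k. \<forall>v\<in>wt_space V k.
      \<psi> (tensor (mmode X v (int k - 1) x) y) = \<psi> (tensor x (Y.opp v (int k - 1) y)) \<and>
      (\<forall>n. int k - n - 1 > 0 \<longrightarrow> \<psi> (tensor (mmode X v n x) y) = 0 \<and> \<psi> (tensor x (mmode Y v n y)) = 0))"
    (is "_ \<longleftrightarrow> ?D \<and> ?R")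
proof
  assume n: "\<psi> \<in> nodal_blocks V (tensor_space X.C Y.C) (tensor_mode X Y)"
  have "?R"
  proof (intro ballI allI)
    fix x y k v assume x: "x \<in> X.C" and y: "y \<in> Y.C" and v: "v \<in> wt_space V k"
    have xs: "set [(x, y)] \<subseteq> X.C \<times> Y.C" using x y by simp
    have w: "tensors [(x, y)] \<in> tensor_space X.C Y.C" by (rule tensors_in[OF X.subspace Y.subspace xs])
    from n[unfolded nodal_blocks_def Let_def mem_Collect_eq] w v
    have "\<psi> (tensor_mode X Y v (vac V) (int k - 1) (tensors [(x, y)])) =
        \<psi> (opp_mode V fscale (tensor_mode X Y (vac V)) v (int k - 1) (tensors [(x, y)])) \<and>
      (\<forall>n. int k - n - 1 > 0 \<longrightarrow> \<psi> (tensor_mode X Y v (vac V) n (tensors [(x, y)])) = 0 \<and>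
        \<psi> (tensor_mode X Y (vac V) v n (tensors [(x, y)])) = 0)"
      by blast
    then show "\<psi> (tensor (mmode X v (int k - 1) x) y) = \<psi> (tensor x (Y.opp v (int k - 1) y)) \<and>
      (\<forall>n. int k - n - 1 > 0 \<longrightarrow> \<psi> (tensor (mmode X v n x) y) = 0 \<and> \<psi> (tensor x (mmode Y v n y)) = 0)"
      unfolding tensor_mode_left[OF xs] tensor_mode_right[OF xs] tensor_opp_right[OF xs v] by simp
  qed
  then show "?D \<and> ?R" using n by (simp add: nodal_blocks_def Let_def)
next
  assume DR: "?D \<and> ?R"
  then have D: ?D and R: ?R by blast+
  have "\<psi> (tensor_mode X Y v (vac V) (int k - 1) w) = \<psi> (opp_mode V fscale (tensor_mode X Y (vac V)) v (int k - 1) w) \<and>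
      (\<forall>n. int k - n - 1 > 0 \<longrightarrow> \<psi> (tensor_mode X Y v (vac V) n w) = 0 \<and> \<psi> (tensor_mode X Y (vac V) v n w) = 0)"
    if w: "w \<in> tensor_space X.C Y.C" and v: "v \<in> wt_space V k" for w k v
  proof -
    obtain xs where xs: "set xs \<subseteq> X.C \<times> Y.C" "w = tensors xs"
      using tensor_spaceE[OF X.subspace Y.subspace w] by blast
    have sets: "set (map (\<lambda>(x, y). (mmode X v n x, y)) xs) \<subseteq> X.C \<times> Y.C"
      "set (map (\<lambda>(x, y). (x, mmode Y v n y)) xs) \<subseteq> X.C \<times> Y.C"
      "set (map (\<lambda>(x, y). (x, Y.opp v n y)) xs) \<subseteq> X.C \<times> Y.C" for n
      using xs(1) X.closed Y.closed Y.opp_closed by auto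
    note d = dual_tensors[OF X.subspace Y.subspace D]
    have 1: "\<psi> (tensor_mode X Y v (vac V) n w) = sum_list (map (\<lambda>(x, y). \<psi> (tensor (mmode X v n x) y)) xs)" for n
      unfolding xs(2) tensor_mode_left[OF xs(1)] d[OF sets(1)] by (simp add: split_def comp_def)
    have 2: "\<psi> (tensor_mode X Y (vac V) v n w) = sum_list (map (\<lambda>(x, y). \<psi> (tensor x (mmode Y v n y))) xs)" for n
      unfolding xs(2) tensor_mode_right[OF xs(1)] d[OF sets(2)] by (simp add: split_def comp_def)
    have 3: "\<psi> (opp_mode V fscale (tensor_mode X Y (vac V)) v n w) =
        sum_list (map (\<lambda>(x, y). \<psi> (tensor x (Y.opp v n y))) xs)" for n
      unfolding xs(2) tensor_opp_right[OF xs(1) v] d[OF sets(3)] by (simp add: split_def comp_def)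
    have e: "sum_list (map f xs) = sum_list (map g xs)" if "\<And>x y. x \<in> X.C \<Longrightarrow> y \<in> Y.C \<Longrightarrow> f (x, y) = g (x, y)"
      for f g :: "_ \<Rightarrow> complex"
      by (intro arg_cong[where f = sum_list] map_cong refl) (use that xs(1) in auto)
    have z: "sum_list (map f xs) = 0" if "\<And>x y. x \<in> X.C \<Longrightarrow> y \<in> Y.C \<Longrightarrow> f (x, y) = 0"
      for f :: "_ \<Rightarrow> complex"
      using e[of f "\<lambda>_. 0"] that by simp
    show ?thesis
    proof (intro conjI allI impI)
      show "\<psi> (tensor_mode X Y v (vac V) (int k - 1) w) = \<psi> (opp_mode V fscale (tensor_mode X Y (vac V)) v (int k - 1) w)"
        unfolding 1 3 by (rule e) (use R v in simp)
      fix n assume n: "int k - n - 1 > 0"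
      show "\<psi> (tensor_mode X Y v (vac V) n w) = 0" unfolding 1 by (rule z) (use R v n in simp)
      show "\<psi> (tensor_mode X Y (vac V) v n w) = 0" unfolding 2 by (rule z) (use R v n in simp)
    qed
  qed
  then show "\<psi> \<in> nodal_blocks V (tensor_space X.C Y.C) (tensor_mode X Y)"
    using D by (simp add: nodal_blocks_def Let_def)
qed

lemma smooth_blocks_subspace: "module.subspace fscale (smooth_blocks V X Y)"
proof -
  show ?thesis
    using fs.subspace_0[OF dual_space_subspace] fs.subspace_add[OF dual_space_subspace]
      fs.subspace_scale[OF dual_space_subspace]
    by (intro fs.subspaceI) (auto simp: smooth_blocks_def fscale_def)
qed

lemma nodal_blocks_subspace: "module.subspace fscale (nodal_blocks V (tensor_space X.C Y.C) (tensor_mode X Y))"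
proof -
  show ?thesis
    using fs.subspace_0[OF dual_space_subspace] fs.subspace_add[OF dual_space_subspace]
      fs.subspace_scale[OF dual_space_subspace]
    by (intro fs.subspaceI) (auto simp: nodal_blocks_iff fscale_def)
qed

end

section \<open>Comparison of dimensions\<close>

text \<open>An injective image of a basis is a basis. In infinite dimension both sides are 0, so the
  lemma also covers the nodal blocks, for which no finiteness is established.\<close>

lemma dim_linear_image:
  fixes P :: "('i \<Rightarrow> complex) \<Rightarrow> ('j \<Rightarrow> complex)"
  assumes P: "Vector_Spaces.linear fscale fscale P" and inj: "inj_on P S" and S: "module.subspace fscale S"
  shows "vector_space.dim fscale (P ` S) = vector_space.dim fscale S"
proof -
  interpret P: module_hom fscale fscale P using P by (simp add: module_hom_iff_linear)
  obtain B where B: "B \<subseteq> S" "fs.independent B" "S \<subseteq> fs.span B" "card B = fs.dim S"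
    using fs.basis_exists by blast
  have span: "fs.span B = S" using fs.span_minimal[OF B(1) S] B(3) by blast
  have "fs.independent (P ` B)"
    by (rule P.independent_injective_image[OF B(2)]) (simp add: span inj)
  moreover have "fs.span (P ` B) = fs.span (P ` S)"
    unfolding P.span_image span fs.span_eq_iff[THEN iffD2, OF S] ..
  ultimately have "fs.dim (P ` S) = card (P ` B)" by (intro fs.dim_eq_card) auto
  also have "\<dots> = card B" by (rule card_image) (rule inj_on_subset[OF inj B(1)])
  finally show ?thesis using B(4) by simp
qed

text \<open>A basis of \<open>S\<close> together with a vector \<open>x\<close> outside
  \<open>S\<close> extends to a basis of \<open>T\<close>; as the latter is finite, cardinalities
  compare strictly.\<close>

lemma dim_strict_mono:
  fixes S :: "('i \<Rightarrow> complex) set"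
  assumes S: "module.subspace fscale S" and T: "finite_dim fscale T" and "S \<subset> T"
  shows "vector_space.dim fscale S < vector_space.dim fscale T"
proof -
  obtain F where F: "finite F" "T \<subseteq> fs.span F" using T by (auto simp: finite_dim_def)
  obtain B where B: "B \<subseteq> S" "fs.independent B" "S \<subseteq> fs.span B" "card B = fs.dim S"
    using fs.basis_exists by blast
  have span: "fs.span B = S" using fs.span_minimal[OF B(1) S] B(3) by blast
  obtain x where x: "x \<in> T" "x \<notin> S" using assms(3) by blast
  have indep: "fs.independent (insert x B)"
    using x(2) B(2) span by (intro fs.independent_insertI) auto
  have sub: "insert x B \<subseteq> T" using B(1) x(1) assms(3) by blast
  obtain B' where B': "insert x B \<subseteq> B'" "B' \<subseteq> T" "fs.independent B'" "T \<subseteq> fs.span B'"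
    using fs.maximal_independent_subset_extend[OF sub indep] by blast
  have fin: "finite B'"
    using fs.independent_span_bound[OF F(1) B'(3)] B'(2) F(2) by blast
  have "x \<notin> B" using x(2) B(1) by blast
  then have "card B < card (insert x B)"
    using fin B'(1) finite_subset by (metis card_insert_disjoint finite_insert lessI)
  also have "\<dots> \<le> card B'" by (rule card_mono[OF fin B'(1)])
  also have "\<dots> = fs.dim T" by (rule fs.basis_card_eq_dim[OF B'(2,4,3)])
  finally show ?thesis using B(4) by simp
qed

text \<open>The image of the pullback consists of the functionals that vanish on \<open>ker p \<otimes> Y\<close>.\<close>

lemma blocks_pullback:
  fixes X1 X2 :: "('v::ab_group_add, 'i \<Rightarrow> complex) vmodule" and Y :: "('v, 'j \<Rightarrow> complex) vmodule"
  assumes X1: "voa_module V fscale X1" and X2: "voa_module V fscale X2" and Y: "voa_module V fscale Y"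
    and p: "linear_on fscale fscale (mcarrier X1) p" and surj: "p ` mcarrier X1 = mcarrier X2"
    and hom: "\<And>v n x. x \<in> mcarrier X1 \<Longrightarrow> p (mmode X1 v n x) = mmode X2 v n (p x)"
    and nodal: "\<And>\<psi> x y. \<psi> \<in> nodal_blocks V (tensor_space (mcarrier X1) (mcarrier Y)) (tensor_mode X1 Y) \<Longrightarrow>
      x \<in> mcarrier X1 \<Longrightarrow> y \<in> mcarrier Y \<Longrightarrow> p x = 0 \<Longrightarrow> \<psi> (tensor x y) = 0"
    and smooth: "\<psi>0 \<in> smooth_blocks V X1 Y" "x0 \<in> mcarrier X1" "y0 \<in> mcarrier Y" "p x0 = 0"
      "\<psi>0 (tensor x0 y0) \<noteq> 0"
    and fin: "finite_dim fscale (smooth_blocks V X1 Y)"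
  shows "vector_space.dim fscale (smooth_blocks V X2 Y) < vector_space.dim fscale (smooth_blocks V X1 Y)"
    and "vector_space.dim fscale (nodal_blocks V (tensor_space (mcarrier X2) (mcarrier Y)) (tensor_mode X2 Y)) =
      vector_space.dim fscale (nodal_blocks V (tensor_space (mcarrier X1) (mcarrier Y)) (tensor_mode X1 Y))"
proof -
  interpret X1: voa_module V fscale X1 by (rule X1)
  interpret X2: voa_module V fscale X2 by (rule X2)
  interpret Y: voa_module V fscale Y by (rule Y)
  interpret p: linear_map_on fscale fscale X1.C p
    by (rule linear_map_onI[OF vector_space_fscale vector_space_fscale X1.subspace p])
  let ?T1 = "tensor_space X1.C Y.C" and ?T2 = "tensor_space X2.C Y.C"
  \<comment> \<open>The pullback of functionals along \<open>p \<otimes> id\<close>, cut off outside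
    the tensor product.\<close>
  define P where "P \<psi> = (\<lambda>w. if w \<in> ?T1 then \<psi> (tensor_op p (\<lambda>y. y) w) else 0)"
    for \<psi> :: "('i \<times> 'j \<Rightarrow> complex) \<Rightarrow> complex"
  have pX: "p x \<in> X2.C" if "x \<in> X1.C" for x using surj that by blast
  have id: "linear_on fscale fscale Y.C (\<lambda>y. y)" by (simp add: linear_on_def)
  note T1_in = tensor_in[OF X1.subspace Y.subspace]
  have P_dual: "P \<psi> \<in> dual_space ?T1" and P_tensor: "x \<in> X1.C \<Longrightarrow> y \<in> Y.C \<Longrightarrow> P \<psi> (tensor x y) = \<psi> (tensor (p x) y)"
    if \<psi>: "\<psi> \<in> dual_space ?T2" for \<psi> x y
  proof -
    have 1: "\<psi> (tensor_op p (\<lambda>y. y) (tensors xs)) = sum_list (map (\<lambda>(x, y). \<psi> (tensor (p x) y)) xs)"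
      if xs: "set xs \<subseteq> X1.C \<times> Y.C" for xs
    proof -
      have "set (map (\<lambda>(x, y). (p x, y)) xs) \<subseteq> X2.C \<times> Y.C" using xs pX by auto
      from dual_tensors[OF X2.subspace Y.subspace \<psi> this] show ?thesis
        unfolding tensor_op_tensors[OF X1.subspace Y.subspace p id xs] by (simp add: split_def comp_def)
    qed
    have 2: "\<psi> (tensor (p (fscale c x)) y) = c * \<psi> (tensor (p x) y)" if "x \<in> X1.C" "y \<in> Y.C" for c x y
      using linear_map_on.scale[OF dual_space_linear[OF X2.subspace Y.subspace \<psi>]
          tensor_in[OF X2.subspace Y.subspace pX[OF that(1)] that(2)], of c] that
      by (simp add: p.scale tensor_fscale)
    show "P \<psi> \<in> dual_space ?T1"
      unfolding P_def
      by (rule tensor_functional(1)[OF X1.subspace Y.subspace, where \<beta> = "\<lambda>x y. \<psi> (tensor (p x) y)"])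
        (fact 1, fact 2)
    show "P \<psi> (tensor x y) = \<psi> (tensor (p x) y)" if "x \<in> X1.C" "y \<in> Y.C"
      unfolding P_def using 1[of "[(x, y)]"] that T1_in[OF that] by simp
  qed
  have P_linear: "Vector_Spaces.linear fscale fscale P"
    unfolding linear_UNIV_iff by (auto simp: vector_space_fscale linear_on_def P_def fscale_def fun_eq_iff)
  have P_inj: "inj_on P (dual_space ?T2)"
  proof (rule inj_onI)
    fix \<psi> \<phi> assume \<psi>: "\<psi> \<in> dual_space ?T2" and \<phi>: "\<phi> \<in> dual_space ?T2" and eq: "P \<psi> = P \<phi>"
    show "\<psi> = \<phi>"
    proof (rule dual_space_eqI[OF X2.subspace Y.subspace \<psi> \<phi>])
      fix x y assume "x \<in> X2.C" and y: "y \<in> Y.C"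
      then obtain x' where x': "x' \<in> X1.C" "x = p x'" using surj by blast
      show "\<psi> (tensor x y) = \<phi> (tensor x y)"
        using P_tensor[OF \<psi> x'(1) y] P_tensor[OF \<phi> x'(1) y] eq x'(2) by simp
    qed
  qed
  \<comment> \<open>A functional that vanishes on \<open>ker p \<otimes> Y\<close> descends:
    \<open>?q\<close> picks preimages under \<open>p\<close>, and \<open>eq\<close> shows that the
    choice does not matter, which gives linearity.\<close>
  have P_range: "\<exists>\<phi>\<in>dual_space ?T2. P \<phi> = \<psi>"
    if \<psi>: "\<psi> \<in> dual_space ?T1" and 0: "\<And>x y. x \<in> X1.C \<Longrightarrow> y \<in> Y.C \<Longrightarrow> p x = 0 \<Longrightarrow> \<psi> (tensor x y) = 0" for \<psi>
  proof -
    let ?q = "inv_into X1.C p"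
    have q: "?q x \<in> X1.C" "p (?q x) = x" if "x \<in> X2.C" for x
      using that surj by (auto simp: inv_into_into f_inv_into_f)
    interpret l: linear_map_on fscale "(*)" ?T1 \<psi> by (rule dual_space_linear[OF X1.subspace Y.subspace \<psi>])
    have eq: "\<psi> (tensor x y) = \<psi> (tensor x' y)" if "x \<in> X1.C" "x' \<in> X1.C" "y \<in> Y.C" "p x = p x'" for x x' y
    proof -
      have "tensor x y - tensor x' y = tensor (x - x') y" by (auto simp: tensor_def algebra_simps)
      then have "\<psi> (tensor x y) - \<psi> (tensor x' y) = \<psi> (tensor (x - x') y)"
        using l.diff[OF T1_in[OF that(1,3)] T1_in[OF that(2,3)]] by simp
      also have "\<dots> = 0"
        by (rule 0) (use that in \<open>simp_all add: p.diff X1.C_simps\<close>)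
      finally show ?thesis by simp
    qed
    have left: "linear_on fscale (*) X2.C (\<lambda>x. \<psi> (tensor (?q x) y))" if y: "y \<in> Y.C" for y
      unfolding linear_on_def
    proof (intro conjI ballI allI)
      fix x x' assume x: "x \<in> X2.C" "x' \<in> X2.C"
      have "\<psi> (tensor (?q (x + x')) y) = \<psi> (tensor (?q x + ?q x') y)"
        by (rule eq) (use x y q X2.C_simps(1) X1.C_simps(1) p.add in auto)
      also have "tensor (?q x + ?q x') y = tensor (?q x) y + tensor (?q x') y"
        by (auto simp: tensor_def algebra_simps)
      also have "\<psi> \<dots> = \<psi> (tensor (?q x) y) + \<psi> (tensor (?q x') y)"
        by (rule l.add) (use x y q T1_in in auto)
      finally show "\<psi> (tensor (?q (x + x')) y) = \<psi> (tensor (?q x) y) + \<psi> (tensor (?q x') y)" .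
    next
      fix c x assume x: "x \<in> X2.C"
      have "\<psi> (tensor (?q (fscale c x)) y) = \<psi> (tensor (fscale c (?q x)) y)"
        by (rule eq) (use x y q X2.C_simps(3) X1.C_simps(3) p.scale in auto)
      also have "\<dots> = c * \<psi> (tensor (?q x) y)"
        unfolding tensor_fscale by (rule l.scale) (use x y q T1_in in auto)
      finally show "\<psi> (tensor (?q (fscale c x)) y) = c * \<psi> (tensor (?q x) y)" .
    qed
    have right: "linear_on fscale (*) Y.C (\<lambda>y. \<psi> (tensor (?q x) y))" if x: "x \<in> X2.C" for x
      unfolding linear_on_def tensor_add tensor_fscale
      using l.add l.scale T1_in[OF q(1)[OF x]] by auto
    obtain \<phi> where \<phi>: "\<phi> \<in> dual_space ?T2"
      "\<And>x y. x \<in> X2.C \<Longrightarrow> y \<in> Y.C \<Longrightarrow> \<phi> (tensor x y) = \<psi> (tensor (?q x) y)"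
      using bilinear_functional_exists[OF X2.subspace Y.subspace left right] by blast
    have "P \<phi> = \<psi>"
    proof (rule dual_space_eqI[OF X1.subspace Y.subspace P_dual[OF \<phi>(1)] \<psi>])
      fix x y assume x: "x \<in> X1.C" and y: "y \<in> Y.C"
      have "P \<phi> (tensor x y) = \<psi> (tensor (?q (p x)) y)"
        using P_tensor[OF \<phi>(1) x y] \<phi>(2)[OF pX[OF x] y] by simp
      also have "\<dots> = \<psi> (tensor x y)"
        by (rule eq) (use q[OF pX[OF x]] x y in auto)
      finally show "P \<phi> (tensor x y) = \<psi> (tensor x y)" .
    qed
    then show ?thesis using \<phi>(1) by blast
  qed

  let ?S1 = "smooth_blocks V X1 Y" and ?S2 = "smooth_blocks V X2 Y"
  have S2: "?S2 \<subseteq> dual_space ?T2" by (auto simp: smooth_blocks_def)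
  have "P ` ?S2 \<subseteq> ?S1"
  proof
    fix \<phi> assume "\<phi> \<in> P ` ?S2"
    then obtain \<psi> where \<psi>: "\<psi> \<in> ?S2" "\<phi> = P \<psi>" by blast
    then have d: "\<psi> \<in> dual_space ?T2" using S2 by blast
    have "P \<psi> (tensor (X1.Y v n x) y) = P \<psi> (tensor x (Y.opp v n y))" if x: "x \<in> X1.C" and y: "y \<in> Y.C" for v n x y
      unfolding P_tensor[OF d X1.closed[OF x] y] P_tensor[OF d x Y.opp_closed[OF y]] hom[OF x]
      using \<psi>(1) pX[OF x] y by (simp add: smooth_blocks_def)
    then show "\<phi> \<in> ?S1" using P_dual[OF d] \<psi>(2) by (simp add: smooth_blocks_def)
  qed
  \<comment> \<open>A pulled back functional vanishes on \<open>x0 \<otimes> y0\<close> because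
    \<open>p x0 = 0\<close>.\<close>
  moreover have "\<psi>0 \<notin> P ` ?S2"
  proof
    assume "\<psi>0 \<in> P ` ?S2"
    then obtain \<psi> where \<psi>: "\<psi> \<in> dual_space ?T2" "\<psi>0 = P \<psi>" using S2 by blast
    have "\<psi> (tensor 0 y0) = 0"
      using linear_map_on.zero[OF dual_space_linear[OF X2.subspace Y.subspace \<psi>(1)]] by simp
    then show False using P_tensor[OF \<psi>(1) smooth(2,3)] smooth(4,5) \<psi>(2) by simp
  qed
  ultimately have strict: "P ` ?S2 \<subset> ?S1" using smooth(1) by blast
  have sub2: "fs.subspace ?S2" by (rule smooth_blocks_subspace[OF X2 Y])
  have "fs.dim (P ` ?S2) < fs.dim ?S1"
    by (rule dim_strict_mono[OF module_hom.subspace_image[OF P_linear[folded module_hom_iff_linear] sub2] fin strict])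
  then show "fs.dim ?S2 < fs.dim ?S1"
    using dim_linear_image[OF P_linear inj_on_subset[OF P_inj S2] sub2] by simp

  let ?N1 = "nodal_blocks V ?T1 (tensor_mode X1 Y)" and ?N2 = "nodal_blocks V ?T2 (tensor_mode X2 Y)"
  note n1 = nodal_blocks_iff[OF X1 Y] and n2 = nodal_blocks_iff[OF X2 Y]
  have N2: "?N2 \<subseteq> dual_space ?T2" using n2 by blast
  \<comment> \<open>As \<open>p\<close> is onto and commutes with the modes, each nodal condition
    over \<open>X2\<close> is the same condition on images of vectors of \<open>X1\<close>.\<close>
  have iff: "P \<psi> \<in> ?N1 \<longleftrightarrow> \<psi> \<in> ?N2" if d: "\<psi> \<in> dual_space ?T2" for \<psi>
  proof -
    have "(\<forall>x\<in>X2.C. Q x) \<longleftrightarrow> (\<forall>x\<in>X1.C. Q (p x))" for Q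
      by (simp flip: surj)
    then show ?thesis
      unfolding n1 n2 using d P_dual[OF d]
      by (simp add: P_tensor[OF d] X1.closed Y.closed Y.opp_closed hom)
  qed
  have "P ` ?N2 = ?N1"
  proof
    show "P ` ?N2 \<subseteq> ?N1" using iff N2 by blast
    show "?N1 \<subseteq> P ` ?N2"
    proof
      fix \<psi> assume \<psi>: "\<psi> \<in> ?N1"
      then have "\<psi> \<in> dual_space ?T1" using n1 by blast
      from P_range[OF this nodal[OF \<psi>]] obtain \<phi> where "\<phi> \<in> dual_space ?T2" "P \<phi> = \<psi>" by blast
      then show "\<psi> \<in> P ` ?N2" using iff \<psi> by blast
    qed
  qed
  then show "fs.dim ?N2 = fs.dim ?N1"
    using dim_linear_image[OF P_linear inj_on_subset[OF P_inj N2] nodal_blocks_subspace[OF X2 Y]] by simp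
qed

section \<open>The pairs built from \<open>M\<close> and from the submodule generated by
  \<open>\<Omega>(M)\<close>\<close>

theorem theorem2p2:
  fixes V :: "'v::ab_group_add voa_data"
    and s :: "complex \<Rightarrow> 'm::ab_group_add \<Rightarrow> 'm"
  assumes "voa V"
    and "C2_cofinite V"
    and "\<exists>M :: ('v, 'm) vmodule. gr_module V s M \<and> \<not> lowest_generated V s M"
  shows "\<exists>(X :: ('v, nat \<Rightarrow> complex) vmodule) (Y :: ('v, nat \<Rightarrow> complex) vmodule).
    gr_module V fscale X \<and> gr_module V fscale Y \<and>
    vector_space.dim fscale (smooth_blocks V X Y) \<noteq>
    vector_space.dim fscale
      (nodal_blocks V (tensor_space (mcarrier X) (mcarrier Y)) (tensor_mode X Y))"
proof -
  obtain M0 :: "('v, 'm) vmodule" where M0: "gr_module V s M0" "\<not> lowest_generated V s M0"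
    using assms(3) by blast
  have "voa_gr_module V s M0"
    using M0(1) assms(1) by (intro voa_gr_module.intro voa_module.intro) (auto simp: gr_module_def)
  from voa_gr_module.cyclic_not_lowest_generated[OF this M0(2)]
  obtain M :: "('v, 'm) vmodule" and w a where M: "voa_gr_module V s M" and w: "w \<in> gen_eigenspace V s M a"
    and cyclic: "\<And>U. vsubmodule s M U \<Longrightarrow> w \<in> U \<Longrightarrow> U = mcarrier M"
    and w_notin: "w \<notin> generated_submodule s M (Omega V M)"
    by blast
  interpret M: voa_gr_module V s M by (rule M)
  define N where "N = generated_submodule s M (Omega V M)"
  have Omega: "Omega V M \<subseteq> M.C" by (auto simp: Omega_def)
  have N: "vsubmodule s M N" unfolding N_def by (rule M.generated_vsubmodule[OF Omega])
  have Omega_N: "Omega V M \<subseteq> N" by (auto simp: N_def generated_submodule_def)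
  interpret N: voa_gr_module V s "M\<lparr>mcarrier := N\<rparr>"
    by (rule M.submodule[OF N])
  have wG: "w \<in> M.E.G a" using w by (simp add: M.gen_eigenspace_eq)
  have wC: "w \<in> M.C" using wG M.E.G_subset by blast

  obtain h1 :: "('m \<Rightarrow> complex) \<Rightarrow> nat \<Rightarrow> complex" where h1: "module_iso V fscale M.contragredient fscale h1"
    using voa_gr_module.transport_exists[OF M.contra_voa_gr_module] by blast
  obtain h2 :: "('m \<Rightarrow> complex) \<Rightarrow> nat \<Rightarrow> complex" where h2: "module_iso V fscale N.contragredient fscale h2"
    using voa_gr_module.transport_exists[OF N.contra_voa_gr_module] by blast
  obtain h3 :: "'m \<Rightarrow> nat \<Rightarrow> complex" where h3: "module_iso V s M fscale h3"
    using M.transport_exists by blast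
  interpret h1: module_iso V fscale M.contragredient fscale h1
    rewrites "mcarrier M.contragredient = M.dual_carrier"
    by (rule h1) (rule M.carrier_contra)
  interpret h2: module_iso V fscale N.contragredient fscale h2
    rewrites "mcarrier N.contragredient = N.dual_carrier"
    by (rule h2) (rule N.carrier_contra)
  interpret h3: module_iso V s M fscale h3 by (rule h3)
  let ?X1 = "h1.N" and ?X2 = "h2.N" and ?Y = "h3.N"
  note X1 = h1.voa_gr_module_N and X2 = h2.voa_gr_module_N and Y = h3.voa_gr_module_N
  interpret X1: voa_gr_module V fscale ?X1 by (rule X1)
  interpret X2: voa_gr_module V fscale ?X2 by (rule X2)
  interpret Y: voa_gr_module V fscale ?Y by (rule Y)

  let ?res = "M.restrict N"
  \<comment> \<open>The restriction \<open>M' \<rightarrow> N'\<close>, read through the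
    embeddings.\<close>
  define p where "p x = h2 (?res (inv_into M.dual_carrier h1 x))" for x
  have p_h1: "p (h1 f) = h2 (?res f)" if "f \<in> M.dual_carrier" for f
    unfolding p_def inv_into_f_f[OF h1.inj that] ..
  have res: "?res f \<in> N.dual_carrier" if "f \<in> M.dual_carrier" for f
    by (rule M.restrict_in_dual[OF N that])
  have res_add: "?res (f + g) = ?res f + ?res g" and res_scale: "?res (fscale c f) = fscale c (?res f)" for f g c
    by (auto simp: M.restrict_def fscale_def)
  have p_linear: "linear_on fscale fscale X1.C p"
    unfolding linear_on_def h1.carrier_N
  proof (intro conjI ballI allI)
    fix x y assume "x \<in> h1 ` M.dual_carrier" "y \<in> h1 ` M.dual_carrier"
    then obtain f g where fg: "x = h1 f" "y = h1 g" "f \<in> M.dual_carrier" "g \<in> M.dual_carrier" by blast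
    have fg': "f + g \<in> M.dual_carrier" by (rule fs.subspace_add[OF M.dual_subspace fg(3,4)])
    show "p (x + y) = p x + p y"
      unfolding fg(1,2) h1.add[OF fg(3,4), symmetric] p_h1[OF fg(3)] p_h1[OF fg(4)] p_h1[OF fg'] res_add
      by (rule h2.add[OF res[OF fg(3)] res[OF fg(4)]])
  next
    fix c x assume "x \<in> h1 ` M.dual_carrier"
    then obtain f where f: "x = h1 f" "f \<in> M.dual_carrier" by blast
    have f': "fscale c f \<in> M.dual_carrier" by (rule fs.subspace_scale[OF M.dual_subspace f(2)])
    show "p (fscale c x) = fscale c (p x)"
      unfolding f(1) h1.scale[OF f(2), symmetric] p_h1[OF f(2)] p_h1[OF f'] res_scale
      by (rule h2.scale[OF res[OF f(2)]])
  qed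
  have p_surj: "p ` X1.C = X2.C"
  proof -
    have "p ` X1.C = h2 ` (?res ` M.dual_carrier)"
      unfolding h1.carrier_N image_image by (rule image_cong) (simp_all add: p_h1)
    then show ?thesis unfolding h2.carrier_N M.restrict_surj[OF N] .
  qed
  have p_hom: "p (X1.Y v n x) = X2.Y v n (p x)" if "x \<in> X1.C" for v n x
  proof -
    obtain f where f: "f \<in> M.dual_carrier" "x = h1 f" using \<open>x \<in> X1.C\<close> by (auto simp: h1.carrier_N)
    show ?thesis
      unfolding f(2) h1.mode_N[OF f(1)] p_h1[OF f(1)] p_h1[OF M.contra_closed[OF f(1)]]
        h2.mode_N[OF res[OF f(1)]] M.restrict_mode[OF N f(1)] ..
  qed

  have nodal: "\<psi> (tensor x y) = 0"
    if \<psi>: "\<psi> \<in> nodal_blocks V (tensor_space X1.C Y.C) (tensor_mode ?X1 ?Y)"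
      and x: "x \<in> X1.C" and y: "y \<in> Y.C" and px: "p x = 0" for \<psi> x y
  proof -
    note nb = nodal_blocks_iff[OF X1.voa_module_axioms Y.voa_module_axioms, THEN iffD1, OF \<psi>]
    have d: "\<psi> \<in> dual_space (tensor_space X1.C Y.C)" using nb by blast
    interpret l: linear_map_on fscale "(*)" "tensor_space X1.C Y.C" \<psi>
      by (rule dual_space_linear[OF X1.subspace Y.subspace d])
    have T_in: "tensor (h1 f) y \<in> tensor_space X1.C Y.C" if "f \<in> M.dual_carrier" for f
      by (rule tensor_in[OF X1.subspace Y.subspace _ y]) (use that in \<open>simp add: h1.carrier_N\<close>)
    obtain f where f: "f \<in> M.dual_carrier" "x = h1 f" using x by (auto simp: h1.carrier_N)
    have "h2 (?res f) = h2 0" using px p_h1[OF f(1)] f(2) by simp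
    then have res0: "?res f = 0"
      using inj_onD[OF h2.inj _ res[OF f(1)] fs.subspace_0[OF N.dual_subspace]] by blast
    \<comment> \<open>For fixed \<open>y\<close> the block is a functional on \<open>M'\<close> that
      kills the images of the raising modes. Zero restriction to \<open>N\<close> makes
      \<open>f\<close> vanish on \<open>\<Omega>(M)\<close>, so the duality lemma applies.\<close>
    have "\<psi> (tensor (h1 f) y) = 0"
    proof (rule M.dual_coinvariant_vanishes[where g = "\<lambda>f. \<psi> (tensor (h1 f) y)"])
      have "tensor (x + x') y = tensor x y + tensor x' y" for x x' :: "nat \<Rightarrow> complex"
        by (auto simp: tensor_def algebra_simps)
      then show "linear_on fscale (*) M.dual_carrier (\<lambda>f. \<psi> (tensor (h1 f) y))"
        unfolding linear_on_def
        using T_in by (simp add: h1.add h1.scale tensor_fscale l.add l.scale)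
      show "\<psi> (tensor (h1 (mmode M.contragredient v n f)) y) = 0"
        if "f \<in> M.dual_carrier" "v \<in> wt_space V k" "int k - n - 1 > 0" for k v n f
      proof -
        have "h1 f \<in> X1.C" using that(1) by (simp add: h1.carrier_N)
        then have "\<psi> (tensor (X1.Y v n (h1 f)) y) = 0" using nb y that(2,3) by blast
        then show ?thesis by (simp only: h1.mode_N[OF that(1)])
      qed
      show "f u = 0" if "u \<in> Omega V M" for u
        using fun_cong[OF res0, of u] Omega_N that by (auto simp: M.restrict_def)
    qed (rule f(1))
    then show ?thesis by (simp only: f(2))
  qed

  \<comment> \<open>The evaluation pairing of \<open>M'\<close> with \<open>M\<close>, read through
    the embeddings. It is invariant because the modes on \<open>M'\<close> are the transposes of
    opposite modes.\<close>
  define \<beta> where "\<beta> x y = (inv_into M.dual_carrier h1 x) (inv_into M.C h3 y)" for x y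
  have \<beta>: "\<beta> (h1 f) (h3 y) = f y" if "f \<in> M.dual_carrier" "y \<in> M.C" for f y
    unfolding \<beta>_def inv_into_f_f[OF h1.inj that(1)] inv_into_f_f[OF h3.inj that(2)] ..
  have left: "linear_on fscale (*) X1.C (\<lambda>x. \<beta> x y)" if "y \<in> Y.C" for y
    unfolding linear_on_def h1.carrier_N
  proof (intro conjI ballI allI)
    obtain u where u: "u \<in> M.C" "y = h3 u" using \<open>y \<in> Y.C\<close> by (auto simp: h3.carrier_N)
    show "\<beta> (x + x') y = \<beta> x y + \<beta> x' y" if x: "x \<in> h1 ` M.dual_carrier" "x' \<in> h1 ` M.dual_carrier" for x x'
    proof -
      obtain f g where fg: "x = h1 f" "x' = h1 g" "f \<in> M.dual_carrier" "g \<in> M.dual_carrier" using x by blast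
      show ?thesis
        unfolding fg(1,2) u(2) h1.add[OF fg(3,4), symmetric] \<beta>[OF fg(3) u(1)] \<beta>[OF fg(4) u(1)]
          \<beta>[OF fs.subspace_add[OF M.dual_subspace fg(3,4)] u(1)] by simp
    qed
    show "\<beta> (fscale c x) y = c * \<beta> x y" if x: "x \<in> h1 ` M.dual_carrier" for c x
    proof -
      obtain f where f: "x = h1 f" "f \<in> M.dual_carrier" using x by blast
      show ?thesis
        unfolding f(1) u(2) h1.scale[OF f(2), symmetric] \<beta>[OF f(2) u(1)]
          \<beta>[OF fs.subspace_scale[OF M.dual_subspace f(2)] u(1)] by (simp add: fscale_def)
    qed
  qed
  have right: "linear_on fscale (*) Y.C (\<beta> x)" if "x \<in> X1.C" for x
    unfolding linear_on_def h3.carrier_N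
  proof (intro conjI ballI allI)
    obtain f where f: "f \<in> M.dual_carrier" "x = h1 f" using \<open>x \<in> X1.C\<close> by (auto simp: h1.carrier_N)
    interpret f: linear_map_on s "(*)" M.C f by (rule M.dual_carrier_linear[OF f(1)])
    show "\<beta> x (y + y') = \<beta> x y + \<beta> x y'" if y: "y \<in> h3 ` M.C" "y' \<in> h3 ` M.C" for y y'
    proof -
      obtain u v where u: "y = h3 u" "y' = h3 v" "u \<in> M.C" "v \<in> M.C" using y by blast
      show ?thesis
        unfolding f(2) u(1,2) h3.add[OF u(3,4), symmetric] \<beta>[OF f(1) u(3)] \<beta>[OF f(1) u(4)]
          \<beta>[OF f(1) M.C_simps(1)[OF u(3,4)]] by (rule f.add[OF u(3,4)])
    qed
    show "\<beta> x (fscale c y) = c * \<beta> x y" if y: "y \<in> h3 ` M.C" for c y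
    proof -
      obtain u where u: "y = h3 u" "u \<in> M.C" using y by blast
      show ?thesis
        unfolding f(2) u(1) h3.scale[OF u(2), symmetric] \<beta>[OF f(1) u(2)]
          \<beta>[OF f(1) M.C_simps(3)[OF u(2)]] by (rule f.scale[OF u(2)])
    qed
  qed
  obtain \<psi>0 where \<psi>0: "\<psi>0 \<in> dual_space (tensor_space X1.C Y.C)"
    "\<And>x y. x \<in> X1.C \<Longrightarrow> y \<in> Y.C \<Longrightarrow> \<psi>0 (tensor x y) = \<beta> x y"
    using bilinear_functional_exists[OF X1.subspace Y.subspace left right] by blast
  have \<psi>0_smooth: "\<psi>0 \<in> smooth_blocks V ?X1 ?Y"
  proof -
    have "\<psi>0 (tensor (X1.Y v n x) y) = \<psi>0 (tensor x (Y.opp v n y))" if x: "x \<in> X1.C" and y: "y \<in> Y.C" for v n x y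
    proof -
      obtain f where f: "f \<in> M.dual_carrier" "x = h1 f" using x by (auto simp: h1.carrier_N)
      obtain u where u: "u \<in> M.C" "y = h3 u" using y by (auto simp: h3.carrier_N)
      have "\<beta> (X1.Y v n x) y = mmode M.contragredient v n f u"
        unfolding f(2) u(2) h1.mode_N[OF f(1)] by (rule \<beta>[OF M.contra_closed[OF f(1)] u(1)])
      also have "\<dots> = f (M.opp v n u)" using u(1) by (simp add: M.mode_contra)
      also have "\<dots> = \<beta> x (Y.opp v n y)"
        unfolding f(2) u(2) h3.opp_N[OF u(1)] by (rule \<beta>[OF f(1) M.opp_closed[OF u(1)], symmetric])
      finally show ?thesis using \<psi>0(2) x y X1.closed Y.opp_closed by simp
    qed
    then show ?thesis using \<psi>0(1) by (simp add: smooth_blocks_def)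
  qed
  \<comment> \<open>\<open>f0\<close> lies in the kernel of restriction but is nonzero at
    \<open>w\<close>, so the evaluation pairing is no pullback from \<open>N'\<close>.\<close>
  obtain f0 where f0: "f0 \<in> M.dual_carrier" "\<And>x. x \<in> N \<Longrightarrow> f0 x = 0" "f0 w \<noteq> 0"
    using M.vsubmodule_separated[OF N wG] w_notin unfolding N_def by blast
  have x0: "h1 f0 \<in> X1.C" "h3 w \<in> Y.C" using f0(1) wC by (auto simp: h1.carrier_N h3.carrier_N)
  have px0: "p (h1 f0) = 0"
  proof -
    have "?res f0 = 0" using f0(2) by (auto simp: M.restrict_def)
    then show ?thesis by (simp add: p_h1[OF f0(1)])
  qed
  have nz: "\<psi>0 (tensor (h1 f0) (h3 w)) \<noteq> 0" using \<psi>0(2)[OF x0] \<beta>[OF f0(1) wC] f0(3) by simp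

  have fin: "finite_dim fscale (smooth_blocks V ?X1 ?Y)"
  proof -
    let ?K = "gen_eigenspace V fscale M.contragredient a"
    obtain F where F: "finite F" "F \<subseteq> ?K" "?K \<subseteq> fs.span F" "fs.independent F"
      unfolding h1.gen_eigenspace_eq by (rule h1.finite_basis_G)
    have KD: "?K \<subseteq> M.dual_carrier" unfolding h1.gen_eigenspace_eq by (rule h1.E.G_subset)
    \<comment> \<open>The evaluation points pair a basis of the weight \<open>a\<close> space of
      \<open>M'\<close> with the generator \<open>w\<close>;
      \<open>invariant_pairing_vanishes\<close> shows that no nonzero block vanishes at all of
      them.\<close>
    show ?thesis
    proof (rule finite_dim_eval)
      show "fs.subspace (smooth_blocks V ?X1 ?Y)"
        by (rule smooth_blocks_subspace[OF X1.voa_module_axioms Y.voa_module_axioms])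
      show "finite ((\<lambda>f. tensor (h1 f) (h3 w)) ` F)" using F(1) by simp
      fix \<psi> assume \<psi>: "\<psi> \<in> smooth_blocks V ?X1 ?Y"
        and zero: "\<And>e. e \<in> (\<lambda>f. tensor (h1 f) (h3 w)) ` F \<Longrightarrow> \<psi> e = 0"
      have d: "\<psi> \<in> dual_space (tensor_space X1.C Y.C)"
        and inv: "\<And>v n x y. x \<in> X1.C \<Longrightarrow> y \<in> Y.C \<Longrightarrow> \<psi> (tensor (X1.Y v n x) y) = \<psi> (tensor x (Y.opp v n y))"
        using \<psi> by (auto simp: smooth_blocks_def)
      interpret l: linear_map_on fscale "(*)" "tensor_space X1.C Y.C" \<psi>
        by (rule dual_space_linear[OF X1.subspace Y.subspace d])
      let ?b = "\<lambda>f y. \<psi> (tensor (h1 f) (h3 y))"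
      have T_in: "tensor (h1 f) (h3 y) \<in> tensor_space X1.C Y.C" if "f \<in> M.dual_carrier" "y \<in> M.C" for f y
        by (rule tensor_in[OF X1.subspace Y.subspace]) (use that in \<open>simp_all add: h1.carrier_N h3.carrier_N\<close>)
      have add_left: "tensor (x + x') y = tensor x y + tensor x' y" for x x' y :: "nat \<Rightarrow> complex"
        by (auto simp: tensor_def algebra_simps)
      have b_left: "linear_on fscale (*) M.dual_carrier (\<lambda>f. ?b f y)" if "y \<in> M.C" for y
        unfolding linear_on_def
        using T_in that by (simp add: h1.add h1.scale add_left tensor_fscale l.add l.scale)
      have b_right: "linear_on s (*) M.C (?b f)" if "f \<in> M.dual_carrier" for f
        unfolding linear_on_def
        using T_in that by (simp add: h3.add h3.scale tensor_add tensor_fscale l.add l.scale)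
      have b_inv: "?b (mmode M.contragredient v n f) y = ?b f (M.opp v n y)"
        if "f \<in> M.dual_carrier" "y \<in> M.C" for f y v n
        using inv[of "h1 f" "h3 y" v n] that
        by (simp add: h1.carrier_N h3.carrier_N h1.mode_N[OF that(1)] h3.opp_N[OF that(2)])
      interpret bw: linear_map_on fscale "(*)" M.dual_carrier "\<lambda>f. ?b f w"
        by (rule linear_map_onI[OF vector_space_fscale vector_space_mult M.dual_subspace b_left[OF wC]])
      have bK: "?b f w = 0" if "f \<in> ?K" for f
      proof (rule bw.zero_on_span[of F])
        show "F \<subseteq> M.dual_carrier" using F(2) KD by blast
        show "f \<in> fs.span F" using that F(3) by blast
      qed (use zero in blast)
      have b0: "?b f y = 0" if "f \<in> M.dual_carrier" "y \<in> M.C" for f y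
        by (rule M.invariant_pairing_vanishes[where b = ?b, OF b_left b_right b_inv wG cyclic bK that])
      show "\<psi> = 0"
      proof (rule dual_space_eqI[OF X1.subspace Y.subspace d fs.subspace_0[OF dual_space_subspace]])
        fix x y assume "x \<in> X1.C" "y \<in> Y.C"
        then show "\<psi> (tensor x y) = 0 (tensor x y)"
          using b0 by (auto simp: h1.carrier_N h3.carrier_N)
      qed
    qed
  qed

  have smooth_less: "fs.dim (smooth_blocks V ?X2 ?Y) < fs.dim (smooth_blocks V ?X1 ?Y)"
    by (rule blocks_pullback(1)[OF X1.voa_module_axioms X2.voa_module_axioms Y.voa_module_axioms
          p_linear p_surj _ _ \<psi>0_smooth x0 px0 nz fin]) (fact p_hom, fact nodal)
  have nodal_eq: "fs.dim (nodal_blocks V (tensor_space X2.C Y.C) (tensor_mode ?X2 ?Y)) =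
      fs.dim (nodal_blocks V (tensor_space X1.C Y.C) (tensor_mode ?X1 ?Y))"
    by (rule blocks_pullback(2)[OF X1.voa_module_axioms X2.voa_module_axioms Y.voa_module_axioms
          p_linear p_surj _ _ \<psi>0_smooth x0 px0 nz fin]) (fact p_hom, fact nodal)
  \<comment> \<open>If the dimensions agree for \<open>?X1\<close>, they differ for
    \<open>?X2\<close>: the smooth one has dropped and the nodal one has not changed.\<close>
  show ?thesis
  proof (cases "vector_space.dim fscale (smooth_blocks V ?X1 ?Y) =
      vector_space.dim fscale (nodal_blocks V (tensor_space X1.C Y.C) (tensor_mode ?X1 ?Y))")
    case True
    then show ?thesis
      using smooth_less nodal_eq X2.gr_module_axioms Y.gr_module_axioms
      by (intro exI[of _ ?X2] exI[of _ ?Y]) auto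
  next
    case False
    then show ?thesis using X1.gr_module_axioms Y.gr_module_axioms by blast
  qed
qed

end
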